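(* The Lie superalgebra $\mathrm{Vec}(\mathcal M)$ of holomorphic super vector fields on a compact complex supermanifold $\mathcal M$ is finite-dimensional.
   Context: A complex supermanifold $\mathcal M=(M,\mathcal O_{\mathcal M})$ of dimension $(m|n)$ is a complex manifold $M$ with a sheaf $\mathcal O_{\mathcal M}$ of $\mathbb Z_2$-graded algebras which is locally, on small open $U\subset M$, isomorphic to $\mathcal O_U\otimes\bigwedge\mathbb C^n$, with $\mathcal O_U$ the sheaf of holomorphic functions; it is compact if $M$ is compact. $\mathrm{Vec}(\mathcal M)=\mathcal T_{\mathcal M}(M)$ is the space of global sections of the tangent sheaf $\mathcal T_{\mathcal M}$ (the sheaf of superderivations of $\mathcal O_{\mathcal M}$); finite-dimensionality is over $\mathbb C$. *)

theory Defs
  imports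
    "HOL-Analysis.Analysis"
    "HOL-Algebra.Module"
    "HOL-Library.Z2"
begin

section \<open>Complex vector spaces and superalgebras\<close>

definition complex_field :: "complex ring" where
  "complex_field = \<lparr>carrier = UNIV, monoid.mult = (*), one = 1, ring.zero = 0, add = (+)\<rparr>"

definition complex_finite_dimensional :: "(complex, 'b, 'm) module_scheme \<Rightarrow> bool" where
  "complex_finite_dimensional V \<longleftrightarrow>
     Module.module complex_field V \<and>
     (\<exists>B. finite B \<and> B \<subseteq> carrier V \<and>
       (\<forall>v\<in>carrier V. \<exists>c. v = (\<Oplus>\<^bsub>V\<^esub>b\<in>B. c b \<odot>\<^bsub>V\<^esub> b)))"

text \<open>
  The field \<open>homog\<close> gives the homogeneous parts, indexed by \<open>\<int>/2\<close>: \<open>homog A 0\<close> is the even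
  and \<open>homog A 1\<close> the odd part. The record serves both for the associative algebras of functions
  and for Lie superalgebras; for the latter \<open>mult\<close> is the bracket and \<open>one\<close> has no meaning.
\<close>

record ('c, 'b) superalgebra = "('c, 'b) module" +
  homog :: "bit \<Rightarrow> 'b set"

definition koszul_sign :: "bit \<Rightarrow> bit \<Rightarrow> complex" where
  "koszul_sign i j = (if i = 1 \<and> j = 1 then - 1 else 1)"

text \<open>Supercommutativity is not an axiom; for supermanifolds it follows from the local model.\<close>

locale complex_superalgebra = ring A + Module.module complex_field A
  for A :: "(complex, 'b, 'x) superalgebra_scheme" (structure) +
  assumes smult_mult_left:
      "\<lbrakk>x \<in> carrier A; y \<in> carrier A\<rbrakk> \<Longrightarrow> (c \<odot> x) \<otimes> y = c \<odot> (x \<otimes> y)"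
    and smult_mult_right:
      "\<lbrakk>x \<in> carrier A; y \<in> carrier A\<rbrakk> \<Longrightarrow> x \<otimes> (c \<odot> y) = c \<odot> (x \<otimes> y)"
    and homog_submodule: "submodule (homog A i) complex_field A"
    and homog_decomposition:
      "x \<in> carrier A \<Longrightarrow> \<exists>!(y, z). y \<in> homog A 0 \<and> z \<in> homog A 1 \<and> x = y \<oplus> z"
    and homog_mult:
      "\<lbrakk>x \<in> homog A i; y \<in> homog A j\<rbrakk> \<Longrightarrow> x \<otimes> y \<in> homog A (i + j)"

definition complex_linear ::
  "(complex, 'a, 'm) module_scheme \<Rightarrow> (complex, 'b, 'n) module_scheme \<Rightarrow> ('a \<Rightarrow> 'b) \<Rightarrow> bool" where
  "complex_linear A B h \<longleftrightarrow>
     h \<in> carrier A \<rightarrow> carrier B \<and>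
     (\<forall>x\<in>carrier A. \<forall>y\<in>carrier A. h (x \<oplus>\<^bsub>A\<^esub> y) = h x \<oplus>\<^bsub>B\<^esub> h y) \<and>
     (\<forall>c. \<forall>x\<in>carrier A. h (c \<odot>\<^bsub>A\<^esub> x) = c \<odot>\<^bsub>B\<^esub> h x)"

definition superalgebra_hom ::
  "(complex, 'a) superalgebra \<Rightarrow> (complex, 'b) superalgebra \<Rightarrow> ('a \<Rightarrow> 'b) set" where
  "superalgebra_hom A B =
     {h \<in> ring_hom A B. complex_linear A B h \<and> (\<forall>i. h ` homog A i \<subseteq> homog B i)}"

definition superalgebra_iso ::
  "(complex, 'a) superalgebra \<Rightarrow> (complex, 'b) superalgebra \<Rightarrow> ('a \<Rightarrow> 'b) set" where
  "superalgebra_iso A B = {h \<in> superalgebra_hom A B. bij_betw h (carrier A) (carrier B)}"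


section \<open>Holomorphic functions and complex manifolds\<close>

text \<open>
  \<open>\<complex>\<^sup>m\<close> consists of the functions on \<open>{..<m}\<close>, extended by \<open>undefined\<close>; this includes
  \<open>m = 0\<close>, where it is a single point.
\<close>

definition complex_space :: "nat \<Rightarrow> (nat \<Rightarrow> complex) topology" where
  "complex_space m = product_topology (\<lambda>_. euclidean) {..<m}"

definition complex_differentiable_at ::
  "nat \<Rightarrow> ((nat \<Rightarrow> complex) \<Rightarrow> complex) \<Rightarrow> (nat \<Rightarrow> complex) \<Rightarrow> bool" where
  "complex_differentiable_at m f z \<longleftrightarrow>
     (\<exists>a. ((\<lambda>w. cmod (f w - f z - (\<Sum>i<m. a i * (w i - z i))) / (\<Sum>i<m. cmod (w i - z i)))
           \<longlongrightarrow> 0) (atin (complex_space m) z))"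

definition holomorphic_in :: "nat \<Rightarrow> (nat \<Rightarrow> complex) set \<Rightarrow> ((nat \<Rightarrow> complex) \<Rightarrow> complex) \<Rightarrow> bool" where
  "holomorphic_in m W f \<longleftrightarrow>
     openin (complex_space m) W \<and> (\<forall>z\<in>W. complex_differentiable_at m f z)"

record 'p complex_mfd =
  base :: "'p topology"
  charts :: "('p set \<times> ('p \<Rightarrow> nat \<Rightarrow> complex)) set"

locale complex_manifold =
  fixes m :: nat and M :: "('p, 'x) complex_mfd_scheme"
  assumes hausdorff: "Hausdorff_space (base M)"
    and second_countable: "second_countable (base M)"
    and charts_cover: "(\<Union>(U, \<phi>)\<in>charts M. U) = topspace (base M)"
    and chart_domain: "(U, \<phi>) \<in> charts M \<Longrightarrow> openin (base M) U"
    and chart_image: "(U, \<phi>) \<in> charts M \<Longrightarrow> openin (complex_space m) (\<phi> ` U)"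
    and chart_homeomorphism: "(U, \<phi>) \<in> charts M \<Longrightarrow>
      homeomorphic_map (subtopology (base M) U) (subtopology (complex_space m) (\<phi> ` U)) \<phi>"
    and transition_holomorphic: "\<lbrakk>(U, \<phi>) \<in> charts M; (V, \<psi>) \<in> charts M; i < m\<rbrakk> \<Longrightarrow>
      holomorphic_in m (\<phi> ` (U \<inter> V)) (\<lambda>z. \<psi> (inv_into U \<phi> z) i)"

definition holomorphic_fun ::
  "nat \<Rightarrow> ('p, 'x) complex_mfd_scheme \<Rightarrow> 'p set \<Rightarrow> ('p \<Rightarrow> complex) \<Rightarrow> bool" where
  "holomorphic_fun m M W f \<longleftrightarrow>
     (\<forall>(U, \<phi>)\<in>charts M. holomorphic_in m (\<phi> ` (U \<inter> W)) (\<lambda>z. f (inv_into U \<phi> z)))"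


section \<open>The local model\<close>

text \<open>
  The exterior algebra \<open>\<Lambda>\<complex>\<^sup>n\<close> in its standard basis: an element is the family of its
  coefficients at \<open>e\<^sub>S = e\<^bsub>s\<^sub>1\<^esub> \<and> \<dots> \<and> e\<^bsub>s\<^sub>k\<^esub>\<close>, where \<open>S = {s\<^sub>1 < \<dots> < s\<^sub>k} \<subseteq> {..<n}\<close>. One has
  \<open>e\<^sub>S \<and> e\<^sub>T = shuffle_sign S T e\<^bsub>S \<union> T\<^esub>\<close> for disjoint \<open>S\<close> and \<open>T\<close>, and \<open>0\<close> otherwise.
\<close>

definition exterior_carrier :: "nat \<Rightarrow> (nat set \<Rightarrow> complex) set" where
  "exterior_carrier n = {a. \<forall>S. \<not> S \<subseteq> {..<n} \<longrightarrow> a S = 0}"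

definition shuffle_sign :: "nat set \<Rightarrow> nat set \<Rightarrow> complex" where
  "shuffle_sign S T = (- 1) ^ card {(i, j) \<in> S \<times> T. j < i}"

definition wedge :: "(nat set \<Rightarrow> complex) \<Rightarrow> (nat set \<Rightarrow> complex) \<Rightarrow> nat set \<Rightarrow> complex" where
  "wedge a b = (\<lambda>S. \<Sum>T\<in>Pow S. shuffle_sign T (S - T) * a T * b (S - T))"

text \<open>
  The sections of \<open>\<O> \<otimes> \<Lambda>\<complex>\<^sup>n\<close> over \<open>W\<close>, for \<open>\<O>\<close> the sheaf of holomorphic functions on \<open>M\<close>, as
  the \<open>\<Lambda>\<complex>\<^sup>n\<close>-valued functions on \<open>W\<close> with holomorphic coefficients.
\<close>

definition model_carrier ::
  "nat \<Rightarrow> nat \<Rightarrow> ('p, 'x) complex_mfd_scheme \<Rightarrow> 'p set \<Rightarrow> ('p \<Rightarrow> nat set \<Rightarrow> complex) set" where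
  "model_carrier m n M W =
     {f \<in> W \<rightarrow>\<^sub>E exterior_carrier n. \<forall>S. holomorphic_fun m M W (\<lambda>x. f x S)}"

definition model_sheaf ::
  "nat \<Rightarrow> nat \<Rightarrow> ('p, 'x) complex_mfd_scheme \<Rightarrow> 'p set
     \<Rightarrow> (complex, 'p \<Rightarrow> nat set \<Rightarrow> complex) superalgebra" where
  "model_sheaf m n M W =
     \<lparr>carrier = model_carrier m n M W,
      monoid.mult = (\<lambda>f g. \<lambda>x\<in>W. wedge (f x) (g x)),
      one = (\<lambda>x\<in>W. \<lambda>S. if S = {} then 1 else 0),
      ring.zero = (\<lambda>x\<in>W. \<lambda>S. 0),
      add = (\<lambda>f g. \<lambda>x\<in>W. \<lambda>S. f x S + g x S),
      smult = (\<lambda>c f. \<lambda>x\<in>W. \<lambda>S. c * f x S),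
      homog = (\<lambda>i. {f \<in> model_carrier m n M W.
                 \<forall>x\<in>W. \<forall>S. f x S \<noteq> 0 \<longrightarrow> of_nat (card S) = i})\<rparr>"


section \<open>Complex supermanifolds\<close>

text \<open>
  The map \<open>restr M U V\<close> is the restriction from \<open>sections M U\<close> to \<open>sections M V\<close>. The algebras of
  all open sets share one carrier type \<open>'s\<close>; this is no restriction, since \<open>'s\<close> may be taken large
  enough to hold their disjoint union. In the sheaf axiom \<open>gluing\<close>, existence is gluing
  and uniqueness is locality.
\<close>

record ('p, 's) supermfd = "'p complex_mfd" +
  sections :: "'p set \<Rightarrow> (complex, 's) superalgebra"
  restr :: "'p set \<Rightarrow> 'p set \<Rightarrow> 's \<Rightarrow> 's"

locale complex_supermanifold = complex_manifold m M
  for m :: nat and n :: nat and M :: "('p, 's) supermfd" +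
  assumes sections_superalgebra: "openin (base M) U \<Longrightarrow> complex_superalgebra (sections M U)"
    and restr_hom: "\<lbrakk>openin (base M) U; openin (base M) V; V \<subseteq> U\<rbrakk> \<Longrightarrow>
      restr M U V \<in> superalgebra_hom (sections M U) (sections M V)"
    and restr_id: "\<lbrakk>openin (base M) U; f \<in> carrier (sections M U)\<rbrakk> \<Longrightarrow> restr M U U f = f"
    and restr_restr: "\<lbrakk>openin (base M) U; openin (base M) V; openin (base M) W; W \<subseteq> V; V \<subseteq> U;
      f \<in> carrier (sections M U)\<rbrakk> \<Longrightarrow> restr M V W (restr M U V f) = restr M U W f"
    and gluing: "\<lbrakk>\<And>V. V \<in> \<U> \<Longrightarrow> openin (base M) V;
      \<And>V. V \<in> \<U> \<Longrightarrow> s V \<in> carrier (sections M V);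
      \<And>V W. \<lbrakk>V \<in> \<U>; W \<in> \<U>\<rbrakk> \<Longrightarrow> restr M V (V \<inter> W) (s V) = restr M W (V \<inter> W) (s W)\<rbrakk> \<Longrightarrow>
      \<exists>!f. f \<in> carrier (sections M (\<Union>\<U>)) \<and> (\<forall>V\<in>\<U>. restr M (\<Union>\<U>) V f = s V)"
    and locally_split: "x \<in> topspace (base M) \<Longrightarrow>
      \<exists>U \<theta>. openin (base M) U \<and> x \<in> U \<and>
        (\<forall>V. openin (base M) V \<and> V \<subseteq> U \<longrightarrow>
          \<theta> V \<in> superalgebra_iso (sections M V) (model_sheaf m n M V)) \<and>
        (\<forall>V W. openin (base M) V \<and> openin (base M) W \<and> W \<subseteq> V \<and> V \<subseteq> U \<longrightarrow>
          (\<forall>f\<in>carrier (sections M V). \<theta> W (restr M V W f) = restrict (\<theta> V f) W))"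


section \<open>The tangent sheaf\<close>

definition opens_in :: "('p, 's) supermfd \<Rightarrow> 'p set \<Rightarrow> 'p set set" where
  "opens_in M U = {V. openin (base M) V \<and> V \<subseteq> U}"

text \<open>
  A section of the tangent sheaf over \<open>U\<close> is a superderivation of the sheaf of algebras restricted
  to \<open>U\<close>: a family of maps \<open>D V\<close> on \<open>sections M V\<close>, for \<open>V \<subseteq> U\<close> open, compatible with restrictions.
  Outside these arguments \<open>D\<close> is \<open>undefined\<close>, so that equality of families is equality of
  superderivations.
\<close>

definition homogeneous_superderivations ::
  "('p, 's) supermfd \<Rightarrow> 'p set \<Rightarrow> bit \<Rightarrow> ('p set \<Rightarrow> 's \<Rightarrow> 's) set" where
  "homogeneous_superderivations M U i =
     {D \<in> extensional (opens_in M U).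
       (\<forall>V\<in>opens_in M U.
          D V \<in> extensional (carrier (sections M V)) \<and>
          complex_linear (sections M V) (sections M V) (D V) \<and>
          (\<forall>j. D V ` homog (sections M V) j \<subseteq> homog (sections M V) (i + j)) \<and>
          (\<forall>j. \<forall>f\<in>homog (sections M V) j. \<forall>g\<in>carrier (sections M V).
             D V (f \<otimes>\<^bsub>sections M V\<^esub> g) =
               (D V f \<otimes>\<^bsub>sections M V\<^esub> g) \<oplus>\<^bsub>sections M V\<^esub>
               koszul_sign i j \<odot>\<^bsub>sections M V\<^esub> (f \<otimes>\<^bsub>sections M V\<^esub> D V g))) \<and>
       (\<forall>V\<in>opens_in M U. \<forall>W\<in>opens_in M V. \<forall>f\<in>carrier (sections M V).
          restr M V W (D V f) = D W (restr M V W f))}"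

definition der_zero :: "('p, 's) supermfd \<Rightarrow> 'p set \<Rightarrow> 'p set \<Rightarrow> 's \<Rightarrow> 's" where
  "der_zero M U = (\<lambda>V\<in>opens_in M U. \<lambda>f\<in>carrier (sections M V). \<zero>\<^bsub>sections M V\<^esub>)"

definition der_add ::
  "('p, 's) supermfd \<Rightarrow> 'p set \<Rightarrow> ('p set \<Rightarrow> 's \<Rightarrow> 's) \<Rightarrow> ('p set \<Rightarrow> 's \<Rightarrow> 's) \<Rightarrow> 'p set \<Rightarrow> 's \<Rightarrow> 's" where
  "der_add M U D E =
     (\<lambda>V\<in>opens_in M U. \<lambda>f\<in>carrier (sections M V). D V f \<oplus>\<^bsub>sections M V\<^esub> E V f)"

definition der_smult ::
  "('p, 's) supermfd \<Rightarrow> 'p set \<Rightarrow> complex \<Rightarrow> ('p set \<Rightarrow> 's \<Rightarrow> 's) \<Rightarrow> 'p set \<Rightarrow> 's \<Rightarrow> 's" where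
  "der_smult M U c D =
     (\<lambda>V\<in>opens_in M U. \<lambda>f\<in>carrier (sections M V). c \<odot>\<^bsub>sections M V\<^esub> D V f)"

definition superderivations :: "('p, 's) supermfd \<Rightarrow> 'p set \<Rightarrow> ('p set \<Rightarrow> 's \<Rightarrow> 's) set" where
  "superderivations M U =
     {der_add M U D E | D E.
       D \<in> homogeneous_superderivations M U 0 \<and> E \<in> homogeneous_superderivations M U 1}"

definition der_component ::
  "('p, 's) supermfd \<Rightarrow> 'p set \<Rightarrow> bit \<Rightarrow> ('p set \<Rightarrow> 's \<Rightarrow> 's) \<Rightarrow> 'p set \<Rightarrow> 's \<Rightarrow> 's" where
  "der_component M U i D =
     (THE D'. D' \<in> homogeneous_superderivations M U i \<and>
        (\<exists>E\<in>homogeneous_superderivations M U (i + 1). D = der_add M U D' E))"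

text \<open>
  The bilinear extension of \<open>[D, E] = D \<circ> E - (- 1)\<^bsup>|D| |E|\<^esup> E \<circ> D\<close>.
\<close>

definition der_bracket ::
  "('p, 's) supermfd \<Rightarrow> 'p set \<Rightarrow> ('p set \<Rightarrow> 's \<Rightarrow> 's) \<Rightarrow> ('p set \<Rightarrow> 's \<Rightarrow> 's) \<Rightarrow> 'p set \<Rightarrow> 's \<Rightarrow> 's" where
  "der_bracket M U D E =
     (\<lambda>V\<in>opens_in M U. \<lambda>f\<in>carrier (sections M V).
        \<Oplus>\<^bsub>sections M V\<^esub>i\<in>UNIV. \<Oplus>\<^bsub>sections M V\<^esub>j\<in>UNIV.
          der_component M U i D V (der_component M U j E V f) \<ominus>\<^bsub>sections M V\<^esub>
          koszul_sign i j \<odot>\<^bsub>sections M V\<^esub>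
            der_component M U j E V (der_component M U i D V f))"

definition tangent_sheaf ::
  "('p, 's) supermfd \<Rightarrow> 'p set \<Rightarrow> (complex, 'p set \<Rightarrow> 's \<Rightarrow> 's) superalgebra" where
  "tangent_sheaf M U =
     \<lparr>carrier = superderivations M U,
      monoid.mult = der_bracket M U,
      one = undefined,
      ring.zero = der_zero M U,
      add = der_add M U,
      smult = der_smult M U,
      homog = homogeneous_superderivations M U\<rparr>"

definition Vec :: "('p, 's) supermfd \<Rightarrow> (complex, 'p set \<Rightarrow> 's \<Rightarrow> 's) superalgebra" where
  "Vec M = tangent_sheaf M (topspace (base M))"

end

theory Submission
  imports Defs "HOL-Complex_Analysis.Cauchy_Integral_Formula"
begin

text \<open>
  A superderivation is determined by finitely many of its coefficients, namely those of its values
  on the local coordinates at the points of a sufficiently fine finite net in \<open>M\<close>. These coefficients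
  are linear functionals that separate \<open>Vec M\<close>, so \<open>Vec M\<close> has finite dimension
  (\<open>complex_finite_dimensionalI\<close>).

  A change of splitting mixes the coefficients of a section with their
  derivatives, so the coefficients of a superderivation \<open>D\<close> at a point in one chart do not determine
  those in another. This changes in lowest degree. Suppose that all values of \<open>D\<close> have degree at least
  \<open>k\<close> in the odd coordinates, a condition that does not depend on the chart. The coefficients of
  degree \<open>k\<close> of \<open>D x\<^sub>a\<close> and \<open>D \<xi>\<^sub>b\<close> then transform linearly at each point, by matrices that are
  continuous and independent of \<open>D\<close> (\<open>leading_transition\<close>). Two facts enter. By Hadamard's lemma, in
  degree \<open>k\<close> the value \<open>D h\<close> at \<open>p\<close> depends only on the first-order part of \<open>h\<close> at \<open>p\<close>
  (\<open>leading_coefficient_formula\<close>). And the body of a section, its coefficient in degree \<open>0\<close>, is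
  intrinsic, because it is characterized by invertibility; so a change of splitting acts linearly on
  lowest-degree coefficients (\<open>transfer_leading\<close>).

  Cover \<open>M\<close> by finitely many coordinate discs of radius \<open>r\<^sub>j\<close> whose concentric closed
  discs of radius \<open>2 r\<^sub>j\<close> are still compact in their charts. By the linear transition, the maximum \<open>A\<close> of the
  degree-\<open>k\<close> coefficients over the large discs is at most \<open>C\<close> times their maximum over the small ones
  (\<open>uniform_transition\<close>). On the other hand, if the coefficients vanish on a \<open>\<delta>\<close>-net of the small
  disc, then Cauchy's estimate on complex lines bounds them there by \<open>2 A \<delta> / r\<^sub>j\<close>
  (\<open>small_if_zero_on_net\<close>). For \<open>\<delta> = r\<^sub>j / (4 (C + 1))\<close> the two bounds give \<open>A \<le> A / 2\<close>, that is,
  \<open>A = 0\<close>, and all values of \<open>D\<close> have degree at least \<open>k + 1\<close>. As \<open>C\<close> does not depend on \<open>k\<close>, the same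
  net serves in every degree, and after \<open>n + 1\<close> steps \<open>D = 0\<close> (\<open>zero_if_zero_on_net\<close>).

  A general element of \<open>Vec M\<close> is a sum of an even and an odd superderivation. The parity of a
  monomial tells which of the two contributes to its coefficient, so the vanishing of all
  coefficients of the sum is the vanishing of the coefficients of both parts.
\<close>

section \<open>Finite dimension from finitely many coordinates\<close>

text \<open>If finitely many linear functionals separate points, a spanning set is found by removing one
  functional at a time: either it vanishes, or its kernel has a complementary line.\<close>

lemma finite_span_if_separating_functionals:
  fixes V :: "(complex, 'b, 'm) module_scheme" (structure)
  assumes V: "Module.module complex_field V"
    and I: "finite I"
    and sub: "submodule W complex_field V"
    and add: "\<And>i x y. \<lbrakk>i \<in> I; x \<in> W; y \<in> W\<rbrakk> \<Longrightarrow> l i (x \<oplus> y) = (l i x + l i y :: complex)"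
    and smult: "\<And>i c x. \<lbrakk>i \<in> I; x \<in> W\<rbrakk> \<Longrightarrow> l i (c \<odot> x) = c * l i x"
    and sep: "\<And>x. \<lbrakk>x \<in> W; \<And>i. i \<in> I \<Longrightarrow> l i x = 0\<rbrakk> \<Longrightarrow> x = \<zero>"
  shows "\<exists>B. finite B \<and> B \<subseteq> W \<and> (\<forall>v\<in>W. \<exists>c. v = (\<Oplus>b\<in>B. c b \<odot> b))"
  using I sub add smult sep
proof (induction I arbitrary: W rule: finite_induct)
  case empty
  interpret V: Module.module complex_field V by fact
  show ?case
  proof (rule exI[of _ "{}"], intro conjI ballI)
    fix v assume v: "v \<in> W"
    have "v = \<zero>" by (rule empty.prems(4)[OF v]) simp
    also have "\<zero> = (\<Oplus>b\<in>{}. 0 \<odot> b)" by (rule V.finsum_empty[symmetric])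
    finally show "\<exists>c. v = (\<Oplus>b\<in>{}. c b \<odot> b)" by (rule exI[of _ "\<lambda>_. 0"])
  qed auto
next
  case (insert i I)
  interpret V: Module.module complex_field V by fact
  have car: "c \<in> carrier complex_field" for c by (simp add: complex_field_def)
  note W = V.submoduleE[OF insert.prems(1)]
  have WV: "x \<in> carrier V" if "x \<in> W" for x by (rule subsetD[OF W(1) that])
  have Wadd: "x \<oplus> y \<in> W" if "x \<in> W" "y \<in> W" for x y by (rule W(5)[OF that])
  have Wsm: "c \<odot> x \<in> W" if "x \<in> W" for x c by (rule W(4)[OF car that])
  show ?case
  proof (cases "\<forall>x\<in>W. l i x = 0")
    case True
    show ?thesis
    proof (rule insert.IH[OF insert.prems(1)])
      show "x = \<zero>" if "x \<in> W" "\<And>j. j \<in> I \<Longrightarrow> l j x = 0" for x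
        by (rule insert.prems(4)[OF that(1)]) (use that True in blast)
    qed (simp_all add: insert.prems(2,3))
  next
    case False
    then obtain v0 where v0: "v0 \<in> W" "l i v0 \<noteq> 0" by blast
    define K where "K = {x\<in>W. l i x = 0}"
    have mone: "(-1) \<odot> x = \<ominus> x" if "x \<in> carrier V" for x
    proof -
      have "\<ominus>\<^bsub>complex_field\<^esub> \<one>\<^bsub>complex_field\<^esub> = -1"
        by (rule V.R.minus_equality) (auto simp: complex_field_def)
      then show ?thesis using V.smult_l_minus[OF car, of x "\<one>\<^bsub>complex_field\<^esub>"] that by simp
    qed
    have K: "submodule K complex_field V"
    proof (rule V.submoduleI)
      show "K \<subseteq> carrier V" using WV by (auto simp: K_def)
      have "0 \<odot> v0 = \<zero>"
        using V.smult_l_null[OF WV[OF v0(1)]] by (simp add: complex_field_def)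
      then have "\<zero> \<in> W" "l i \<zero> = 0" using Wsm[OF v0(1), of 0] insert.prems(3)[of i v0 0] v0 by auto
      then show "\<zero> \<in> K" by (simp add: K_def)
      show "\<ominus> a \<in> K" if "a \<in> K" for a
        using that Wsm[of a "-1"] insert.prems(3)[of i a "-1"] mone[of a] WV by (auto simp: K_def)
      show "a \<oplus> b \<in> K" if "a \<in> K" "b \<in> K" for a b
        using that Wadd insert.prems(2)[of i] by (auto simp: K_def)
      show "a \<odot> x \<in> K" if "x \<in> K" for a x
        using that Wsm insert.prems(3)[of i] by (auto simp: K_def)
    qed
    have "\<exists>B. finite B \<and> B \<subseteq> K \<and> (\<forall>v\<in>K. \<exists>c. v = (\<Oplus>b\<in>B. c b \<odot> b))"
    proof (rule insert.IH[OF K])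
      show "x = \<zero>" if "x \<in> K" "\<And>j. j \<in> I \<Longrightarrow> l j x = 0" for x
        by (rule insert.prems(4)) (use that in \<open>auto simp: K_def\<close>)
    qed (simp_all add: K_def insert.prems(2,3))
    then obtain B where B: "finite B" "B \<subseteq> K" "\<And>v. v \<in> K \<Longrightarrow> \<exists>c. v = (\<Oplus>b\<in>B. c b \<odot> b)" by blast
    have v0B: "v0 \<notin> B" using B(2) v0 by (auto simp: K_def)
    have BW: "B \<subseteq> W" using B(2) by (auto simp: K_def)
    show ?thesis
    proof (rule exI[of _ "insert v0 B"], intro conjI ballI)
      show "finite (insert v0 B)" using B by simp
      show "insert v0 B \<subseteq> W" using BW v0 by simp
      fix v assume v: "v \<in> W"
      \<comment> \<open>\<open>v - a v0\<close> is the component of \<open>v\<close> in the kernel \<open>K\<close> of \<open>l i\<close>.\<close>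
      define a where "a = l i v / l i v0"
      have mem: "v \<oplus> (-a) \<odot> v0 \<in> K"
        using v v0 Wadd Wsm insert.prems(2,3)[of i] by (auto simp: K_def a_def)
      then obtain c where c: "v \<oplus> (-a) \<odot> v0 = (\<Oplus>b\<in>B. c b \<odot> b)" using B(3) by blast
      have fin: "(\<Oplus>b\<in>B. c b \<odot> b) \<in> carrier V"
        using mem WV c by (auto simp: K_def)
      have "a \<odot> v0 \<oplus> (v \<oplus> (-a) \<odot> v0) = (a \<odot> v0 \<oplus> (-a) \<odot> v0) \<oplus> v"
        using WV[OF v] WV[OF v0(1)] V.smult_closed[OF car]
        by (simp add: V.M.add.m_assoc V.M.add.m_comm V.M.add.m_lcomm)
      also have "a \<odot> v0 \<oplus> (-a) \<odot> v0 = 0 \<odot> v0"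
        using V.smult_l_distr[OF car car, of v0 a "-a"] WV[OF v0(1)] by (simp add: complex_field_def)
      also have "0 \<odot> v0 = \<zero>" 
        using V.smult_l_null[OF WV[OF v0(1)]] by (simp add: complex_field_def)
      finally have "v = a \<odot> v0 \<oplus> (\<Oplus>b\<in>B. c b \<odot> b)" using c WV[OF v] by simp
      also have "(\<Oplus>b\<in>B. c b \<odot> b) = (\<Oplus>b\<in>B. (c(v0 := a)) b \<odot> b)"
        by (rule V.M.add.finprod_cong') (use v0B BW WV V.smult_closed[OF car] in auto)
      also have "a \<odot> v0 \<oplus> \<dots> = (\<Oplus>b\<in>insert v0 B. (c(v0 := a)) b \<odot> b)"
      proof (subst V.finsum_insert[OF B(1) v0B])
        show "(\<lambda>b. (c(v0 := a)) b \<odot> b) \<in> B \<rightarrow> carrier V"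
          using V.smult_closed[OF car] WV subsetD[OF BW] by blast
      qed (use V.smult_closed[OF car] WV[OF v0(1)] in simp_all)
      finally show "\<exists>c. v = (\<Oplus>b\<in>insert v0 B. c b \<odot> b)"
        by (rule exI[of _ "c(v0 := a)"])
    qed
  qed
qed

corollary complex_finite_dimensionalI:
  fixes V :: "(complex, 'b, 'm) module_scheme" (structure)
  assumes V: "Module.module complex_field V"
    and I: "finite I"
    and add: "\<And>i x y. \<lbrakk>i \<in> I; x \<in> carrier V; y \<in> carrier V\<rbrakk> \<Longrightarrow> l i (x \<oplus> y) = (l i x + l i y :: complex)"
    and smult: "\<And>i c x. \<lbrakk>i \<in> I; x \<in> carrier V\<rbrakk> \<Longrightarrow> l i (c \<odot> x) = c * l i x"
    and sep: "\<And>x. \<lbrakk>x \<in> carrier V; \<And>i. i \<in> I \<Longrightarrow> l i x = 0\<rbrakk> \<Longrightarrow> x = \<zero>"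
  shows "complex_finite_dimensional V"
proof -
  interpret V: Module.module complex_field V by fact
  have "submodule (carrier V) complex_field V"
    by (rule V.carrier_is_submodule)
  then have "\<exists>B. finite B \<and> B \<subseteq> carrier V \<and> (\<forall>v\<in>carrier V. \<exists>c. v = (\<Oplus>b\<in>B. c b \<odot> b))"
  proof (rule finite_span_if_separating_functionals[where l = l, OF V I])
    show "l i (x \<oplus> y) = l i x + l i y" if "i \<in> I" "x \<in> carrier V" "y \<in> carrier V" for i x y
      using that by (rule add)
    show "l i (c \<odot> x) = c * l i x" if "i \<in> I" "x \<in> carrier V" for i c x
      using that by (rule smult)
    show "x = \<zero>" if "x \<in> carrier V" "\<And>i. i \<in> I \<Longrightarrow> l i x = 0" for x
      using that by (rule sep)
  qed
  then show ?thesis using V by (auto simp: complex_finite_dimensional_def)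
qed

section \<open>Several complex variables\<close>

text \<open>The \<open>l\<^sup>1\<close>-distance looks only at the first \<open>m\<close> coordinates and scales along complex lines, on
  which all estimates are made. Its balls, taken among extensional functions, generate the topology
  of \<open>complex_space m\<close>.\<close>

definition dist1 :: "nat \<Rightarrow> (nat \<Rightarrow> complex) \<Rightarrow> (nat \<Rightarrow> complex) \<Rightarrow> real" where
  "dist1 m w z = (\<Sum>i<m. cmod (w i - z i))"

definition ball1 :: "nat \<Rightarrow> (nat \<Rightarrow> complex) \<Rightarrow> real \<Rightarrow> (nat \<Rightarrow> complex) set" where
  "ball1 m z r = {w \<in> extensional {..<m}. dist1 m w z < r}"

lemma topspace_complex_space [simp]: "topspace (complex_space m) = extensional {..<m}"
  by (simp add: complex_space_def PiE_def)

lemma dist1_nonneg [simp]: "0 \<le> dist1 m w z"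
  by (simp add: dist1_def sum_nonneg)

lemma dist1_self [simp]: "dist1 m z z = 0"
  by (simp add: dist1_def)

lemma dist1_commute: "dist1 m w z = dist1 m z w"
  by (simp add: dist1_def norm_minus_commute)

lemma dist1_triangle: "dist1 m u w \<le> dist1 m u v + dist1 m v w"
  unfolding dist1_def sum.distrib[symmetric]
  by (rule sum_mono) (metis norm_diff_triangle_le order_refl)

lemma dist1_component: "i < m \<Longrightarrow> cmod (w i - z i) \<le> dist1 m w z"
  unfolding dist1_def by (rule member_le_sum[of i "{..<m}" "\<lambda>i. cmod (w i - z i)"]) auto

lemma dist1_eq_0_iff: "\<lbrakk>w \<in> extensional {..<m}; z \<in> extensional {..<m}\<rbrakk> \<Longrightarrow> dist1 m w z = 0 \<longleftrightarrow> w = z"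
  by (auto simp: dist1_def sum_nonneg_eq_0_iff intro: extensionalityI)

lemma ball1_subset: assumes *: "dist1 m w z + s \<le> r" shows "ball1 m w s \<subseteq> ball1 m z r"
proof
  fix u assume "u \<in> ball1 m w s"
  then show "u \<in> ball1 m z r" using * dist1_triangle[of m u z w] by (auto simp: ball1_def)
qed

lemma openin_complex_space_iff:
  "openin (complex_space m) W \<longleftrightarrow>
     W \<subseteq> extensional {..<m} \<and> (\<forall>z\<in>W. \<exists>r>0. ball1 m z r \<subseteq> W)" (is "?L \<longleftrightarrow> ?R")
proof
  assume L: ?L
  have "\<exists>r>0. ball1 m z r \<subseteq> W" if z: "z \<in> W" for z
  proof -
    obtain U where U: "\<And>i. i < m \<Longrightarrow> open (U i)" "z \<in> PiE {..<m} U" "PiE {..<m} U \<subseteq> W"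
    proof -
      from L z obtain U where "\<forall>i\<in>{..<m}. openin euclidean (U i)" "z \<in> PiE {..<m} U" "PiE {..<m} U \<subseteq> W"
        unfolding complex_space_def openin_product_topology_alt by blast
      then show ?thesis using that[of U] by simp
    qed
    have "\<exists>e>0. ball (z i) e \<subseteq> U i" if "i < m" for i
      using U that by (auto simp: open_contains_ball PiE_iff)
    then obtain e where e: "\<And>i. i < m \<Longrightarrow> e i > 0" "\<And>i. i < m \<Longrightarrow> ball (z i) (e i) \<subseteq> U i" by metis
    define r where "r = Min (insert 1 (e ` {..<m}))"
    have r: "r > 0" "\<And>i. i < m \<Longrightarrow> r \<le> e i" using e by (auto simp: r_def)
    have "ball1 m z r \<subseteq> PiE {..<m} U"
    proof
      fix w assume w: "w \<in> ball1 m z r"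
      have "w i \<in> U i" if "i < m" for i
      proof -
        have "cmod (w i - z i) < e i" using dist1_component[OF that, of w z] r(2)[OF that] w by (auto simp: ball1_def)
        then show ?thesis using e(2)[OF that] by (auto simp: dist_norm norm_minus_commute)
      qed
      then show "w \<in> PiE {..<m} U" using w by (auto simp: ball1_def PiE_iff)
    qed
    then show ?thesis using r(1) U(3) by (intro exI[of _ r]) blast
  qed
  then show ?R using openin_subset[OF L] by simp
next
  assume R: ?R
  have "\<exists>T. openin (complex_space m) T \<and> z \<in> T \<and> T \<subseteq> W" if z: "z \<in> W" for z
  proof -
    obtain r where r: "r > 0" "ball1 m z r \<subseteq> W" using R z by blast
    define T where "T = PiE {..<m} (\<lambda>i. ball (z i) (r / (m + 1)))"
    have "openin (complex_space m) T"
      unfolding T_def complex_space_def by (subst openin_PiE) auto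
    moreover have "z \<in> T" using z R r by (auto simp: T_def PiE_iff)
    moreover have "T \<subseteq> ball1 m z r"
    proof
      fix w assume w: "w \<in> T"
      have "dist1 m w z \<le> (\<Sum>i<m. r / (m + 1))"
        unfolding dist1_def
        by (rule sum_mono) (use w in \<open>auto simp: T_def PiE_iff dist_norm norm_minus_commute intro: less_imp_le\<close>)
      also have "\<dots> < r" using r by (simp add: field_simps)
      finally show "w \<in> ball1 m z r" using w by (auto simp: ball1_def T_def PiE_iff)
    qed
    ultimately show ?thesis using r by blast
  qed
  then show ?L using openin_subopen by metis
qed

lemma openin_ball1: "openin (complex_space m) (ball1 m z r)"
  unfolding openin_complex_space_iff
proof (intro conjI ballI)
  fix w assume "w \<in> ball1 m z r"
  then show "\<exists>s>0. ball1 m w s \<subseteq> ball1 m z r"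
    by (intro exI[of _ "r - dist1 m w z"] conjI ball1_subset) (auto simp: ball1_def)
qed (auto simp: ball1_def)

text \<open>The limit in \<open>complex_differentiable_at\<close> with the quotient cleared, so that the centre needs no
  separate treatment.\<close>

definition has_gradient :: "nat \<Rightarrow> ((nat \<Rightarrow> complex) \<Rightarrow> complex) \<Rightarrow> (nat \<Rightarrow> complex) \<Rightarrow> (nat \<Rightarrow> complex) \<Rightarrow> bool" where
  "has_gradient m f a z \<longleftrightarrow> (\<forall>e>0. \<exists>r>0. \<forall>w\<in>ball1 m z r.
     cmod (f w - f z - (\<Sum>i<m. a i * (w i - z i))) \<le> e * dist1 m w z)"

lemma complex_differentiable_at_iff:
  assumes z: "z \<in> extensional {..<m}"
  shows "complex_differentiable_at m f z \<longleftrightarrow> (\<exists>a. has_gradient m f a z)"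
proof -
  have "((\<lambda>w. cmod (f w - f z - (\<Sum>i<m. a i * (w i - z i))) / (\<Sum>i<m. cmod (w i - z i)))
           \<longlongrightarrow> 0) (atin (complex_space m) z) \<longleftrightarrow> has_gradient m f a z" (is "?L \<longleftrightarrow> ?R") for a
  proof
    assume L: ?L
    show ?R unfolding has_gradient_def
    proof (intro allI impI)
      fix e :: real assume "e > 0"
      with L have *: "eventually (\<lambda>w. dist (cmod (f w - f z - (\<Sum>i<m. a i * (w i - z i))) / (\<Sum>i<m. cmod (w i - z i))) 0 < e) (atin (complex_space m) z)"
        by (rule tendstoD)
      then obtain U where U: "openin (complex_space m) U" "z \<in> U"
        "\<And>w. w \<in> U - {z} \<Longrightarrow> cmod (f w - f z - (\<Sum>i<m. a i * (w i - z i))) / dist1 m w z < e"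
      proof -
        from * obtain U where "openin (complex_space m) U" "z \<in> U"
          "\<forall>w\<in>U - {z}. dist (cmod (f w - f z - (\<Sum>i<m. a i * (w i - z i))) / dist1 m w z) 0 < e"
          using z unfolding eventually_atin dist1_def by auto
        then show ?thesis using that[of U] by auto
      qed
      then obtain r where r: "r > 0" "ball1 m z r \<subseteq> U" unfolding openin_complex_space_iff by blast
      have "cmod (f w - f z - (\<Sum>i<m. a i * (w i - z i))) \<le> e * dist1 m w z" if w: "w \<in> ball1 m z r" for w
      proof (cases "w = z")
        case False
        then have "dist1 m w z > 0"
          using dist1_eq_0_iff[of w m z] z w dist1_nonneg[of m w z] by (auto simp: ball1_def less_le)
        with U(3)[of w] False r w show ?thesis by (auto simp: field_simps)
      qed simp
      with r show "\<exists>r>0. \<forall>w\<in>ball1 m z r. cmod (f w - f z - (\<Sum>i<m. a i * (w i - z i))) \<le> e * dist1 m w z" by blast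
    qed
  next
    assume R: ?R
    show ?L unfolding tendsto_iff
    proof (intro allI impI)
      fix e :: real assume e: "e > 0"
      obtain r where r: "r > 0" "\<And>w. w \<in> ball1 m z r \<Longrightarrow> cmod (f w - f z - (\<Sum>i<m. a i * (w i - z i))) \<le> (e/2) * dist1 m w z"
        using R e unfolding has_gradient_def by (metis half_gt_zero)
      show "eventually (\<lambda>w. dist (cmod (f w - f z - (\<Sum>i<m. a i * (w i - z i))) / (\<Sum>i<m. cmod (w i - z i))) 0 < e) (atin (complex_space m) z)"
        unfolding eventually_atin
      proof (intro disjI2 exI conjI ballI)
        show "openin (complex_space m) (ball1 m z r)" by (rule openin_ball1)
        show "z \<in> ball1 m z r" using z r by (simp add: ball1_def)
        fix w assume w: "w \<in> ball1 m z r - {z}"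
        then have d: "dist1 m w z > 0"
          using dist1_eq_0_iff[of w m z] z dist1_nonneg[of m w z] by (auto simp: ball1_def less_le)
        have "cmod (f w - f z - (\<Sum>i<m. a i * (w i - z i))) / dist1 m w z \<le> e/2"
          using r(2)[of w] w d by (simp add: field_simps)
        also have "\<dots> < e" using e by simp
        finally show "dist (cmod (f w - f z - (\<Sum>i<m. a i * (w i - z i))) / (\<Sum>i<m. cmod (w i - z i))) 0 < e"
          using d by (simp add: dist1_def)
      qed
    qed
  qed
  then show ?thesis unfolding complex_differentiable_at_def by blast
qed

lemma holomorphic_in_iff:
  "holomorphic_in m W f \<longleftrightarrow> openin (complex_space m) W \<and> (\<forall>z\<in>W. \<exists>a. has_gradient m f a z)"
  unfolding holomorphic_in_def using complex_differentiable_at_iff openin_complex_space_iff by (metis subsetD)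

lemma has_gradient_local:
  assumes "has_gradient m f a z" "openin (complex_space m) U" "z \<in> U" "\<And>w. w \<in> U \<Longrightarrow> f w = g w"
  shows "has_gradient m g a z"
  unfolding has_gradient_def
proof (intro allI impI)
  fix e :: real assume "e > 0"
  then obtain r where r: "r > 0" "\<And>w. w \<in> ball1 m z r \<Longrightarrow> cmod (f w - f z - (\<Sum>i<m. a i * (w i - z i))) \<le> e * dist1 m w z"
    using assms(1) unfolding has_gradient_def by metis
  obtain s where s: "s > 0" "ball1 m z s \<subseteq> U" using assms(2,3) unfolding openin_complex_space_iff by blast
  show "\<exists>r>0. \<forall>w\<in>ball1 m z r. cmod (g w - g z - (\<Sum>i<m. a i * (w i - z i))) \<le> e * dist1 m w z"
  proof (intro exI[of _ "min r s"] conjI ballI)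
    fix w assume "w \<in> ball1 m z (min r s)"
    then have "w \<in> ball1 m z r" "w \<in> U" using s by (auto simp: ball1_def)
    then show "cmod (g w - g z - (\<Sum>i<m. a i * (w i - z i))) \<le> e * dist1 m w z"
      using r(2)[of w] assms(3,4) by simp
  qed (use r s in auto)
qed

lemma has_gradient_coefficients_cong:
  assumes "has_gradient m f a z" "\<And>i. i < m \<Longrightarrow> a i = b i"
  shows "has_gradient m f b z"
proof -
  have "(\<Sum>i<m. a i * (w i - z i)) = (\<Sum>i<m. b i * (w i - z i))" for w
    using assms(2) by simp
  then show ?thesis using assms(1) by (simp add: has_gradient_def)
qed

lemma has_gradient_lipschitz:
  assumes "has_gradient m f a z"
  obtains L r where "L > 0" "r > 0" "\<And>w. w \<in> ball1 m z r \<Longrightarrow> cmod (f w - f z) \<le> L * dist1 m w z"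
proof -
  obtain r where r: "r > 0" "\<And>w. w \<in> ball1 m z r \<Longrightarrow> cmod (f w - f z - (\<Sum>i<m. a i * (w i - z i))) \<le> 1 * dist1 m w z"
    using assms unfolding has_gradient_def by (metis zero_less_one)
  define A where "A = (\<Sum>i<m. cmod (a i))"
  have A: "cmod (a i) \<le> A" if "i < m" for i
    unfolding A_def by (rule member_le_sum[of i "{..<m}" "\<lambda>i. cmod (a i)"]) (use that in auto)
  have "cmod (f w - f z) \<le> (1 + A) * dist1 m w z" if w: "w \<in> ball1 m z r" for w
  proof -
    have "cmod (\<Sum>i<m. a i * (w i - z i)) \<le> (\<Sum>i<m. A * cmod (w i - z i))"
      by (rule sum_norm_le) (use A in \<open>auto simp: norm_mult intro: mult_right_mono\<close>)
    also have "\<dots> = A * dist1 m w z" by (simp add: dist1_def sum_distrib_left)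
    finally show ?thesis using r(2)[OF w] norm_triangle_sub[of "f w - f z" "\<Sum>i<m. a i * (w i - z i)"]
      by (simp add: algebra_simps)
  qed
  moreover have "1 + A > 0" using sum_nonneg[of "{..<m}" "\<lambda>i. cmod (a i)"] by (simp add: A_def add_pos_nonneg)
  ultimately show ?thesis using that r(1) by blast
qed

lemma has_gradient_const: "has_gradient m (\<lambda>_. c) (\<lambda>_. 0) z"
  by (auto simp: has_gradient_def intro: exI[of _ 1])

lemma has_gradient_coordinate:
  assumes "i < m" shows "has_gradient m (\<lambda>w. w i) (\<lambda>j. if j = i then 1 else 0) z"
proof -
  have "(\<Sum>j<m. (if j = i then 1 else 0) * (w j - z j)) = w i - z i" for w
  proof -
    have "(\<Sum>j<m. (if j = i then 1 else 0) * (w j - z j)) = (\<Sum>j<m. if j = i then w j - z j else 0)"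
      by (rule sum.cong) auto
    then show ?thesis using assms by simp
  qed
  then show ?thesis unfolding has_gradient_def
    by (intro allI impI exI[of _ "1::real"]) (simp del: sum.delta)
qed

lemma has_gradient_add:
  assumes f: "has_gradient m f a z" and g: "has_gradient m g b z"
  shows "has_gradient m (\<lambda>w. f w + g w) (\<lambda>i. a i + b i) z"
  unfolding has_gradient_def
proof (intro allI impI)
  fix e :: real assume "e > 0"
  then have e2: "e/2 > 0" by simp
  obtain r where r: "r > 0" "\<And>w. w \<in> ball1 m z r \<Longrightarrow> cmod (f w - f z - (\<Sum>i<m. a i * (w i - z i))) \<le> (e/2) * dist1 m w z"
    using f e2 unfolding has_gradient_def by blast
  obtain s where s: "s > 0" "\<And>w. w \<in> ball1 m z s \<Longrightarrow> cmod (g w - g z - (\<Sum>i<m. b i * (w i - z i))) \<le> (e/2) * dist1 m w z"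
    using g e2 unfolding has_gradient_def by blast
  show "\<exists>r>0. \<forall>w\<in>ball1 m z r. cmod (f w + g w - (f z + g z) - (\<Sum>i<m. (a i + b i) * (w i - z i))) \<le> e * dist1 m w z"
  proof (intro exI[of _ "min r s"] conjI ballI)
    fix w assume "w \<in> ball1 m z (min r s)"
    then have w: "w \<in> ball1 m z r" "w \<in> ball1 m z s" by (auto simp: ball1_def)
    have eq: "f w + g w - (f z + g z) - (\<Sum>i<m. (a i + b i) * (w i - z i)) =
      (f w - f z - (\<Sum>i<m. a i * (w i - z i))) + (g w - g z - (\<Sum>i<m. b i * (w i - z i)))"
      by (simp add: distrib_right sum.distrib)
    have "(e/2) * dist1 m w z + (e/2) * dist1 m w z = e * dist1 m w z" by (simp flip: distrib_right)
    then show "cmod (f w + g w - (f z + g z) - (\<Sum>i<m. (a i + b i) * (w i - z i))) \<le> e * dist1 m w z"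
      unfolding eq using norm_triangle_mono[OF r(2)[OF w(1)] s(2)[OF w(2)]] by simp
  qed (use r s in auto)
qed

lemma has_gradient_compose:
  assumes f: "has_gradient k f b (\<psi> z)"
    and psi: "\<And>j. j < k \<Longrightarrow> has_gradient m (\<lambda>w. \<psi> w j) (a j) z"
    and ext: "\<And>w. w \<in> U \<Longrightarrow> \<psi> w \<in> extensional {..<k}"
    and U: "openin (complex_space m) U" "z \<in> U"
  shows "has_gradient m (\<lambda>w. f (\<psi> w)) (\<lambda>i. \<Sum>j<k. b j * a j i) z"
  unfolding has_gradient_def
proof (intro allI impI)
  fix e :: real assume e: "e > 0"
  obtain \<rho> where \<rho>: "\<rho> > 0" "ball1 m z \<rho> \<subseteq> U" using U unfolding openin_complex_space_iff by blast
  have "\<exists>L r. L > 0 \<and> r > 0 \<and> (\<forall>w\<in>ball1 m z r. cmod (\<psi> w j - \<psi> z j) \<le> L * dist1 m w z)" if "j < k" for j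
    using has_gradient_lipschitz[OF psi[OF that]] by metis
  then obtain L s where Ls: "\<And>j. j < k \<Longrightarrow> L j > 0" "\<And>j. j < k \<Longrightarrow> s j > (0::real)"
    "\<And>j w. j < k \<Longrightarrow> w \<in> ball1 m z (s j) \<Longrightarrow> cmod (\<psi> w j - \<psi> z j) \<le> L j * dist1 m w z" by metis
  define \<Lambda> where "\<Lambda> = 1 + (\<Sum>j<k. L j)"
  define B where "B = 1 + (\<Sum>j<k. cmod (b j))"
  have \<Lambda>: "\<Lambda> > 0" unfolding \<Lambda>_def using Ls(1) by (intro add_pos_nonneg sum_nonneg) (auto intro: less_imp_le)
  have B: "B > 0" unfolding B_def by (intro add_pos_nonneg sum_nonneg) auto
  define e1 where "e1 = e / (2 * \<Lambda>)"
  define e2 where "e2 = e / (2 * B)"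
  have e12: "e1 > 0" "e2 > 0" using e \<Lambda> B by (auto simp: e1_def e2_def)
  obtain \<sigma> where \<sigma>: "\<sigma> > 0" "\<And>u. u \<in> ball1 k (\<psi> z) \<sigma> \<Longrightarrow> cmod (f u - f (\<psi> z) - (\<Sum>j<k. b j * (u j - \<psi> z j))) \<le> e1 * dist1 k u (\<psi> z)"
    using f e12(1) unfolding has_gradient_def by metis
  have "\<exists>r>0. \<forall>w\<in>ball1 m z r. cmod (\<psi> w j - \<psi> z j - (\<Sum>i<m. a j i * (w i - z i))) \<le> e2 * dist1 m w z" if "j < k" for j
    using psi[OF that] e12(2) unfolding has_gradient_def by metis
  then obtain t where t: "\<And>j. j < k \<Longrightarrow> t j > (0::real)"
    "\<And>j w. j < k \<Longrightarrow> w \<in> ball1 m z (t j) \<Longrightarrow> cmod (\<psi> w j - \<psi> z j - (\<Sum>i<m. a j i * (w i - z i))) \<le> e2 * dist1 m w z" by metis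
  define r where "r = Min ({\<rho>, \<sigma> / \<Lambda>} \<union> s ` {..<k} \<union> t ` {..<k})"
  have r: "r > 0" "r \<le> \<rho>" "r \<le> \<sigma> / \<Lambda>" "\<And>j. j < k \<Longrightarrow> r \<le> s j" "\<And>j. j < k \<Longrightarrow> r \<le> t j"
  proof -
    show "r > 0" unfolding r_def using \<rho>(1) \<sigma>(1) \<Lambda> Ls(2) t(1) by (subst Min_gr_iff) auto
    show "r \<le> \<rho>" "r \<le> \<sigma> / \<Lambda>" unfolding r_def by (rule Min_le; simp)+
    show "r \<le> s j" "r \<le> t j" if "j < k" for j unfolding r_def by (rule Min_le; use that in simp)+
  qed
  show "\<exists>r>0. \<forall>w\<in>ball1 m z r. cmod (f (\<psi> w) - f (\<psi> z) - (\<Sum>i<m. (\<Sum>j<k. b j * a j i) * (w i - z i))) \<le> e * dist1 m w z"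
  proof (intro exI[of _ r] conjI ballI r(1))
    fix w assume w: "w \<in> ball1 m z r"
    have ws: "w \<in> ball1 m z (s j)" "w \<in> ball1 m z (t j)" if "j < k" for j
      using w r(4,5)[OF that] by (auto simp: ball1_def)
    have wU: "w \<in> U" using w r(2) \<rho> by (auto simp: ball1_def)
    have "dist1 k (\<psi> w) (\<psi> z) \<le> (\<Sum>j<k. L j * dist1 m w z)"
      unfolding dist1_def[of k] by (rule sum_mono) (use Ls(3) ws in auto)
    also have "\<dots> \<le> \<Lambda> * dist1 m w z"
      by (simp add: \<Lambda>_def sum_distrib_right[symmetric] mult_right_mono)
    finally have d: "dist1 k (\<psi> w) (\<psi> z) \<le> \<Lambda> * dist1 m w z" .
    also have "\<dots> < \<Lambda> * r" using w \<Lambda> by (simp add: ball1_def)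
    also have "\<dots> \<le> \<sigma>" using r(3) \<Lambda> by (simp add: field_simps)
    finally have "\<psi> w \<in> ball1 k (\<psi> z) \<sigma>" using ext[OF wU] by (simp add: ball1_def)
    then have 1: "cmod (f (\<psi> w) - f (\<psi> z) - (\<Sum>j<k. b j * (\<psi> w j - \<psi> z j))) \<le> e1 * (\<Lambda> * dist1 m w z)"
      using \<sigma>(2) d e12 by (meson mult_left_mono order_trans less_imp_le)
    have "cmod (\<Sum>j<k. b j * (\<psi> w j - \<psi> z j - (\<Sum>i<m. a j i * (w i - z i)))) \<le> (\<Sum>j<k. cmod (b j) * (e2 * dist1 m w z))"
      by (rule sum_norm_le) (use t(2) ws in \<open>auto simp: norm_mult intro: mult_left_mono\<close>)
    also have "\<dots> \<le> B * (e2 * dist1 m w z)"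
      using e12 by (simp add: B_def sum_distrib_right[symmetric] mult_right_mono)
    finally have 2: "cmod (\<Sum>j<k. b j * (\<psi> w j - \<psi> z j - (\<Sum>i<m. a j i * (w i - z i)))) \<le> B * (e2 * dist1 m w z)" .
    have sw: "(\<Sum>i<m. (\<Sum>j<k. b j * a j i) * (w i - z i)) = (\<Sum>j<k. b j * (\<Sum>i<m. a j i * (w i - z i)))"
      by (simp add: sum_distrib_left sum_distrib_right mult.assoc, rule sum.swap)
    have eq: "f (\<psi> w) - f (\<psi> z) - (\<Sum>i<m. (\<Sum>j<k. b j * a j i) * (w i - z i)) =
       (f (\<psi> w) - f (\<psi> z) - (\<Sum>j<k. b j * (\<psi> w j - \<psi> z j))) +
       (\<Sum>j<k. b j * (\<psi> w j - \<psi> z j - (\<Sum>i<m. a j i * (w i - z i))))"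
      unfolding sw by (simp add: right_diff_distrib sum_subtractf)
    have "cmod (f (\<psi> w) - f (\<psi> z) - (\<Sum>i<m. (\<Sum>j<k. b j * a j i) * (w i - z i))) \<le>
      e1 * (\<Lambda> * dist1 m w z) + B * (e2 * dist1 m w z)"
      unfolding eq by (rule norm_triangle_mono[OF 1 2])
    also have "\<dots> = e * dist1 m w z" using \<Lambda> B by (simp add: e1_def e2_def field_simps)
    finally show "cmod (f (\<psi> w) - f (\<psi> z) - (\<Sum>i<m. (\<Sum>j<k. b j * a j i) * (w i - z i))) \<le> e * dist1 m w z" .
  qed
qed

text \<open>The case \<open>k = 1\<close> of \<open>has_gradient_compose\<close>, with \<open>\<complex>\<^sup>1\<close> replaced by \<open>\<complex>\<close>.\<close>

lemma has_gradient_compose_field: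
  assumes f: "has_gradient m f a z" and g: "(g has_field_derivative c) (at (f z))"
    and z: "z \<in> extensional {..<m}"
  shows "has_gradient m (\<lambda>w. g (f w)) (\<lambda>i. c * a i) z"
proof -
  let ?\<psi> = "\<lambda>w. \<lambda>j\<in>{..<1::nat}. f w"
  have "has_gradient 1 (\<lambda>u. g (u 0)) (\<lambda>_. c) (?\<psi> z)"
    unfolding has_gradient_def
  proof (intro allI impI)
    fix e :: real assume "e > 0"
    then obtain d where d: "d > 0" "\<And>y. norm (y - f z) < d \<Longrightarrow> norm (g y - g (f z) - c * (y - f z)) \<le> e * norm (y - f z)"
      using g unfolding has_field_derivative_def has_derivative_at_alt by metis
    then show "\<exists>r>0. \<forall>u\<in>ball1 1 (?\<psi> z) r. cmod (g (u 0) - g (?\<psi> z 0) - (\<Sum>i<1. c * (u i - ?\<psi> z i))) \<le> e * dist1 1 u (?\<psi> z)"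
      by (intro exI[of _ d]) (auto simp: ball1_def dist1_def)
  qed
  from has_gradient_compose[where U = "ball1 m z 1" and \<psi> = ?\<psi> and k = 1 and a = "\<lambda>_. a" and m = m, OF this]
  show ?thesis using f z openin_ball1[of m z 1] by (simp add: ball1_def)
qed

lemma holomorphic_inI:
  "\<lbrakk>openin (complex_space m) W; \<And>z. z \<in> W \<Longrightarrow> \<exists>a. has_gradient m f a z\<rbrakk> \<Longrightarrow> holomorphic_in m W f"
  by (simp add: holomorphic_in_iff)

lemma holomorphic_inD:
  assumes "holomorphic_in m W f"
  shows "openin (complex_space m) W" "\<And>z. z \<in> W \<Longrightarrow> \<exists>a. has_gradient m f a z" "W \<subseteq> extensional {..<m}"
  using assms openin_complex_space_iff by (auto simp: holomorphic_in_iff)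

lemma holomorphic_in_subset:
  "\<lbrakk>holomorphic_in m W f; openin (complex_space m) V; V \<subseteq> W\<rbrakk> \<Longrightarrow> holomorphic_in m V f"
  by (auto simp: holomorphic_in_iff)

lemma holomorphic_in_cong:
  assumes "\<And>w. w \<in> W \<Longrightarrow> f w = g w"
  shows "holomorphic_in m W f \<longleftrightarrow> holomorphic_in m W g"
  unfolding holomorphic_in_iff using has_gradient_local assms by metis

lemma holomorphic_in_const: "openin (complex_space m) W \<Longrightarrow> holomorphic_in m W (\<lambda>_. c)"
  using has_gradient_const by (auto intro!: holomorphic_inI)

lemma holomorphic_in_coordinate: "\<lbrakk>openin (complex_space m) W; i < m\<rbrakk> \<Longrightarrow> holomorphic_in m W (\<lambda>w. w i)"
  using has_gradient_coordinate by (intro holomorphic_inI) blast+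

lemma holomorphic_in_add:
  "\<lbrakk>holomorphic_in m W f; holomorphic_in m W g\<rbrakk> \<Longrightarrow> holomorphic_in m W (\<lambda>w. f w + g w)"
  unfolding holomorphic_in_iff using has_gradient_add by blast

lemma holomorphic_in_compose_field:
  assumes f: "holomorphic_in m W f" and g: "\<And>z. z \<in> W \<Longrightarrow> (g has_field_derivative g' (f z)) (at (f z))"
  shows "holomorphic_in m W (\<lambda>w. g (f w))"
proof (rule holomorphic_inI)
  show "openin (complex_space m) W" using holomorphic_inD[OF f] by blast
  fix z assume z: "z \<in> W"
  obtain a where "has_gradient m f a z" using holomorphic_inD[OF f] z by blast
  from has_gradient_compose_field[OF this g[OF z]] z holomorphic_inD(3)[OF f]
  show "\<exists>a. has_gradient m (\<lambda>w. g (f w)) a z" by blast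
qed

lemma holomorphic_in_cmult:
  assumes "holomorphic_in m W f" shows "holomorphic_in m W (\<lambda>w. c * f w)"
  by (rule holomorphic_in_compose_field[OF assms, where g' = "\<lambda>_. c"]) (auto intro!: derivative_eq_intros)

lemma holomorphic_in_diff:
  "\<lbrakk>holomorphic_in m W f; holomorphic_in m W g\<rbrakk> \<Longrightarrow> holomorphic_in m W (\<lambda>w. f w - g w)"
  using holomorphic_in_add[of m W f "\<lambda>w. (-1) * g w"] holomorphic_in_cmult[of m W g "-1"] by simp

text \<open>Products reduce to squares by polarization.\<close>

lemma holomorphic_in_mult:
  assumes "holomorphic_in m W f" "holomorphic_in m W g"
  shows "holomorphic_in m W (\<lambda>w. f w * g w)"
proof -
  have sq: "holomorphic_in m W (\<lambda>w. (h w)\<^sup>2)" if "holomorphic_in m W h" for h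
    by (rule holomorphic_in_compose_field[OF that, where g' = "\<lambda>u. 2 * u"]) (auto intro!: derivative_eq_intros)
  have "holomorphic_in m W (\<lambda>w. (1/4) * ((f w + g w)\<^sup>2 - (f w - g w)\<^sup>2))"
    by (intro holomorphic_in_cmult holomorphic_in_diff sq holomorphic_in_add assms)
  moreover have "(1/4) * ((f w + g w)\<^sup>2 - (f w - g w)\<^sup>2) = f w * g w" for w
    by (simp add: power2_eq_square algebra_simps)
  ultimately show ?thesis by simp
qed

lemma holomorphic_in_inverse:
  assumes "holomorphic_in m W f" "\<And>w. w \<in> W \<Longrightarrow> f w \<noteq> 0"
  shows "holomorphic_in m W (\<lambda>w. inverse (f w))"
  by (rule holomorphic_in_compose_field[OF assms(1), where g' = "\<lambda>u. - (inverse u)\<^sup>2"])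
    (use assms(2) in \<open>auto intro!: derivative_eq_intros simp: power2_eq_square\<close>)

lemma holomorphic_in_sum:
  assumes "openin (complex_space m) W" "\<And>i. i \<in> I \<Longrightarrow> holomorphic_in m W (f i)"
  shows "holomorphic_in m W (\<lambda>w. \<Sum>i\<in>I. f i w)"
  using assms(2)
proof (induction I rule: infinite_finite_induct)
  case (insert i I)
  then show ?case using holomorphic_in_add[of m W "f i" "\<lambda>w. \<Sum>i\<in>I. f i w"] by simp
qed (use holomorphic_in_const[OF assms(1)] in auto)

lemma holomorphic_in_compose:
  assumes f: "holomorphic_in k V f"
    and psi: "\<And>j. j < k \<Longrightarrow> holomorphic_in m W (\<lambda>w. \<psi> w j)"
    and V: "\<And>w. w \<in> W \<Longrightarrow> \<psi> w \<in> V" and W: "openin (complex_space m) W"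
  shows "holomorphic_in m W (\<lambda>w. f (\<psi> w))"
proof (rule holomorphic_inI[OF W])
  fix z assume z: "z \<in> W"
  obtain b where b: "has_gradient k f b (\<psi> z)" using holomorphic_inD(2)[OF f] V[OF z] by blast
  have "\<exists>a. has_gradient m (\<lambda>w. \<psi> w j) a z" if "j < k" for j
    using holomorphic_inD(2)[OF psi[OF that] z] .
  then obtain a where a: "\<And>j. j < k \<Longrightarrow> has_gradient m (\<lambda>w. \<psi> w j) (a j) z" by metis
  have ext: "\<psi> w \<in> extensional {..<k}" if "w \<in> W" for w using V[OF that] holomorphic_inD(3)[OF f] by blast
  show "\<exists>a. has_gradient m (\<lambda>w. f (\<psi> w)) a z"
    using has_gradient_compose[OF b a ext W z] by blast
qed

lemma holomorphic_in_locally_bounded: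
  assumes f: "holomorphic_in m W f" and z: "z \<in> W"
  obtains r B where "r > 0" "ball1 m z r \<subseteq> W" "\<And>w. w \<in> ball1 m z r \<Longrightarrow> cmod (f w) \<le> B"
proof -
  obtain a where "has_gradient m f a z" using holomorphic_inD(2)[OF f z] by blast
  then obtain L r where L: "L > 0" "r > 0" "\<And>w. w \<in> ball1 m z r \<Longrightarrow> cmod (f w - f z) \<le> L * dist1 m w z"
    by (rule has_gradient_lipschitz) blast
  obtain s where s: "s > 0" "ball1 m z s \<subseteq> W"
    using holomorphic_inD(1)[OF f] z unfolding openin_complex_space_iff by blast
  show ?thesis
  proof (rule that)
    show "min r s > 0" using L s by simp
    show "ball1 m z (min r s) \<subseteq> W" using s by (auto simp: ball1_def)
    fix w assume w: "w \<in> ball1 m z (min r s)"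
    then have "cmod (f w - f z) \<le> L * dist1 m w z" "dist1 m w z \<le> r" using L by (auto simp: ball1_def)
    then have "cmod (f w - f z) \<le> L * r" using L by (meson mult_left_mono order_trans less_imp_le)
    then show "cmod (f w) \<le> cmod (f z) + L * r" using norm_triangle_sub[of "f w" "f z"] by linarith
  qed
qed

lemma holomorphic_in_continuous:
  assumes f: "holomorphic_in m W f"
  shows "continuous_map (subtopology (complex_space m) W) euclidean f"
  unfolding continuous_map_def
proof (intro conjI allI impI)
  fix U :: "complex set" assume "openin euclidean U"
  then have U: "open U" by simp
  have top: "topspace (subtopology (complex_space m) W) = W"
    using holomorphic_inD(3)[OF f] by auto
  have "openin (complex_space m) {x \<in> W. f x \<in> U}"
    unfolding openin_complex_space_iff
  proof (intro conjI ballI)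
    show "{x \<in> W. f x \<in> U} \<subseteq> extensional {..<m}" using holomorphic_inD(3)[OF f] by blast
    fix z assume z: "z \<in> {x \<in> W. f x \<in> U}"
    obtain a where "has_gradient m f a z" using holomorphic_inD(2)[OF f] z by blast
    then obtain L r where L: "L > 0" "r > 0" "\<And>w. w \<in> ball1 m z r \<Longrightarrow> cmod (f w - f z) \<le> L * dist1 m w z"
      by (rule has_gradient_lipschitz) blast
    obtain s where s: "s > 0" "ball1 m z s \<subseteq> W"
      using holomorphic_inD(1)[OF f] z unfolding openin_complex_space_iff by blast
    obtain e where e: "e > 0" "ball (f z) e \<subseteq> U" using U z open_contains_ball by blast
    have "w \<in> {x \<in> W. f x \<in> U}" if w: "w \<in> ball1 m z (min (min r s) (e / L))" for w
    proof -
      have w': "w \<in> ball1 m z r" "w \<in> ball1 m z s" "L * dist1 m w z < e"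
        using w L by (auto simp: ball1_def field_simps)
      then have "cmod (f w - f z) < e" using L(3)[of w] by linarith
      then have "f w \<in> ball (f z) e" by (simp add: dist_norm norm_minus_commute)
      then show ?thesis using e s w' by blast
    qed
    then have "ball1 m z (min (min r s) (e / L)) \<subseteq> {x \<in> W. f x \<in> U}" by (rule subsetI)
    moreover have "min (min r s) (e / L) > 0" using L s e by simp
    ultimately show "\<exists>r>0. ball1 m z r \<subseteq> {x \<in> W. f x \<in> U}"
      by (intro exI[of _ "min (min r s) (e / L)"] conjI)
  qed
  then show "openin (subtopology (complex_space m) W) {x \<in> topspace (subtopology (complex_space m) W). f x \<in> U}"
    unfolding top openin_subtopology by (intro exI[of _ "{x \<in> W. f x \<in> U}"]) auto
qed auto

section \<open>Cauchy estimates along complex lines\<close>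

text \<open>On the closed unit disc the Cauchy estimates apply with radius \<open>R / 2\<close>, since \<open>1 + R / 2 < R\<close>;
  Taylor's formula turns the bounds on derivatives into bounds on differences.\<close>

lemma cauchy_difference_estimates:
  fixes g :: "complex \<Rightarrow> complex"
  assumes R: "R > 2" and g: "g holomorphic_on ball 0 R" and B: "\<And>t. cmod t < R \<Longrightarrow> cmod (g t) \<le> B"
  shows "cmod (g 1 - g 0) \<le> 2 * B / R" and "cmod (g 1 - g 0 - deriv g 0) \<le> 8 * B / R\<^sup>2"
    and "cmod (deriv g 0) \<le> 2 * B / R"
proof -
  have est: "cmod ((deriv ^^ k) g t) \<le> fact k * B / (R/2) ^ k" if t: "cmod t \<le> 1" for t k
  proof (rule Cauchy_inequality)
    have sub: "cball t (R/2) \<subseteq> ball 0 R"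
    proof
      fix x assume "x \<in> cball t (R/2)"
      then have "cmod x \<le> cmod t + R/2"
        using norm_triangle_ineq3[of x t] by (simp add: dist_norm norm_minus_commute)
      then show "x \<in> ball 0 R" using t R by simp
    qed
    show "g holomorphic_on ball t (R/2)" using g sub holomorphic_on_subset ball_subset_cball by blast
    show "continuous_on (cball t (R/2)) g" using g sub holomorphic_on_subset holomorphic_on_imp_continuous_on by blast
    show "0 < R/2" using R by simp
    fix x assume "norm (t - x) = R/2"
    then have "x \<in> cball t (R/2)" by (simp add: dist_norm)
    then show "norm (g x) \<le> B" using sub B by auto
  qed
  have hol: "(deriv ^^ k) g holomorphic_on ball 0 R" for k
    using g holomorphic_higher_deriv open_ball by blast
  have der: "((deriv ^^ k) g has_field_derivative (deriv ^^ Suc k) g t) (at t within cball 0 1)" if "t \<in> cball 0 1" for k t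
  proof -
    have "t \<in> ball 0 R" using that R by auto
    from holomorphic_derivI[OF hol open_ball this] show ?thesis by (auto intro: has_field_derivative_at_within)
  qed
  show 3: "cmod (deriv g 0) \<le> 2 * B / R" using est[of 0 1] by (simp add: mult.commute)
  have "cmod ((deriv ^^ 0) g 1 - (\<Sum>i\<le>0. (deriv ^^ i) g 0 * (1 - 0) ^ i / fact i)) \<le> (2 * B / R) * cmod (1 - 0) ^ Suc 0 / fact 0"
    by (rule field_Taylor[where S = "cball 0 1" and f = "\<lambda>i. (deriv ^^ i) g"])
      (use der[of _ 0] est[of _ 1] in \<open>auto simp: mult.commute\<close>)
  then show "cmod (g 1 - g 0) \<le> 2 * B / R" by simp
  have "cmod ((deriv ^^ 0) g 1 - (\<Sum>i\<le>1. (deriv ^^ i) g 0 * (1 - 0) ^ i / fact i)) \<le> (8 * B / R\<^sup>2) * cmod (1 - 0) ^ Suc 1 / fact 1"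
  proof (rule field_Taylor[where S = "cball 0 1" and f = "\<lambda>i. (deriv ^^ i) g"])
    show "cmod ((deriv ^^ Suc 1) g t) \<le> 8 * B / R\<^sup>2" if "t \<in> cball 0 1" for t
      using est[of t 2] that by (simp add: numeral_2_eq_2 power2_eq_square field_simps)
    show "((deriv ^^ i) g has_field_derivative (deriv ^^ Suc i) g t) (at t within cball 0 1)" if "t \<in> cball 0 1" for i t
      using that by (rule der)
  qed auto
  then show "cmod (g 1 - g 0 - deriv g 0) \<le> 8 * B / R\<^sup>2" by (simp add: algebra_simps)
qed

definition line_point :: "nat \<Rightarrow> (nat \<Rightarrow> complex) \<Rightarrow> (nat \<Rightarrow> complex) \<Rightarrow> complex \<Rightarrow> nat \<Rightarrow> complex" where
  "line_point m z v t = (\<lambda>i\<in>{..<m}. z i + t * v i)"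

lemma line_point_0: "z \<in> extensional {..<m} \<Longrightarrow> line_point m z v 0 = z"
  by (auto simp: line_point_def fun_eq_iff extensional_def)

lemma line_point_1: "w \<in> extensional {..<m} \<Longrightarrow> line_point m z (\<lambda>i. w i - z i) 1 = w"
  by (auto simp: line_point_def fun_eq_iff extensional_def)

lemma dist1_line_point: "dist1 m (line_point m z v t) (line_point m z v s) = cmod (t - s) * (\<Sum>i<m. cmod (v i))"
  by (simp add: dist1_def line_point_def sum_distrib_left norm_mult flip: left_diff_distrib)

lemma dist1_line_point_base: "dist1 m (line_point m z v t) z = cmod t * (\<Sum>i<m. cmod (v i))"
  by (simp add: dist1_def line_point_def sum_distrib_left norm_mult)

lemma line_point_in_ball1: "cmod t * (\<Sum>i<m. cmod (v i)) < r \<Longrightarrow> line_point m z v t \<in> ball1 m z r"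
  by (simp add: ball1_def dist1_line_point_base) (simp add: line_point_def)

lemma has_gradient_line:
  assumes "has_gradient m f a (line_point m z v t)"
  shows "((\<lambda>t. f (line_point m z v t)) has_field_derivative (\<Sum>i<m. a i * v i)) (at t)"
  unfolding has_field_derivative_def has_derivative_at_alt
proof (intro conjI allI impI)
  show "bounded_linear ((*) (\<Sum>i<m. a i * v i))" by (rule bounded_linear_mult_right)
  fix e :: real assume e: "e > 0"
  define N where "N = 1 + (\<Sum>i<m. cmod (v i))"
  have N: "N > 0" "(\<Sum>i<m. cmod (v i)) \<le> N" using sum_nonneg[of "{..<m}" "\<lambda>i. cmod (v i)"] by (auto simp: N_def add_pos_nonneg)
  have "e / N > 0" using e N by simp
  then obtain r where r: "r > 0" "\<And>w. w \<in> ball1 m (line_point m z v t) r \<Longrightarrow>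
     cmod (f w - f (line_point m z v t) - (\<Sum>i<m. a i * (w i - line_point m z v t i))) \<le> e / N * dist1 m w (line_point m z v t)"
    using assms unfolding has_gradient_def by blast
  show "\<exists>d>0. \<forall>y. norm (y - t) < d \<longrightarrow>
     norm (f (line_point m z v y) - f (line_point m z v t) - (\<Sum>i<m. a i * v i) * (y - t)) \<le> e * norm (y - t)"
  proof (intro exI[of _ "r / N"] conjI allI impI)
    show "r / N > 0" using r N by simp
    fix y assume y: "norm (y - t) < r / N"
    have d: "dist1 m (line_point m z v y) (line_point m z v t) \<le> norm (y - t) * N"
      unfolding dist1_line_point using N(2) by (intro mult_left_mono) auto
    also have "\<dots> < r" using y N by (simp add: field_simps)
    finally have "line_point m z v y \<in> ball1 m (line_point m z v t) r" by (simp add: ball1_def line_point_def)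
    from r(2)[OF this]
    have "cmod (f (line_point m z v y) - f (line_point m z v t) - (\<Sum>i<m. a i * (line_point m z v y i - line_point m z v t i)))
      \<le> e / N * dist1 m (line_point m z v y) (line_point m z v t)" .
    also have "\<dots> \<le> e / N * (norm (y - t) * N)" using d e N by (intro mult_left_mono) auto
    also have "\<dots> = e * norm (y - t)" using N by simp
    also have "(\<Sum>i<m. a i * (line_point m z v y i - line_point m z v t i)) = (\<Sum>i<m. a i * v i) * (y - t)"
      unfolding sum_distrib_right by (rule sum.cong) (auto simp: line_point_def algebra_simps)
    finally show "norm (f (line_point m z v y) - f (line_point m z v t) - (\<Sum>i<m. a i * v i) * (y - t)) \<le> e * norm (y - t)" .
  qed
qed

definition partial :: "nat \<Rightarrow> nat \<Rightarrow> ((nat \<Rightarrow> complex) \<Rightarrow> complex) \<Rightarrow> (nat \<Rightarrow> complex) \<Rightarrow> complex" where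
  "partial m i f z = deriv (\<lambda>t. f (line_point m z (\<lambda>j. if j = i then 1 else 0) t)) 0"

lemma has_gradient_partial:
  assumes f: "has_gradient m f a z" and z: "z \<in> extensional {..<m}" and i: "i < m"
  shows "partial m i f z = a i"
proof -
  have "has_gradient m f a (line_point m z (\<lambda>j. if j = i then 1 else 0) 0)"
    using f line_point_0[OF z] by simp
  from DERIV_imp_deriv[OF has_gradient_line[OF this]]
  show ?thesis using i by (simp add: partial_def if_distrib cong: if_cong)
qed

lemma holomorphic_in_has_gradient:
  assumes f: "holomorphic_in m W f" and z: "z \<in> W"
  shows "has_gradient m f (\<lambda>i. partial m i f z) z"
proof -
  obtain a where a: "has_gradient m f a z" using holomorphic_inD(2)[OF f z] by blast
  have zx: "z \<in> extensional {..<m}" using holomorphic_inD(3)[OF f] z by blast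
  show ?thesis
    by (rule has_gradient_coefficients_cong[OF a]) (simp add: has_gradient_partial[OF a zx])
qed

lemma holomorphic_on_line:
  assumes f: "holomorphic_in m W f" and W: "\<And>t. t \<in> T \<Longrightarrow> line_point m z v t \<in> W"
  shows "(\<lambda>t. f (line_point m z v t)) holomorphic_on T"
  unfolding holomorphic_on_def field_differentiable_def
proof
  fix t assume "t \<in> T"
  from has_gradient_line[OF holomorphic_in_has_gradient[OF f W[OF this]]]
  show "\<exists>f'. ((\<lambda>t. f (line_point m z v t)) has_field_derivative f') (at t within T)"
    using has_field_derivative_at_within by blast
qed

text \<open>Both estimates restrict \<open>f\<close> to the complex line through \<open>z\<close> and \<open>w\<close>.\<close>

lemma line_difference_estimates:
  assumes f: "holomorphic_in m (ball1 m z r) f" and B: "\<And>u. u \<in> ball1 m z r \<Longrightarrow> cmod (f u) \<le> B"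
    and z: "z \<in> extensional {..<m}" and w: "w \<in> extensional {..<m}" "2 * dist1 m w z < r"
  shows "cmod (f w - f z) \<le> 2 * B / r * dist1 m w z"
    and "cmod (f w - f z - (\<Sum>i<m. partial m i f z * (w i - z i))) \<le> 8 * B / r\<^sup>2 * (dist1 m w z)\<^sup>2"
proof -
  define d where "d = dist1 m w z"
  have "cmod (f w - f z) \<le> 2 * B / r * d \<and> cmod (f w - f z - (\<Sum>i<m. partial m i f z * (w i - z i))) \<le> 8 * B / r\<^sup>2 * d\<^sup>2"
  proof (cases "w = z")
    case False
    then have d: "d > 0" using dist1_eq_0_iff[OF w(1) z] dist1_nonneg[of m w z] by (auto simp: d_def less_le)
    have r: "r > 0" using w(2) dist1_nonneg[of m w z] by linarith
    define R where "R = r / d"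
    have R: "R > 2" using w(2) d by (simp add: R_def d_def field_simps)
    define v where "v = (\<lambda>i. w i - z i)"
    define g where "g = (\<lambda>t. f (line_point m z v t))"
    have dv: "(\<Sum>i<m. cmod (v i)) = d" by (simp add: d_def dist1_def v_def)
    have mem: "line_point m z v t \<in> ball1 m z r" if "cmod t < R" for t
      by (rule line_point_in_ball1) (use that d in \<open>simp add: dv R_def field_simps\<close>)
    have g: "g holomorphic_on ball 0 R" unfolding g_def
      by (rule holomorphic_on_line[OF f]) (use mem in auto)
    have gB: "cmod (g t) \<le> B" if "cmod t < R" for t using B[OF mem[OF that]] by (simp add: g_def)
    have z0: "z \<in> ball1 m z r" using z r by (simp add: ball1_def)
    have "(g has_field_derivative (\<Sum>i<m. partial m i f z * v i)) (at 0)" unfolding g_def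
      by (rule has_gradient_line) (use holomorphic_in_has_gradient[OF f z0] line_point_0[OF z] in simp)
    then have "deriv g 0 = (\<Sum>i<m. partial m i f z * v i)" by (rule DERIV_imp_deriv)
    moreover have "g 0 = f z" "g 1 = f w" using line_point_0[OF z] line_point_1[OF w(1)] by (auto simp: g_def v_def)
    ultimately show ?thesis
      using cauchy_difference_estimates(1,2)[OF R g gB] d r by (simp add: R_def v_def power2_eq_square field_simps)
  qed (simp add: d_def)
  then show "cmod (f w - f z) \<le> 2 * B / r * dist1 m w z"
    and "cmod (f w - f z - (\<Sum>i<m. partial m i f z * (w i - z i))) \<le> 8 * B / r\<^sup>2 * (dist1 m w z)\<^sup>2"
    by (auto simp: d_def)
qed

text \<open>The form in which gradients arise below: a remainder of second order is stable under limits and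
  integration.\<close>

lemma has_gradientI_quadratic:
  assumes r: "r > 0" and z: "\<And>w. w \<in> ball1 m z r \<Longrightarrow> cmod (f w - f z - (\<Sum>i<m. a i * (w i - z i))) \<le> C * (dist1 m w z)\<^sup>2"
  shows "has_gradient m f a z"
  unfolding has_gradient_def
proof (intro allI impI)
  fix e :: real assume e: "e > 0"
  define C' where "C' = \<bar>C\<bar> + 1"
  have C': "C' > 0" "C \<le> C'" by (auto simp: C'_def)
  show "\<exists>r>0. \<forall>w\<in>ball1 m z r. cmod (f w - f z - (\<Sum>i<m. a i * (w i - z i))) \<le> e * dist1 m w z"
  proof (intro exI[of _ "min r (e / C')"] conjI ballI)
    show "min r (e / C') > 0" using r e C' by simp
    fix w assume w: "w \<in> ball1 m z (min r (e / C'))"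
    then have d: "C' * dist1 m w z \<le> e" "w \<in> ball1 m z r" using C' by (auto simp: ball1_def field_simps)
    have "cmod (f w - f z - (\<Sum>i<m. a i * (w i - z i))) \<le> C * (dist1 m w z)\<^sup>2" using z[OF d(2)] .
    also have "\<dots> \<le> C' * (dist1 m w z)\<^sup>2" using C' by (intro mult_right_mono) auto
    also have "\<dots> = (C' * dist1 m w z) * dist1 m w z" by (simp add: power2_eq_square)
    also have "\<dots> \<le> e * dist1 m w z" using d by (intro mult_right_mono) auto
    finally show "cmod (f w - f z - (\<Sum>i<m. a i * (w i - z i))) \<le> e * dist1 m w z" .
  qed
qed

lemma partial_estimate:
  assumes f: "holomorphic_in m (ball1 m z r) f" and B: "\<And>u. u \<in> ball1 m z r \<Longrightarrow> cmod (f u) \<le> B"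
    and z: "z \<in> extensional {..<m}" and r: "r > 0" and i: "i < m"
  shows "cmod (partial m i f z) \<le> 8 * B / r"
proof -
  \<comment> \<open>Length \<open>r / 4\<close> makes the disc of radius \<open>4 > 2\<close> of this line lie in the ball.\<close>
  define v where "v = (\<lambda>j. if j = i then complex_of_real (r/4) else 0)"
  have sv: "(\<Sum>j<m. cmod (v j)) = r/4"
  proof -
    have "(\<Sum>j<m. cmod (v j)) = (\<Sum>j<m. if j = i then r/4 else 0)" using r by (intro sum.cong) (auto simp: v_def)
    then show ?thesis using i by simp
  qed
  define g where "g = (\<lambda>t. f (line_point m z v t))"
  have mem: "line_point m z v t \<in> ball1 m z r" if "cmod t < 4" for t
    by (rule line_point_in_ball1) (use that r in \<open>simp add: sv field_simps\<close>)
  have g: "g holomorphic_on ball 0 4" unfolding g_def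
    by (rule holomorphic_on_line[OF f]) (use mem in auto)
  have gB: "cmod (g t) \<le> B" if "cmod t < 4" for t using B[OF mem[OF that]] by (simp add: g_def)
  have z0: "z \<in> ball1 m z r" using z r by (simp add: ball1_def)
  have "(g has_field_derivative (\<Sum>j<m. partial m j f z * v j)) (at 0)" unfolding g_def
    by (rule has_gradient_line) (use holomorphic_in_has_gradient[OF f z0] line_point_0[OF z] in simp)
  then have "deriv g 0 = (\<Sum>j<m. partial m j f z * v j)" by (rule DERIV_imp_deriv)
  also have "\<dots> = (\<Sum>j<m. if j = i then partial m i f z * (r/4) else 0)" by (intro sum.cong) (auto simp: v_def)
  also have "\<dots> = partial m i f z * (r/4)" using i by simp
  finally have "cmod (deriv g 0) = cmod (partial m i f z * (r/4))" by (rule arg_cong)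
  then have "cmod (partial m i f z) * (r/4) = cmod (deriv g 0)" using r by (simp add: norm_mult norm_divide)
  also have "\<dots> \<le> 2 * B / 4" by (rule cauchy_difference_estimates(3)[OF _ g gB]) auto
  finally have "cmod (partial m i f z) * r \<le> 2 * B" by (simp add: mult.commute)
  moreover have "B \<ge> 0" using B[OF z0] norm_ge_zero[of "f z"] by linarith
  ultimately have "cmod (partial m i f z) * r \<le> 8 * B" by linarith
  then show ?thesis using r by (simp add: field_simps)
qed

text \<open>Cauchy's estimate makes the gradients of the approximations a Cauchy sequence, and the remainder
  estimate, being uniform, is preserved in the limit.\<close>

lemma gradient_of_uniform_limit:
  assumes g: "\<And>N. holomorphic_in m (ball1 m z r) (g N)" and B: "\<And>N u. u \<in> ball1 m z r \<Longrightarrow> cmod (g N u) \<le> B"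
    and lim: "\<And>N u. u \<in> ball1 m z r \<Longrightarrow> cmod (g N u - f u) \<le> \<epsilon> N" and eps: "\<epsilon> \<longlonglongrightarrow> 0"
    and z: "z \<in> extensional {..<m}" and r: "r > 0"
  shows "\<exists>a. has_gradient m f a z"
proof -
  have "convergent (\<lambda>N. partial m i (g N) z)" if i: "i < m" for i
  proof -
    have hd: "cmod (partial m i (g N) z - partial m i (g M) z) \<le> 8 * (\<epsilon> N + \<epsilon> M) / r" for N M
    proof -
      have h: "holomorphic_in m (ball1 m z r) (\<lambda>u. g N u - g M u)" by (intro holomorphic_in_diff g)
      have z0: "z \<in> ball1 m z r" using z r by (simp add: ball1_def)
      have "has_gradient m (\<lambda>u. g N u + (-1) * g M u) (\<lambda>i. partial m i (g N) z + (-1) * partial m i (g M) z) z"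
      proof (rule has_gradient_add[OF holomorphic_in_has_gradient[OF g z0]])
        have "((\<lambda>x. (-1) * x) has_field_derivative (-1)) (at (g M z))"
          by (auto intro!: derivative_eq_intros)
        from has_gradient_compose_field[OF holomorphic_in_has_gradient[OF g z0] this z]
        show "has_gradient m (\<lambda>u. (-1) * g M u) (\<lambda>i. (-1) * partial m i (g M) z) z" .
      qed
      from has_gradient_partial[OF this z i]
      have "partial m i (\<lambda>u. g N u - g M u) z = partial m i (g N) z - partial m i (g M) z" by simp
      moreover have "cmod (partial m i (\<lambda>u. g N u - g M u) z) \<le> 8 * (\<epsilon> N + \<epsilon> M) / r"
      proof (rule partial_estimate[OF h _ z r i])
        fix u assume u: "u \<in> ball1 m z r"
        show "cmod (g N u - g M u) \<le> \<epsilon> N + \<epsilon> M"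
          using lim[OF u, of N] lim[OF u, of M] norm_triangle_ineq4[of "g N u - f u" "g M u - f u"] by simp
      qed
      ultimately show ?thesis by simp
    qed
    have "Cauchy (\<lambda>N. partial m i (g N) z)"
    proof (rule CauchyI)
      fix e :: real assume e: "e > 0"
      then have "e * r / 16 > 0" using r by simp
      with eps have "eventually (\<lambda>N. dist (\<epsilon> N) 0 < e * r / 16) sequentially" by (rule tendstoD)
      then obtain K where "\<forall>N\<ge>K. dist (\<epsilon> N) 0 < e * r / 16"
        unfolding eventually_sequentially by blast
      then have K: "\<epsilon> N < e * r / 16" if "N \<ge> K" for N using that by (auto simp: dist_real_def abs_less_iff)
      have "cmod (partial m i (g N) z - partial m i (g M) z) < e" if NM: "N \<ge> K" "M \<ge> K" for N M
      proof -
        have "8 * (\<epsilon> N + \<epsilon> M) / r < e" using K[OF NM(1)] K[OF NM(2)] r by (simp add: field_simps)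
        with hd[of N M] show ?thesis by linarith
      qed
      then show "\<exists>K. \<forall>N\<ge>K. \<forall>M\<ge>K. cmod (partial m i (g N) z - partial m i (g M) z) < e" by blast
    qed
    then show ?thesis by (rule Cauchy_convergent)
  qed
  then obtain a where a: "\<And>i. i < m \<Longrightarrow> (\<lambda>N. partial m i (g N) z) \<longlonglongrightarrow> a i"
    unfolding convergent_def by metis
  have gl: "(\<lambda>N. g N u) \<longlonglongrightarrow> f u" if "u \<in> ball1 m z r" for u
  proof -
    have "(\<lambda>N. g N u - f u) \<longlonglongrightarrow> 0"
      by (rule Lim_null_comparison[OF _ eps]) (use lim that in auto)
    then show ?thesis by (rule LIM_zero_cancel)
  qed
  have "has_gradient m f a z"
  proof (rule has_gradientI_quadratic)
    show "r/2 > 0" using r by simp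
    fix w assume w: "w \<in> ball1 m z (r/2)"
    have mem: "w \<in> ball1 m z r" "z \<in> ball1 m z r" using w z r by (auto simp: ball1_def)
    have L: "(\<lambda>N. cmod (g N w - g N z - (\<Sum>i<m. partial m i (g N) z * (w i - z i)))) \<longlonglongrightarrow> cmod (f w - f z - (\<Sum>i<m. a i * (w i - z i)))"
    proof (rule tendsto_norm, rule tendsto_diff)
      show "(\<lambda>N. g N w - g N z) \<longlonglongrightarrow> f w - f z" by (rule tendsto_diff[OF gl[OF mem(1)] gl[OF mem(2)]])
      show "(\<lambda>N. \<Sum>i<m. partial m i (g N) z * (w i - z i)) \<longlonglongrightarrow> (\<Sum>i<m. a i * (w i - z i))"
        by (rule tendsto_sum) (use a in \<open>auto intro: tendsto_mult_right\<close>)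
    qed
    have "cmod (g N w - g N z - (\<Sum>i<m. partial m i (g N) z * (w i - z i))) \<le> 8 * B / r\<^sup>2 * (dist1 m w z)\<^sup>2" for N
      by (rule line_difference_estimates(2)[OF g B z]) (use w in \<open>auto simp: ball1_def\<close>)
    then show "cmod (f w - f z - (\<Sum>i<m. a i * (w i - z i))) \<le> 8 * B / r\<^sup>2 * (dist1 m w z)\<^sup>2"
      by (intro LIMSEQ_le_const2[OF L]) blast
  qed
  then show ?thesis by blast
qed

lemma line_point_component: "j < m \<Longrightarrow> line_point m z v t j = z j + t * v j"
  by (simp add: line_point_def)

lemma holomorphic_in_translate:
  assumes f: "holomorphic_in m W f" and V: "openin (complex_space m) V"
    and VW: "\<And>w. w \<in> V \<Longrightarrow> line_point m w v t \<in> W"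
  shows "holomorphic_in m V (\<lambda>w. f (line_point m w v t))"
proof (rule holomorphic_in_compose[OF f _ VW V])
  fix j assume j: "j < m"
  show "holomorphic_in m V (\<lambda>w. line_point m w v t j)"
    using holomorphic_in_add[OF holomorphic_in_coordinate[OF V j] holomorphic_in_const[OF V]]
    by (simp add: line_point_component[OF j])
qed

text \<open>A partial derivative is a locally uniform limit of difference quotients.\<close>

lemma holomorphic_in_partial:
  assumes f: "holomorphic_in m W f" and i: "i < m"
  shows "holomorphic_in m W (partial m i f)"
proof (rule holomorphic_inI[OF holomorphic_inD(1)[OF f]])
  fix z assume z: "z \<in> W"
  then have zx: "z \<in> extensional {..<m}" using holomorphic_inD(3)[OF f] by blast
  obtain R B where R: "R > 0" "ball1 m z R \<subseteq> W" and B: "\<And>w. w \<in> ball1 m z R \<Longrightarrow> cmod (f w) \<le> B"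
    using holomorphic_in_locally_bounded[OF f z] by metis
  \<comment> \<open>Balls of radius \<open>r\<close> around points of \<open>ball1 m z r\<close> stay in \<open>ball1 m z R\<close>.\<close>
  define r where "r = R / 2"
  have r: "r > 0" "R = r + r" using R by (auto simp: r_def)
  define e where "e = (\<lambda>j. if j = i then 1 else 0 :: complex)"
  have se: "(\<Sum>j<m. cmod (e j)) = 1" using i by (simp add: e_def if_distrib cong: if_cong)
  \<comment> \<open>The steps tend to \<open>0\<close> and are less than \<open>r / 2\<close>, as the line estimates require.\<close>
  define h where "h N = r / (4 * (real N + 1))" for N
  have h: "h N > 0" "2 * h N < r" "h N \<le> r" for N
  proof -
    show "h N > 0" using r by (simp add: h_def)
    have "h N = (r / 4) * (1 / (real N + 1))" by (simp add: h_def)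
    also have "\<dots> \<le> (r / 4) * 1" using r by (intro mult_left_mono) auto
    finally show "2 * h N < r" "h N \<le> r" using r by auto
  qed
  define g where "g N w = (1 / of_real (h N)) * (f (line_point m w e (of_real (h N))) - f w)" for N w
  have sub: "ball1 m w r \<subseteq> ball1 m z R" if "w \<in> ball1 m z r" for w
    by (rule ball1_subset) (use that r in \<open>auto simp: ball1_def\<close>)
  have f_ball: "holomorphic_in m (ball1 m w r) f" if "w \<in> ball1 m z r" for w
    by (rule holomorphic_in_subset[OF f openin_ball1]) (use sub[OF that] R in blast)
  have dist: "dist1 m (line_point m w e (of_real (h N))) w = h N" for w N
    using h[of N] by (simp add: dist1_line_point_base se)
  have le: "line_point m w e t \<in> extensional {..<m}" for w t by (simp add: line_point_def)
  have est: "cmod (f (line_point m w e (of_real (h N))) - f w) \<le> 2 * B / r * h N"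
    "cmod (f (line_point m w e (of_real (h N))) - f w - partial m i f w * of_real (h N)) \<le> 8 * B / r\<^sup>2 * (h N)\<^sup>2"
    if w: "w \<in> ball1 m z r" for w N
  proof -
    have wx: "w \<in> extensional {..<m}" using w by (simp add: ball1_def)
    have bd: "cmod (f u) \<le> B" if "u \<in> ball1 m w r" for u using B sub[OF w] that by blast
    have d2: "2 * dist1 m (line_point m w e (of_real (h N))) w < r" using dist h by simp
    note E = line_difference_estimates[OF f_ball[OF w] bd wx le d2, unfolded dist]
    show "cmod (f (line_point m w e (of_real (h N))) - f w) \<le> 2 * B / r * h N" by (rule E(1))
    have "(\<Sum>j<m. partial m j f w * (line_point m w e (of_real (h N)) j - w j)) = (\<Sum>j<m. if j = i then partial m i f w * of_real (h N) else 0)"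
      by (rule sum.cong) (auto simp: line_point_def e_def)
    then have "(\<Sum>j<m. partial m j f w * (line_point m w e (of_real (h N)) j - w j)) = partial m i f w * of_real (h N)"
      using i by simp
    with E(2) show "cmod (f (line_point m w e (of_real (h N))) - f w - partial m i f w * of_real (h N)) \<le> 8 * B / r\<^sup>2 * (h N)\<^sup>2" by simp
  qed
  show "\<exists>a. has_gradient m (partial m i f) a z"
  proof (rule gradient_of_uniform_limit[OF _ _ _ _ zx r(1)])
    show "holomorphic_in m (ball1 m z r) (g N)" for N
      unfolding g_def
    proof (intro holomorphic_in_cmult holomorphic_in_diff holomorphic_in_translate[OF f openin_ball1])
      show "holomorphic_in m (ball1 m z r) f" by (rule f_ball) (use zx r in \<open>simp add: ball1_def\<close>)
      fix w assume w: "w \<in> ball1 m z r"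
      have "dist1 m (line_point m w e (of_real (h N))) z < R"
        using dist1_triangle[of m "line_point m w e (of_real (h N))" z w] dist[of w N] w r h[of N] by (simp add: ball1_def)
      then show "line_point m w e (of_real (h N)) \<in> W" using R le by (auto simp: ball1_def)
    qed
    show "cmod (g N w) \<le> 2 * B / r" if "w \<in> ball1 m z r" for N w
      using est(1)[OF that, of N] h(1)[of N] by (simp add: g_def norm_mult norm_divide field_simps)
    show "cmod (g N w - partial m i f w) \<le> 8 * B / r\<^sup>2 * h N" if "w \<in> ball1 m z r" for N w
    proof -
      have "g N w - partial m i f w = (1 / of_real (h N)) * (f (line_point m w e (of_real (h N))) - f w - partial m i f w * of_real (h N))"
        using h(1)[of N] by (simp add: g_def right_diff_distrib)
      also have "cmod \<dots> = (1 / h N) * cmod (f (line_point m w e (of_real (h N))) - f w - partial m i f w * of_real (h N))"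
        using h(1)[of N] by (simp add: norm_mult norm_divide)
      also have "\<dots> \<le> (1 / h N) * (8 * B / r\<^sup>2 * (h N)\<^sup>2)"
        by (rule mult_left_mono[OF est(2)[OF that]]) (use h(1)[of N] in simp)
      also have "\<dots> = 8 * B / r\<^sup>2 * h N" using h(1)[of N] by (simp add: power2_eq_square)
      finally show ?thesis .
    qed
    have "h = (\<lambda>N. (r / 4) * (1 / real (Suc N)))" by (simp add: h_def fun_eq_iff add.commute)
    moreover have "(\<lambda>N. (r / 4) * (1 / real (Suc N))) \<longlonglongrightarrow> (r / 4) * 0"
      by (intro tendsto_mult tendsto_const LIMSEQ_Suc[OF lim_1_over_n])
    ultimately have "h \<longlonglongrightarrow> 0" by simp
    then show "(\<lambda>N. 8 * B / r\<^sup>2 * h N) \<longlonglongrightarrow> 0" using tendsto_mult_right_zero by blast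
  qed
qed

lemma continuous_on_segment:
  assumes f: "holomorphic_in m W f" and W: "\<And>t::real. t \<in> {0..1} \<Longrightarrow> line_point m z v (of_real t) \<in> W"
  shows "continuous_on {0..1} (\<lambda>t::real. f (line_point m z v (of_real t)))"
proof -
  have "continuous_on (complex_of_real ` {0..1}) (\<lambda>t. f (line_point m z v t))"
    by (intro holomorphic_on_imp_continuous_on holomorphic_on_line[OF f]) (use W in auto)
  then show ?thesis
    by (rule continuous_on_compose2) (auto intro!: continuous_intros)
qed

text \<open>Differentiation under the integral sign: the quadratic remainder of \<open>G\<close> is uniform along the
  segment, and integrating the gradients gives the gradient of the average.\<close>

lemma holomorphic_in_segment_average:
  assumes G: "holomorphic_in m (ball1 m p (2 * r)) G" and B: "\<And>w. w \<in> ball1 m p (2 * r) \<Longrightarrow> cmod (G w) \<le> B"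
    and p: "p \<in> extensional {..<m}" and r: "r > 0"
  shows "holomorphic_in m (ball1 m p r) (\<lambda>w. integral {0..1} (\<lambda>t::real. G (line_point m p (\<lambda>j. w j - p j) (of_real t))))"
proof (rule holomorphic_inI[OF openin_ball1])
  fix z assume z: "z \<in> ball1 m p r"
  define q where "q w t = line_point m p (\<lambda>j. w j - p j) (complex_of_real t)" for w t
  have qx: "q w t \<in> extensional {..<m}" for w t by (simp add: q_def line_point_def)
  have q: "q w t \<in> ball1 m p r" if "w \<in> ball1 m p r" "t \<in> {0..1}" for w t
  proof -
    have "t * dist1 m w p \<le> 1 * dist1 m w p" using that by (intro mult_right_mono) auto
    then show ?thesis unfolding q_def
      by (intro line_point_in_ball1) (use that in \<open>auto simp: ball1_def dist1_def\<close>)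
  qed
  have q2: "q w t \<in> ball1 m p (2 * r)" if "w \<in> ball1 m p r" "t \<in> {0..1}" for w t
    using q[OF that] r by (auto simp: ball1_def)
  have dq: "dist1 m (q w t) (q z t) \<le> dist1 m w z" if "t \<in> {0..1}" for w t
  proof -
    have "dist1 m (q w t) (q z t) = t * dist1 m w z"
      using that by (simp add: dist1_def q_def line_point_def sum_distrib_left norm_mult flip: right_diff_distrib)
    also have "\<dots> \<le> 1 * dist1 m w z" using that by (intro mult_right_mono) auto
    finally show ?thesis by simp
  qed
  have cG: "continuous_on {0..1} (\<lambda>t. G (q w t))" if "w \<in> ball1 m p r" for w
    unfolding q_def by (rule continuous_on_segment[OF G]) (use q2[OF that] in \<open>simp add: q_def\<close>)
  have cP: "continuous_on {0..1} (\<lambda>t. of_real t * partial m i G (q z t))" if "i < m" for i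
    unfolding q_def
    by (intro continuous_intros continuous_on_segment[OF holomorphic_in_partial[OF G that]]) (use q2[OF z] in \<open>simp add: q_def\<close>)
  define a where "a i = integral {0..1} (\<lambda>t. of_real t * partial m i G (q z t))" for i
  define s where "s = min (r / 2) (r - dist1 m z p)"
  have s: "s > 0" using z r by (auto simp: s_def ball1_def)
  have "has_gradient m (\<lambda>w. integral {0..1} (\<lambda>t. G (q w t))) a z"
  proof (rule has_gradientI_quadratic[OF s])
    fix w assume w: "w \<in> ball1 m z s"
    have wp: "w \<in> ball1 m p r" using w dist1_triangle[of m w p z] by (auto simp: ball1_def s_def)
    have w2: "2 * dist1 m w z < r" using w by (auto simp: ball1_def s_def)
    let ?F = "\<lambda>t. G (q w t) - G (q z t) - (\<Sum>i<m. of_real t * partial m i G (q z t) * (w i - z i))"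
    have cF: "continuous_on {0..1} ?F"
      by (intro continuous_on_diff[OF continuous_on_diff[OF cG[OF wp] cG[OF z]]] continuous_on_sum continuous_on_mult_right)
        (use cP in simp)
    have "cmod (?F t) \<le> 8 * B / r\<^sup>2 * (dist1 m w z)\<^sup>2" if t: "t \<in> {0..1}" for t
    proof -
      have sub: "ball1 m (q z t) r \<subseteq> ball1 m p (2 * r)"
        by (rule ball1_subset) (use q[OF z t] in \<open>auto simp: ball1_def\<close>)
      have h: "holomorphic_in m (ball1 m (q z t) r) G" by (rule holomorphic_in_subset[OF G openin_ball1 sub])
      have b: "cmod (G u) \<le> B" if "u \<in> ball1 m (q z t) r" for u using B sub that by blast
      have d2: "2 * dist1 m (q w t) (q z t) < r" using dq[OF t, of w] w2 by linarith
      have "(\<Sum>i<m. partial m i G (q z t) * (q w t i - q z t i)) = (\<Sum>i<m. of_real t * partial m i G (q z t) * (w i - z i))"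
        by (rule sum.cong) (auto simp: q_def line_point_def algebra_simps)
      with line_difference_estimates(2)[OF h b qx qx d2]
      have "cmod (?F t) \<le> 8 * B / r\<^sup>2 * (dist1 m (q w t) (q z t))\<^sup>2" by simp
      also have "\<dots> \<le> 8 * B / r\<^sup>2 * (dist1 m w z)\<^sup>2"
      proof (rule mult_left_mono)
        show "(dist1 m (q w t) (q z t))\<^sup>2 \<le> (dist1 m w z)\<^sup>2" using dq[OF t] by (intro power_mono) auto
        have "B \<ge> 0" using B[OF q2[OF z t]] norm_ge_zero[of "G (q z t)"] by linarith
        then show "0 \<le> 8 * B / r\<^sup>2" by simp
      qed
      finally show ?thesis .
    qed
    from integral_bound[OF _ cF this]
    have "cmod (integral {0..1} ?F) \<le> 8 * B / r\<^sup>2 * (dist1 m w z)\<^sup>2" by simp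
    also have "integral {0..1} ?F = integral {0..1} (\<lambda>t. G (q w t)) - integral {0..1} (\<lambda>t. G (q z t)) - (\<Sum>i<m. a i * (w i - z i))"
    proof -
      have 1: "((\<lambda>t. G (q w t)) has_integral integral {0..1} (\<lambda>t. G (q w t))) {0..1}"
        "((\<lambda>t. G (q z t)) has_integral integral {0..1} (\<lambda>t. G (q z t))) {0..1}"
        using integrable_continuous_real[OF cG[OF wp]] integrable_continuous_real[OF cG[OF z]] by (auto intro: integrable_integral)
      have 2: "((\<lambda>t. of_real t * partial m i G (q z t) * (w i - z i)) has_integral a i * (w i - z i)) {0..1}" if "i < m" for i
        using has_integral_mult_left[OF integrable_integral[OF integrable_continuous_real[OF cP[OF that]]]] by (simp add: a_def)
      show ?thesis
        by (rule integral_unique) (intro has_integral_diff 1 has_integral_sum finite_lessThan 2, auto)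
    qed
    finally show "cmod (integral {0..1} (\<lambda>t. G (q w t)) - integral {0..1} (\<lambda>t. G (q z t)) - (\<Sum>i<m. a i * (w i - z i))) \<le> 8 * B / r\<^sup>2 * (dist1 m w z)\<^sup>2" .
  qed
  then show "\<exists>a. has_gradient m (\<lambda>w. integral {0..1} (\<lambda>t::real. G (line_point m p (\<lambda>j. w j - p j) (of_real t)))) a z"
    unfolding q_def by blast
qed

text \<open>The quotients are the averages of the partial derivatives over the segments from \<open>p\<close>; the
  identity is the fundamental theorem of calculus on these segments.\<close>

lemma hadamard:
  assumes f: "holomorphic_in m W f" and p: "p \<in> W"
  obtains r h where "r > 0" "ball1 m p r \<subseteq> W" "\<And>i. i < m \<Longrightarrow> holomorphic_in m (ball1 m p r) (h i)"
    "\<And>w. w \<in> ball1 m p r \<Longrightarrow> f w = f p + (\<Sum>i<m. (w i - p i) * h i w)"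
    "\<And>i. i < m \<Longrightarrow> h i p = partial m i f p"
proof -
  have px: "p \<in> extensional {..<m}" using holomorphic_inD(3)[OF f] p by blast
  have "\<exists>r B. r > 0 \<and> ball1 m p r \<subseteq> W \<and> (\<forall>w\<in>ball1 m p r. cmod (partial m i f w) \<le> B)" if "i < m" for i
    using holomorphic_in_locally_bounded[OF holomorphic_in_partial[OF f that] p] by metis
  then obtain R B where R: "\<And>i. i < m \<Longrightarrow> R i > (0::real)"
    and B: "\<And>i w. i < m \<Longrightarrow> w \<in> ball1 m p (R i) \<Longrightarrow> cmod (partial m i f w) \<le> B i" by metis
  obtain R0 where R0: "R0 > 0" "ball1 m p R0 \<subseteq> W"
    using holomorphic_inD(1)[OF f] p unfolding openin_complex_space_iff by blast
  define r where "r = Min (insert R0 (R ` {..<m})) / 2"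
  have "Min (insert R0 (R ` {..<m})) > 0" by (subst Min_gr_iff) (use R R0 in auto)
  then have r: "r > 0" by (simp add: r_def)
  have rR0: "2 * r \<le> R0" unfolding r_def by simp
  have rR: "2 * r \<le> R i" if "i < m" for i unfolding r_def by (simp, rule Min_le) (use that in auto)
  have sub2: "ball1 m p (2 * r) \<subseteq> W" using R0 rR0 by (auto simp: ball1_def)
  have sub: "ball1 m p r \<subseteq> W" using sub2 r by (auto simp: ball1_def)
  define h where "h i w = integral {0..1} (\<lambda>t::real. partial m i f (line_point m p (\<lambda>j. w j - p j) (of_real t)))" for i w
  show ?thesis
  proof (rule that[OF r sub])
    fix i assume i: "i < m"
    have bd: "cmod (partial m i f w) \<le> B i" if "w \<in> ball1 m p (2 * r)" for w
      using B[OF i, of w] that rR[OF i] by (simp add: ball1_def)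
    show "holomorphic_in m (ball1 m p r) (h i)"
      unfolding h_def
      by (rule holomorphic_in_segment_average[OF holomorphic_in_subset[OF holomorphic_in_partial[OF f i] openin_ball1 sub2] bd px r])
    have "line_point m p (\<lambda>j. p j - p j) t = p" for t using px by (auto simp: line_point_def extensional_def fun_eq_iff)
    then show "h i p = partial m i f p" by (simp add: h_def)
  next
    fix w assume w: "w \<in> ball1 m p r"
    define q where "q t = line_point m p (\<lambda>j. w j - p j) (complex_of_real t)" for t
    have q: "q t \<in> W" if "t \<in> {0..1}" for t
    proof -
      have "t * dist1 m w p \<le> 1 * dist1 m w p" using that by (intro mult_right_mono) auto
      then have "q t \<in> ball1 m p r" unfolding q_def
        by (intro line_point_in_ball1) (use that w in \<open>auto simp: ball1_def dist1_def\<close>)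
      then show ?thesis using sub by blast
    qed
    have "((\<lambda>t. \<Sum>i<m. partial m i f (q t) * (w i - p i)) has_integral f (q 1) - f (q 0)) {0..1}"
    proof (rule fundamental_theorem_of_calculus)
      fix t :: real assume t: "t \<in> {0..1}"
      from has_gradient_line[OF holomorphic_in_has_gradient[OF f q[OF t], unfolded q_def]]
      show "((\<lambda>t. f (q t)) has_vector_derivative (\<Sum>i<m. partial m i f (q t) * (w i - p i))) (at t within {0..1})"
        unfolding q_def by (rule has_vector_derivative_real_field)
    qed simp
    moreover have "((\<lambda>t. \<Sum>i<m. partial m i f (q t) * (w i - p i)) has_integral (\<Sum>i<m. h i w * (w i - p i))) {0..1}"
    proof (rule has_integral_sum)
      fix i assume "i \<in> {..<m}"
      then have "continuous_on {0..1} (\<lambda>t. partial m i f (q t))"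
        unfolding q_def by (intro continuous_on_segment[OF holomorphic_in_partial[OF f]]) (use q in \<open>auto simp: q_def\<close>)
      from has_integral_mult_left[OF integrable_integral[OF integrable_continuous_real[OF this]]]
      show "((\<lambda>t. partial m i f (q t) * (w i - p i)) has_integral h i w * (w i - p i)) {0..1}"
        by (simp add: h_def q_def)
    qed simp
    ultimately have "f (q 1) - f (q 0) = (\<Sum>i<m. h i w * (w i - p i))" by (rule has_integral_unique)
    moreover have "q 1 = w" using line_point_1[of w m p] w by (simp add: q_def ball1_def)
    moreover have "q 0 = p" using line_point_0[OF px] by (simp add: q_def)
    ultimately have "f w - f p = (\<Sum>i<m. h i w * (w i - p i))" by simp
    also have "\<dots> = (\<Sum>i<m. (w i - p i) * h i w)" by (rule sum.cong) auto
    finally show "f w = f p + (\<Sum>i<m. (w i - p i) * h i w)" by (simp add: diff_eq_eq add.commute)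
  qed
qed

section \<open>The exterior algebra and its filtration by degree\<close>

text \<open>The \<open>k\<close>-th power of the ideal generated by the odd generators.\<close>

definition ext_filt :: "nat \<Rightarrow> nat \<Rightarrow> (nat set \<Rightarrow> complex) set" where
  "ext_filt n k = {u \<in> exterior_carrier n. \<forall>S. card S < k \<longrightarrow> u S = 0}"

definition ext_basis :: "nat set \<Rightarrow> nat set \<Rightarrow> complex" where
  "ext_basis S = (\<lambda>T. if T = S then 1 else 0)"

lemma ext_filtD: "u \<in> ext_filt n k \<Longrightarrow> card S < k \<Longrightarrow> u S = 0"
  by (simp add: ext_filt_def)

lemma ext_filt_carrier: "u \<in> ext_filt n k \<Longrightarrow> u \<in> exterior_carrier n"
  by (simp add: ext_filt_def)

lemma exterior_carrierD: "u \<in> exterior_carrier n \<Longrightarrow> \<not> S \<subseteq> {..<n} \<Longrightarrow> u S = 0"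
  by (simp add: exterior_carrier_def)

lemma ext_filt_0: "ext_filt n 0 = exterior_carrier n"
  by (simp add: ext_filt_def)

lemma ext_filt_Suc: "u \<in> ext_filt n (Suc k) \<longleftrightarrow> u \<in> ext_filt n k \<and> (\<forall>S. S \<subseteq> {..<n} \<longrightarrow> card S = k \<longrightarrow> u S = 0)"
  by (auto simp: ext_filt_def exterior_carrier_def less_Suc_eq)

lemma ext_filt_beyond: "u \<in> ext_filt n (Suc n) \<Longrightarrow> u S = 0"
proof (cases "S \<subseteq> {..<n}")
  case True
  then have "card S \<le> n" using card_mono[of "{..<n}" S] by simp
  then show "u \<in> ext_filt n (Suc n) \<Longrightarrow> u S = 0" by (simp add: ext_filt_def)
qed (simp add: ext_filt_def exterior_carrier_def)

lemma ext_basis_filt: "S \<subseteq> {..<n} \<Longrightarrow> ext_basis S \<in> ext_filt n (card S)"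
  by (auto simp: ext_basis_def ext_filt_def exterior_carrier_def)

lemma shuffle_sign_empty [simp]: "shuffle_sign {} T = 1" "shuffle_sign T {} = 1"
  by (simp_all add: shuffle_sign_def)

lemma wedge_empty: "wedge u v {} = u {} * v {}"
  by (simp add: wedge_def)

lemma shuffle_sign_Min: "(\<And>j. j \<in> T \<Longrightarrow> b \<le> j) \<Longrightarrow> shuffle_sign {b} T = 1"
proof -
  assume *: "\<And>j. j \<in> T \<Longrightarrow> b \<le> j"
  have "{(i, j) \<in> {b} \<times> T. j < i} = {}" using * by (auto simp: not_less)
  then show ?thesis unfolding shuffle_sign_def by (simp only: card.empty power_0)
qed

lemma wedge_carrier:
  assumes "u \<in> exterior_carrier n" "v \<in> exterior_carrier n"
  shows "wedge u v \<in> exterior_carrier n"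
  unfolding exterior_carrier_def wedge_def
proof (intro CollectI allI impI sum.neutral ballI)
  fix S T assume "\<not> S \<subseteq> {..<n}" "T \<in> Pow S"
  then have "\<not> T \<subseteq> {..<n} \<or> \<not> S - T \<subseteq> {..<n}" by blast
  then show "shuffle_sign T (S - T) * u T * v (S - T) = 0"
    using exterior_carrierD[OF assms(1), of T] exterior_carrierD[OF assms(2), of "S - T"] by auto
qed

text \<open>In lowest degree a product only sees the body of the other factor: every other term of the
  shuffle sum takes from \<open>v\<close> a coefficient of degree less than \<open>k\<close>.\<close>

lemma wedge_leading_right:
  assumes v: "v \<in> ext_filt n k" and T: "finite T" "card T \<le> k"
  shows "wedge u v T = u {} * v T"
proof -
  have "wedge u v T = (\<Sum>S\<in>{{}}. shuffle_sign S (T - S) * u S * v (T - S))"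
    unfolding wedge_def
  proof (rule sum.mono_neutral_right)
    show "\<forall>S\<in>Pow T - {{}}. shuffle_sign S (T - S) * u S * v (T - S) = 0"
    proof
      fix S assume S: "S \<in> Pow T - {{}}"
      then have "card (T - S) < card T" using T(1) by (intro psubset_card_mono) auto
      then show "shuffle_sign S (T - S) * u S * v (T - S) = 0" using ext_filtD[OF v, of "T - S"] T by simp
    qed
  qed (use T in auto)
  then show ?thesis by simp
qed

lemma wedge_leading_left:
  assumes u: "u \<in> ext_filt n k" and T: "finite T" "card T \<le> k"
  shows "wedge u v T = u T * v {}"
proof -
  have "wedge u v T = (\<Sum>S\<in>{T}. shuffle_sign S (T - S) * u S * v (T - S))"
    unfolding wedge_def
  proof (rule sum.mono_neutral_right)
    show "\<forall>S\<in>Pow T - {T}. shuffle_sign S (T - S) * u S * v (T - S) = 0"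
    proof
      fix S assume S: "S \<in> Pow T - {T}"
      then have "card S < card T" using T(1) by (intro psubset_card_mono) auto
      then show "shuffle_sign S (T - S) * u S * v (T - S) = 0" using ext_filtD[OF u, of S] T by simp
    qed
  qed (use T in auto)
  then show ?thesis by simp
qed

lemma wedge_filt:
  assumes u: "u \<in> ext_filt n k" and v: "v \<in> ext_filt n l"
  shows "wedge u v \<in> ext_filt n (k + l)"
proof -
  have c: "wedge u v \<in> exterior_carrier n" using wedge_carrier u v ext_filt_carrier by blast
  have "wedge u v S = 0" if S: "card S < k + l" for S
  proof (cases "S \<subseteq> {..<n}")
    case True
    then have fin: "finite S" using finite_subset by blast
    show ?thesis unfolding wedge_def
    proof (intro sum.neutral ballI)
      fix T assume T: "T \<in> Pow S"
      have "card T + card (S - T) = card S" using T fin by (simp add: card_Diff_subset card_mono finite_subset)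
      then have "card T < k \<or> card (S - T) < l" using S by linarith
      then show "shuffle_sign T (S - T) * u T * v (S - T) = 0" using ext_filtD[OF u, of T] ext_filtD[OF v, of "S - T"] by auto
    qed
  next
    case False then show ?thesis using exterior_carrierD[OF c] by blast
  qed
  with c show ?thesis by (simp add: ext_filt_def)
qed

lemma wedge_scalar:
  assumes v: "v \<in> exterior_carrier n"
  shows "wedge (\<lambda>S. if S = {} then c else 0) v = (\<lambda>S. c * v S)"
proof
  fix S
  show "wedge (\<lambda>S. if S = {} then c else 0) v S = c * v S"
  proof (cases "finite S")
    case True
    have "wedge (\<lambda>S. if S = {} then c else 0) v S = (\<Sum>T\<in>Pow S. if T = {} then c * v S else 0)"
      unfolding wedge_def by (rule sum.cong) auto
    then show ?thesis using True by simp
  next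
    case False
    then have "\<not> S \<subseteq> {..<n}" using finite_subset by blast
    then show ?thesis using False exterior_carrierD[OF v] by (simp add: wedge_def)
  qed
qed

lemma wedge_scalar_right:
  assumes v: "v \<in> exterior_carrier n"
  shows "wedge v (\<lambda>S. if S = {} then c else 0) = (\<lambda>S. c * v S)"
proof
  fix S
  show "wedge v (\<lambda>S. if S = {} then c else 0) S = c * v S"
  proof (cases "finite S")
    case True
    have "wedge v (\<lambda>S. if S = {} then c else 0) S = (\<Sum>T\<in>Pow S. if T = S then c * v S else 0)"
      unfolding wedge_def by (rule sum.cong) auto
    then show ?thesis using True by simp
  next
    case False
    then have "\<not> S \<subseteq> {..<n}" using finite_subset by blast
    then show ?thesis using False exterior_carrierD[OF v] by (simp add: wedge_def)
  qed
qed

text \<open>If all indices in \<open>v\<close> are larger than \<open>b\<close>, no sign appears; this is why odd variables are split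
  off in increasing order below.\<close>

lemma wedge_ext_basis_singleton:
  assumes v: "v \<in> exterior_carrier n" and v0: "\<And>S. v S \<noteq> 0 \<Longrightarrow> S \<subseteq> {Suc b..}"
  shows "wedge (ext_basis {b}) v = (\<lambda>S. if b \<in> S then v (S - {b}) else 0)"
proof
  fix S
  show "wedge (ext_basis {b}) v S = (if b \<in> S then v (S - {b}) else 0)"
  proof (cases "finite S")
    case True
    have "wedge (ext_basis {b}) v S = (\<Sum>T\<in>Pow S. if T = {b} then v (S - {b}) else 0)"
      unfolding wedge_def
    proof (rule sum.cong)
      fix T assume "T \<in> Pow S"
      show "shuffle_sign T (S - T) * ext_basis {b} T * v (S - T) = (if T = {b} then v (S - {b}) else 0)"
      proof (cases "T = {b} \<and> v (S - {b}) \<noteq> 0")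
        case True
        then have "\<And>j. j \<in> S - {b} \<Longrightarrow> b \<le> j" using v0[of "S - {b}"] by force
        with True shuffle_sign_Min[of "S - {b}" b] show ?thesis by (simp add: ext_basis_def)
      qed (auto simp: ext_basis_def)
    qed simp
    then show ?thesis using True by simp
  next
    case False
    then have "infinite (S - {b})" by simp
    then have "\<not> S - {b} \<subseteq> {..<n}" by (meson finite_subset finite_lessThan)
    then have "v (S - {b}) = 0" by (rule exterior_carrierD[OF v])
    then show ?thesis using False by (simp add: wedge_def)
  qed
qed

section \<open>Holomorphic functions on a complex manifold\<close>

context complex_manifold
begin

lemma openin_chart_image:
  assumes c: "(U, \<phi>) \<in> charts M" and V: "openin (base M) V" "V \<subseteq> U"
  shows "openin (complex_space m) (\<phi> ` V)"
proof -
  have VU: "openin (subtopology (base M) U) V" using V unfolding openin_subtopology by blast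
  with VU have "openin (subtopology (complex_space m) (\<phi> ` U)) (\<phi> ` V)"
    using homeomorphic_map_openness[OF chart_homeomorphism[OF c] openin_subset[OF VU]] by simp
  then show ?thesis using chart_image[OF c] openin_trans_full by blast
qed

lemma chart_inj: "(U, \<phi>) \<in> charts M \<Longrightarrow> inj_on \<phi> U"
  using chart_homeomorphism[of U \<phi>] chart_domain[of U \<phi>] openin_subset
  by (metis homeomorphic_map_def topspace_subtopology_subset homeomorphic_eq_injective_perfect_map)

lemma chart_inv: "\<lbrakk>(U, \<phi>) \<in> charts M; x \<in> U\<rbrakk> \<Longrightarrow> inv_into U \<phi> (\<phi> x) = x"
  using chart_inj by (simp add: inv_into_f_f)

lemma chart_extensional: "\<lbrakk>(U, \<phi>) \<in> charts M; x \<in> U\<rbrakk> \<Longrightarrow> \<phi> x \<in> extensional {..<m}"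
  using openin_subset[OF chart_image[of U \<phi>]] by (auto simp: subset_iff)

lemma chart_openin_preimage:
  assumes c: "(U, \<phi>) \<in> charts M" and W: "openin (complex_space m) W" and V: "openin (base M) V" "V \<subseteq> U"
  shows "openin (base M) {x \<in> V. \<phi> x \<in> W}"
proof -
  have "continuous_map (subtopology (base M) U) (subtopology (complex_space m) (\<phi> ` U)) \<phi>"
    using chart_homeomorphism[OF c] homeomorphic_imp_continuous_map by blast
  then have "continuous_map (subtopology (base M) V) (complex_space m) \<phi>"
    using continuous_map_from_subtopology_mono[OF _ V(2)] continuous_map_into_fulltopology by blast
  from openin_continuous_map_preimage[OF this W]
  have "openin (subtopology (base M) V) {x \<in> V. \<phi> x \<in> W}" using V openin_subset by (metis topspace_subtopology_subset)
  then show ?thesis using V openin_trans_full by blast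
qed

lemma holomorphic_funI:
  assumes "\<And>U \<phi>. (U, \<phi>) \<in> charts M \<Longrightarrow> holomorphic_in m (\<phi> ` (U \<inter> W)) (\<lambda>z. f (inv_into U \<phi> z))"
  shows "holomorphic_fun m M W f"
  using assms by (auto simp: holomorphic_fun_def)

lemma holomorphic_funD:
  "\<lbrakk>holomorphic_fun m M W f; (U, \<phi>) \<in> charts M\<rbrakk> \<Longrightarrow> holomorphic_in m (\<phi> ` (U \<inter> W)) (\<lambda>z. f (inv_into U \<phi> z))"
  by (auto simp: holomorphic_fun_def)

lemma openin_chart_image_Int:
  "\<lbrakk>(U, \<phi>) \<in> charts M; openin (base M) W\<rbrakk> \<Longrightarrow> openin (complex_space m) (\<phi> ` (U \<inter> W))"
  using openin_chart_image[of U \<phi> "U \<inter> W"] chart_domain by blast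

lemma holomorphic_fun_subset:
  assumes "holomorphic_fun m M W f" "openin (base M) V" "V \<subseteq> W"
  shows "holomorphic_fun m M V f"
proof (rule holomorphic_funI)
  fix U \<phi> assume c: "(U, \<phi>) \<in> charts M"
  show "holomorphic_in m (\<phi> ` (U \<inter> V)) (\<lambda>z. f (inv_into U \<phi> z))"
    by (rule holomorphic_in_subset[OF holomorphic_funD[OF assms(1) c] openin_chart_image_Int[OF c assms(2)]])
      (use assms(3) in blast)
qed

lemma holomorphic_fun_cong:
  assumes "\<And>x. x \<in> W \<Longrightarrow> f x = g x"
  shows "holomorphic_fun m M W f \<longleftrightarrow> holomorphic_fun m M W g"
proof -
  have "holomorphic_in m (\<phi> ` (U \<inter> W)) (\<lambda>z. f (inv_into U \<phi> z)) \<longleftrightarrow> holomorphic_in m (\<phi> ` (U \<inter> W)) (\<lambda>z. g (inv_into U \<phi> z))"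
    if c: "(U, \<phi>) \<in> charts M" for U \<phi>
    by (rule holomorphic_in_cong) (use chart_inv[OF c] assms in auto)
  then show ?thesis unfolding holomorphic_fun_def by blast
qed

lemma holomorphic_fun_const: "openin (base M) W \<Longrightarrow> holomorphic_fun m M W (\<lambda>_. c)"
  by (intro holomorphic_funI holomorphic_in_const openin_chart_image_Int)

lemma holomorphic_fun_add:
  assumes "holomorphic_fun m M W f" "holomorphic_fun m M W g"
  shows "holomorphic_fun m M W (\<lambda>x. f x + g x)"
  by (rule holomorphic_funI) (rule holomorphic_in_add[OF assms[THEN holomorphic_funD]])

lemma holomorphic_fun_mult:
  assumes "holomorphic_fun m M W f" "holomorphic_fun m M W g"
  shows "holomorphic_fun m M W (\<lambda>x. f x * g x)"
  by (rule holomorphic_funI) (rule holomorphic_in_mult[OF assms[THEN holomorphic_funD]])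

lemma holomorphic_fun_inverse:
  assumes "holomorphic_fun m M W f" "\<And>x. x \<in> W \<Longrightarrow> f x \<noteq> 0"
  shows "holomorphic_fun m M W (\<lambda>x. inverse (f x))"
proof (rule holomorphic_funI)
  fix U \<phi> assume c: "(U, \<phi>) \<in> charts M"
  show "holomorphic_in m (\<phi> ` (U \<inter> W)) (\<lambda>z. inverse (f (inv_into U \<phi> z)))"
    by (rule holomorphic_in_inverse[OF holomorphic_funD[OF assms(1) c]]) (use assms(2) chart_inv[OF c] in auto)
qed

lemma holomorphic_fun_sum:
  assumes "openin (base M) W" "\<And>i. i \<in> I \<Longrightarrow> holomorphic_fun m M W (f i)"
  shows "holomorphic_fun m M W (\<lambda>x. \<Sum>i\<in>I. f i x)"
  by (rule holomorphic_funI)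
    (rule holomorphic_in_sum[OF openin_chart_image_Int[OF _ assms(1)] holomorphic_funD[OF assms(2)]])

text \<open>Holomorphy is a condition in all charts; one chart suffices because the transition maps are
  holomorphic.\<close>

lemma holomorphic_fun_chart:
  assumes c: "(U, \<phi>) \<in> charts M" and W: "openin (base M) W" "W \<subseteq> U"
    and h: "holomorphic_in m V h" and V: "\<And>x. x \<in> W \<Longrightarrow> \<phi> x \<in> V"
  shows "holomorphic_fun m M W (\<lambda>x. h (\<phi> x))"
proof (rule holomorphic_funI)
  fix U' \<psi> assume c': "(U', \<psi>) \<in> charts M"
  note op = openin_chart_image_Int[OF c' W(1)]
  show "holomorphic_in m (\<psi> ` (U' \<inter> W)) (\<lambda>z. h (\<phi> (inv_into U' \<psi> z)))"
  proof (rule holomorphic_in_compose[OF h _ _ op])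
    fix j assume "j < m"
    from holomorphic_in_subset[OF transition_holomorphic[OF c' c this] op]
    show "holomorphic_in m (\<psi> ` (U' \<inter> W)) (\<lambda>w. \<phi> (inv_into U' \<psi> w) j)" using W(2) by blast
  next
    fix w assume "w \<in> \<psi> ` (U' \<inter> W)"
    then show "\<phi> (inv_into U' \<psi> w) \<in> V" using chart_inv[OF c'] V by auto
  qed
qed

lemma holomorphic_fun_coordinate:
  assumes c: "(U, \<phi>) \<in> charts M" and W: "openin (base M) W" "W \<subseteq> U" and i: "i < m"
  shows "holomorphic_fun m M W (\<lambda>x. \<phi> x i)"
  by (rule holomorphic_fun_chart[OF c W holomorphic_in_coordinate[OF chart_image[OF c] i]]) (use W in blast)

lemma holomorphic_fun_in_chart:
  assumes c: "(U, \<phi>) \<in> charts M" and W: "W \<subseteq> U" and f: "holomorphic_fun m M W f"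
  shows "holomorphic_in m (\<phi> ` W) (\<lambda>z. f (inv_into U \<phi> z))"
  using holomorphic_funD[OF f c] W by (simp add: Int_absorb1)

lemma chart_continuous:
  assumes c: "(U, \<phi>) \<in> charts M" and W: "W \<subseteq> U"
  shows "continuous_map (subtopology (base M) W) (subtopology (complex_space m) (\<phi> ` W)) \<phi>"
proof -
  have "continuous_map (subtopology (base M) U) (subtopology (complex_space m) (\<phi> ` U)) \<phi>"
    using chart_homeomorphism[OF c] homeomorphic_imp_continuous_map by blast
  then have "continuous_map (subtopology (base M) W) (complex_space m) \<phi>"
    using continuous_map_from_subtopology_mono[OF _ W] continuous_map_into_fulltopology by blast
  then show ?thesis by (auto simp: continuous_map_in_subtopology)
qed

lemma continuous_map_of_holomorphic_in_chart:
  assumes c: "(U, \<phi>) \<in> charts M" and W: "W \<subseteq> U" and h: "holomorphic_in m (\<phi> ` W) h"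
  shows "continuous_map (subtopology (base M) W) euclidean (\<lambda>x. h (\<phi> x))"
  using continuous_map_compose[OF chart_continuous[OF c W] holomorphic_in_continuous[OF h]] by (simp add: o_def)

lemma holomorphic_fun_continuous:
  assumes c: "(U, \<phi>) \<in> charts M" and W: "W \<subseteq> U" and f: "holomorphic_fun m M W f"
  shows "continuous_map (subtopology (base M) W) euclidean f"
proof (rule continuous_map_eq[OF continuous_map_of_holomorphic_in_chart[OF c W holomorphic_fun_in_chart[OF c W f]]])
  fix x assume "x \<in> topspace (subtopology (base M) W)"
  then have "x \<in> W" by auto
  then show "f (inv_into U \<phi> (\<phi> x)) = f x" using chart_inv[OF c] W by auto
qed

end

section \<open>The local model \<open>\<O> \<otimes> \<Lambda>\<complex>\<^sup>n\<close>\<close>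

definition model_add :: "'p set \<Rightarrow> ('p \<Rightarrow> nat set \<Rightarrow> complex) \<Rightarrow> ('p \<Rightarrow> nat set \<Rightarrow> complex) \<Rightarrow> 'p \<Rightarrow> nat set \<Rightarrow> complex" where
  "model_add W f g = (\<lambda>x\<in>W. \<lambda>S. f x S + g x S)"

definition model_mult :: "'p set \<Rightarrow> ('p \<Rightarrow> nat set \<Rightarrow> complex) \<Rightarrow> ('p \<Rightarrow> nat set \<Rightarrow> complex) \<Rightarrow> 'p \<Rightarrow> nat set \<Rightarrow> complex" where
  "model_mult W f g = (\<lambda>x\<in>W. wedge (f x) (g x))"

definition model_smult :: "'p set \<Rightarrow> complex \<Rightarrow> ('p \<Rightarrow> nat set \<Rightarrow> complex) \<Rightarrow> 'p \<Rightarrow> nat set \<Rightarrow> complex" where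
  "model_smult W c f = (\<lambda>x\<in>W. \<lambda>S. c * f x S)"

definition even_fun :: "'p set \<Rightarrow> ('p \<Rightarrow> complex) \<Rightarrow> 'p \<Rightarrow> nat set \<Rightarrow> complex" where
  "even_fun W h = (\<lambda>x\<in>W. \<lambda>S. if S = {} then h x else 0)"

definition odd_monomial :: "'p set \<Rightarrow> nat set \<Rightarrow> 'p \<Rightarrow> nat set \<Rightarrow> complex" where
  "odd_monomial W S = (\<lambda>x\<in>W. ext_basis S)"

definition has_parity :: "'p set \<Rightarrow> bit \<Rightarrow> ('p \<Rightarrow> nat set \<Rightarrow> complex) \<Rightarrow> bool" where
  "has_parity W i f \<longleftrightarrow> (\<forall>x\<in>W. \<forall>S. f x S \<noteq> 0 \<longrightarrow> of_nat (card S) = i)"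

lemma even_fun_parity: "has_parity W 0 (even_fun W h)"
  by (simp add: has_parity_def even_fun_def)

lemma odd_monomial_parity: "has_parity W (of_nat (card S)) (odd_monomial W S)"
  by (simp add: has_parity_def odd_monomial_def ext_basis_def)

context complex_manifold
begin

lemma model_carrierI:
  assumes "f \<in> extensional W" "\<And>x. x \<in> W \<Longrightarrow> f x \<in> exterior_carrier n" "\<And>S. holomorphic_fun m M W (\<lambda>x. f x S)"
  shows "f \<in> model_carrier m n M W"
  using assms by (auto simp: model_carrier_def PiE_def)

lemma model_carrierD:
  assumes "f \<in> model_carrier m n M W"
  shows "f \<in> extensional W" "\<And>x. x \<in> W \<Longrightarrow> f x \<in> exterior_carrier n" "\<And>S. holomorphic_fun m M W (\<lambda>x. f x S)"
  using assms by (auto simp: model_carrier_def PiE_def)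

lemma model_add_closed:
  assumes "f \<in> model_carrier m n M W" "g \<in> model_carrier m n M W"
  shows "model_add W f g \<in> model_carrier m n M W"
proof (rule model_carrierI)
  fix S
  have "holomorphic_fun m M W (\<lambda>x. f x S + g x S)"
    by (rule holomorphic_fun_add[OF model_carrierD(3)[OF assms(1)] model_carrierD(3)[OF assms(2)]])
  then show "holomorphic_fun m M W (\<lambda>x. model_add W f g x S)"
    by (subst holomorphic_fun_cong[where g = "\<lambda>x. f x S + g x S"]) (auto simp: model_add_def)
qed (use model_carrierD(2)[OF assms(1)] model_carrierD(2)[OF assms(2)] in \<open>auto simp: model_add_def exterior_carrier_def\<close>)

lemma even_fun_closed:
  assumes "holomorphic_fun m M W h" "openin (base M) W"
  shows "even_fun W h \<in> model_carrier m n M W"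
proof (rule model_carrierI)
  fix S
  show "holomorphic_fun m M W (\<lambda>x. even_fun W h x S)"
  proof (cases "S = {}")
    case True
    then show ?thesis using assms(1) by (subst holomorphic_fun_cong[where g = h]) (auto simp: even_fun_def)
  next
    case False
    then show ?thesis using holomorphic_fun_const[OF assms(2), of 0]
      by (subst holomorphic_fun_cong[where g = "\<lambda>_. 0"]) (auto simp: even_fun_def)
  qed
qed (auto simp: even_fun_def exterior_carrier_def)

lemma odd_monomial_closed:
  assumes "openin (base M) W" "S \<subseteq> {..<n}"
  shows "odd_monomial W S \<in> model_carrier m n M W"
proof (rule model_carrierI)
  fix T
  show "holomorphic_fun m M W (\<lambda>x. odd_monomial W S x T)"
    using holomorphic_fun_const[OF assms(1), of "ext_basis S T"]
    by (subst holomorphic_fun_cong[where g = "\<lambda>_. ext_basis S T"]) (auto simp: odd_monomial_def)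
qed (use ext_basis_filt[OF assms(2)] ext_filt_carrier in \<open>auto simp: odd_monomial_def\<close>)

lemma model_mult_closed:
  assumes W: "openin (base M) W" and "f \<in> model_carrier m n M W" "g \<in> model_carrier m n M W"
  shows "model_mult W f g \<in> model_carrier m n M W"
proof (rule model_carrierI)
  fix S
  have "holomorphic_fun m M W (\<lambda>x. shuffle_sign T (S - T) * f x T * g x (S - T))" for T
    by (intro holomorphic_fun_mult holomorphic_fun_const W model_carrierD(3)[OF assms(2)] model_carrierD(3)[OF assms(3)])
  then have "holomorphic_fun m M W (\<lambda>x. \<Sum>T\<in>Pow S. shuffle_sign T (S - T) * f x T * g x (S - T))"
    by (rule holomorphic_fun_sum[OF W])
  then show "holomorphic_fun m M W (\<lambda>x. model_mult W f g x S)"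
    by (subst holomorphic_fun_cong[where g = "\<lambda>x. \<Sum>T\<in>Pow S. shuffle_sign T (S - T) * f x T * g x (S - T)"]) (auto simp: model_mult_def wedge_def)
qed (use model_carrierD(2)[OF assms(2)] model_carrierD(2)[OF assms(3)] wedge_carrier in \<open>auto simp: model_mult_def\<close>)

lemma even_fun_restrict: "V \<subseteq> W \<Longrightarrow> restrict (even_fun W h) V = even_fun V h"
  by (auto simp: even_fun_def fun_eq_iff)

lemma odd_monomial_restrict: "V \<subseteq> W \<Longrightarrow> restrict (odd_monomial W S) V = odd_monomial V S"
  by (auto simp: odd_monomial_def fun_eq_iff)

end

lemma model_sheaf_simps:
  "carrier (model_sheaf m n M W) = model_carrier m n M W"
  "f \<otimes>\<^bsub>model_sheaf m n M W\<^esub> g = model_mult W f g"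
  "f \<oplus>\<^bsub>model_sheaf m n M W\<^esub> g = model_add W f g"
  "c \<odot>\<^bsub>model_sheaf m n M W\<^esub> f = model_smult W c f"
  "\<one>\<^bsub>model_sheaf m n M W\<^esub> = even_fun W (\<lambda>_. 1)"
  "homog (model_sheaf m n M W) i = {f \<in> model_carrier m n M W. has_parity W i f}"
  by (simp_all add: model_sheaf_def model_mult_def model_add_def model_smult_def even_fun_def has_parity_def)

section \<open>Splitting coordinates\<close>

lemma opens_inD: "V \<in> opens_in M U \<Longrightarrow> openin (base M) V" "V \<in> opens_in M U \<Longrightarrow> V \<subseteq> U"
  by (simp_all add: opens_in_def)

lemma opens_in_trans: "V \<in> opens_in M W \<Longrightarrow> W \<in> opens_in M U \<Longrightarrow> V \<in> opens_in M U"
  by (auto simp: opens_in_def)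

context complex_supermanifold
begin

lemma restr_closed:
  "\<lbrakk>V \<in> opens_in M W; openin (base M) W; g \<in> carrier (sections M W)\<rbrakk> \<Longrightarrow> restr M W V g \<in> carrier (sections M V)"
  using restr_hom[of W V] by (auto simp: superalgebra_hom_def ring_hom_def opens_in_def)

end

text \<open>An open set \<open>U\<close> that carries both a splitting \<open>\<theta>\<close> and the coordinates \<open>\<phi>\<close> of a chart of the
  underlying manifold. The domain \<open>U0\<close> of the chart may be larger.\<close>

locale splitting_chart = complex_supermanifold m n M
  for m n :: nat and M :: "('p, 's) supermfd" +
  fixes U0 U :: "'p set" and \<phi> :: "'p \<Rightarrow> nat \<Rightarrow> complex"
    and \<theta> :: "'p set \<Rightarrow> 's \<Rightarrow> 'p \<Rightarrow> nat set \<Rightarrow> complex"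
  assumes chart: "(U0, \<phi>) \<in> charts M" and U_U0: "U \<subseteq> U0" and openin_U: "openin (base M) U"
    and theta_iso: "V \<in> opens_in M U \<Longrightarrow> \<theta> V \<in> superalgebra_iso (sections M V) (model_sheaf m n M V)"
    and theta_restr: "\<lbrakk>V \<in> opens_in M U; W \<in> opens_in M V; f \<in> carrier (sections M V)\<rbrakk> \<Longrightarrow>
      \<theta> W (restr M V W f) = restrict (\<theta> V f) W"

lemma (in complex_supermanifold) splitting_chart_exists:
  assumes x: "x \<in> topspace (base M)"
  shows "\<exists>U0 U \<phi> \<theta>. splitting_chart m n M U0 U \<phi> \<theta> \<and> x \<in> U"
proof -
  obtain U1 \<theta> where U1: "openin (base M) U1" "x \<in> U1"
    "\<And>V. openin (base M) V \<and> V \<subseteq> U1 \<Longrightarrow> \<theta> V \<in> superalgebra_iso (sections M V) (model_sheaf m n M V)"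
    "\<And>V W f. openin (base M) V \<and> openin (base M) W \<and> W \<subseteq> V \<and> V \<subseteq> U1 \<Longrightarrow> f\<in>carrier (sections M V) \<Longrightarrow> \<theta> W (restr M V W f) = restrict (\<theta> V f) W"
    using locally_split[OF x] by (elim exE conjE) (rule that, auto)
  obtain U0 \<phi> where c: "(U0, \<phi>) \<in> charts M" "x \<in> U0" using charts_cover x by blast
  have "splitting_chart m n M U0 (U0 \<inter> U1) \<phi> \<theta>"
  proof
    show "openin (base M) (U0 \<inter> U1)" using U1(1) chart_domain[OF c(1)] by blast
  qed (use c U1 in \<open>auto simp: opens_in_def\<close>)
  then show ?thesis using c U1 by blast
qed

context splitting_chart
begin

definition lift :: "'p set \<Rightarrow> ('p \<Rightarrow> nat set \<Rightarrow> complex) \<Rightarrow> 's" where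
  "lift V h = inv_into (carrier (sections M V)) (\<theta> V) h"

context
  fixes V assumes V: "V \<in> opens_in M U"
begin

lemma theta_bij: "bij_betw (\<theta> V) (carrier (sections M V)) (model_carrier m n M V)"
  using theta_iso[OF V] by (simp add: superalgebra_iso_def model_sheaf_simps)

lemma theta_hom: "\<theta> V \<in> superalgebra_hom (sections M V) (model_sheaf m n M V)"
  using theta_iso[OF V] by (simp add: superalgebra_iso_def)

lemma theta_closed: "f \<in> carrier (sections M V) \<Longrightarrow> \<theta> V f \<in> model_carrier m n M V"
  using theta_bij bij_betwE by blast

lemma lift_closed: "h \<in> model_carrier m n M V \<Longrightarrow> lift V h \<in> carrier (sections M V)"
  unfolding lift_def using theta_bij by (simp add: bij_betw_def inv_into_into)

lemma theta_lift: "h \<in> model_carrier m n M V \<Longrightarrow> \<theta> V (lift V h) = h"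
  unfolding lift_def using theta_bij by (simp add: bij_betw_def f_inv_into_f)

lemma theta_inj: "\<lbrakk>f \<in> carrier (sections M V); g \<in> carrier (sections M V); \<theta> V f = \<theta> V g\<rbrakk> \<Longrightarrow> f = g"
  using theta_bij by (simp add: bij_betw_def inj_on_def)

lemma lift_theta: "f \<in> carrier (sections M V) \<Longrightarrow> lift V (\<theta> V f) = f"
  by (rule theta_inj) (simp_all add: lift_closed theta_closed theta_lift)

lemma theta_add: "\<lbrakk>f \<in> carrier (sections M V); g \<in> carrier (sections M V)\<rbrakk> \<Longrightarrow>
    \<theta> V (f \<oplus>\<^bsub>sections M V\<^esub> g) = model_add V (\<theta> V f) (\<theta> V g)"
  using theta_hom by (simp add: superalgebra_hom_def complex_linear_def model_sheaf_simps)

lemma theta_mult: "\<lbrakk>f \<in> carrier (sections M V); g \<in> carrier (sections M V)\<rbrakk> \<Longrightarrow>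
    \<theta> V (f \<otimes>\<^bsub>sections M V\<^esub> g) = model_mult V (\<theta> V f) (\<theta> V g)"
  using theta_hom by (simp add: superalgebra_hom_def ring_hom_def model_sheaf_simps)

lemma theta_smult: "f \<in> carrier (sections M V) \<Longrightarrow>
    \<theta> V (c \<odot>\<^bsub>sections M V\<^esub> f) = model_smult V c (\<theta> V f)"
  using theta_hom by (simp add: superalgebra_hom_def complex_linear_def model_sheaf_simps)

lemma theta_one: "\<theta> V \<one>\<^bsub>sections M V\<^esub> = even_fun V (\<lambda>_. 1)"
  using theta_hom by (simp add: superalgebra_hom_def ring_hom_def model_sheaf_simps)

lemma sections_ring: "ring (sections M V)" and sections_module: "Module.module complex_field (sections M V)"
  using sections_superalgebra[OF opens_inD(1)[OF V]] by (simp_all add: complex_superalgebra_def)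

lemma sections_closed:
  "\<lbrakk>f \<in> carrier (sections M V); g \<in> carrier (sections M V)\<rbrakk> \<Longrightarrow> f \<oplus>\<^bsub>sections M V\<^esub> g \<in> carrier (sections M V)"
  "\<lbrakk>f \<in> carrier (sections M V); g \<in> carrier (sections M V)\<rbrakk> \<Longrightarrow> f \<otimes>\<^bsub>sections M V\<^esub> g \<in> carrier (sections M V)"
  "f \<in> carrier (sections M V) \<Longrightarrow> c \<odot>\<^bsub>sections M V\<^esub> f \<in> carrier (sections M V)"
  "\<zero>\<^bsub>sections M V\<^esub> \<in> carrier (sections M V)" "\<one>\<^bsub>sections M V\<^esub> \<in> carrier (sections M V)"
proof -
  interpret A: ring "sections M V" by (rule sections_ring)
  show "\<lbrakk>f \<in> carrier (sections M V); g \<in> carrier (sections M V)\<rbrakk> \<Longrightarrow> f \<oplus>\<^bsub>sections M V\<^esub> g \<in> carrier (sections M V)" by (rule A.a_closed)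
  show "\<lbrakk>f \<in> carrier (sections M V); g \<in> carrier (sections M V)\<rbrakk> \<Longrightarrow> f \<otimes>\<^bsub>sections M V\<^esub> g \<in> carrier (sections M V)" by (rule A.m_closed)
  show "\<zero>\<^bsub>sections M V\<^esub> \<in> carrier (sections M V)" by (rule A.zero_closed)
  show "\<one>\<^bsub>sections M V\<^esub> \<in> carrier (sections M V)" by (rule A.one_closed)
  show "f \<in> carrier (sections M V) \<Longrightarrow> c \<odot>\<^bsub>sections M V\<^esub> f \<in> carrier (sections M V)"
    using Module.module.smult_closed[OF sections_module] by (simp add: complex_field_def)
qed

lemma theta_zero: "x \<in> V \<Longrightarrow> \<theta> V \<zero>\<^bsub>sections M V\<^esub> x S = 0"
proof -
  assume x: "x \<in> V"
  interpret A: ring "sections M V" by (rule sections_ring)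
  have "\<theta> V (\<zero>\<^bsub>sections M V\<^esub> \<oplus>\<^bsub>sections M V\<^esub> \<zero>\<^bsub>sections M V\<^esub>) x S = \<theta> V \<zero>\<^bsub>sections M V\<^esub> x S + \<theta> V \<zero>\<^bsub>sections M V\<^esub> x S"
    using x by (simp only: theta_add[OF sections_closed(4) sections_closed(4)]) (simp add: model_add_def)
  then show ?thesis unfolding A.l_zero[OF A.zero_closed] by simp
qed

lemma theta_eq_zeroI:
  assumes f: "f \<in> carrier (sections M V)" and z: "\<And>x S. x \<in> V \<Longrightarrow> \<theta> V f x S = 0"
  shows "f = \<zero>\<^bsub>sections M V\<^esub>"
proof (rule theta_inj[OF f sections_closed(4)])
  show "\<theta> V f = \<theta> V \<zero>\<^bsub>sections M V\<^esub>"
  proof (rule extensionalityI[of _ V])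
    show "\<theta> V f x = \<theta> V \<zero>\<^bsub>sections M V\<^esub> x" if "x \<in> V" for x
      using z[OF that] theta_zero[OF that] by (simp add: fun_eq_iff)
  qed (use model_carrierD(1)[OF theta_closed] f sections_closed(4) in auto)
qed

text \<open>An isomorphism of superalgebras is only required to map homogeneous sections to homogeneous
  ones. The converse holds because the component of \<open>f\<close> of the wrong parity is mapped to \<open>0\<close>.\<close>

lemma theta_homog_iff:
  assumes f: "f \<in> carrier (sections M V)"
  shows "f \<in> homog (sections M V) i \<longleftrightarrow> has_parity V i (\<theta> V f)"
proof
  assume "f \<in> homog (sections M V) i"
  then show "has_parity V i (\<theta> V f)"
    using theta_hom by (auto simp: superalgebra_hom_def model_sheaf_simps)
next
  assume p: "has_parity V i (\<theta> V f)"
  interpret A: complex_superalgebra "sections M V" by (rule sections_superalgebra[OF opens_inD(1)[OF V]])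
  have sub: "homog (sections M V) j \<subseteq> carrier (sections M V)" for j
    using A.submoduleE(1)[OF A.homog_submodule] .
  have par: "has_parity V j (\<theta> V g)" if "g \<in> homog (sections M V) j" for j g
    using theta_hom that by (auto simp: superalgebra_hom_def model_sheaf_simps)
  obtain g h where gh: "g \<in> homog (sections M V) 0" "h \<in> homog (sections M V) 1" "f = g \<oplus>\<^bsub>sections M V\<^esub> h"
    using A.homog_decomposition[OF f] by blast
  have gc: "g \<in> carrier (sections M V)" "h \<in> carrier (sections M V)" using gh sub by auto
  have sum: "\<theta> V f x S = \<theta> V g x S + \<theta> V h x S" if "x \<in> V" for x S
    using theta_add[OF gc] that by (simp add: gh(3) model_add_def)
  show "f \<in> homog (sections M V) i"
  proof (cases i)
    case zero
    have "\<theta> V h x S = 0" if x: "x \<in> V" for x S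
    proof (rule ccontr)
      assume h: "\<theta> V h x S \<noteq> 0"
      then have 1: "of_nat (card S) = (1::bit)" using par[OF gh(2)] x by (simp add: has_parity_def)
      then have "\<theta> V g x S = 0" using par[OF gh(1)] x by (force simp: has_parity_def)
      then have "\<theta> V f x S \<noteq> 0" using sum[OF x] h by simp
      then show False using p x 1 zero by (force simp: has_parity_def)
    qed
    then have "h = \<zero>\<^bsub>sections M V\<^esub>" by (rule theta_eq_zeroI[OF gc(2)])
    then show ?thesis using gh gc A.r_zero zero by simp
  next
    case one
    have "\<theta> V g x S = 0" if x: "x \<in> V" for x S
    proof (rule ccontr)
      assume h: "\<theta> V g x S \<noteq> 0"
      then have 1: "of_nat (card S) = (0::bit)" using par[OF gh(1)] x by (simp add: has_parity_def)
      then have "\<theta> V h x S = 0" using par[OF gh(2)] x by (force simp: has_parity_def)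
      then have "\<theta> V f x S \<noteq> 0" using sum[OF x] h by simp
      then show False using p x 1 one by (force simp: has_parity_def)
    qed
    then have "g = \<zero>\<^bsub>sections M V\<^esub>" by (rule theta_eq_zeroI[OF gc(1)])
    then show ?thesis using gh gc A.l_zero one by simp
  qed
qed

lemma lift_add: "\<lbrakk>h \<in> model_carrier m n M V; k \<in> model_carrier m n M V\<rbrakk> \<Longrightarrow>
    lift V (model_add V h k) = lift V h \<oplus>\<^bsub>sections M V\<^esub> lift V k"
  by (rule theta_inj) (simp_all add: lift_closed model_add_closed sections_closed theta_lift theta_add)

lemma lift_mult: "\<lbrakk>h \<in> model_carrier m n M V; k \<in> model_carrier m n M V\<rbrakk> \<Longrightarrow>
    lift V (model_mult V h k) = lift V h \<otimes>\<^bsub>sections M V\<^esub> lift V k"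
  by (rule theta_inj) (simp_all add: lift_closed model_mult_closed[OF opens_inD(1)[OF V]] sections_closed theta_lift theta_mult)

lemma even_fun_const: "even_fun V (\<lambda>_. c) = model_smult V c (even_fun V (\<lambda>_. 1))"
  by (auto simp: even_fun_def model_smult_def fun_eq_iff)

lemma even_const_closed: "even_fun V (\<lambda>_. c) \<in> model_carrier m n M V"
  by (rule even_fun_closed[OF holomorphic_fun_const]) (use opens_inD(1)[OF V] in auto)

lemma lift_const: "lift V (even_fun V (\<lambda>_. c)) = c \<odot>\<^bsub>sections M V\<^esub> \<one>\<^bsub>sections M V\<^esub>"
proof (rule theta_inj)
  show "\<theta> V (lift V (even_fun V (\<lambda>_. c))) = \<theta> V (c \<odot>\<^bsub>sections M V\<^esub> \<one>\<^bsub>sections M V\<^esub>)"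
    unfolding theta_lift[OF even_const_closed] theta_smult[OF sections_closed(5)] theta_one by (rule even_fun_const)
qed (simp_all add: lift_closed even_const_closed sections_closed)

lemma lift_homog: "h \<in> model_carrier m n M V \<Longrightarrow> has_parity V i h \<Longrightarrow> lift V h \<in> homog (sections M V) i"
  using theta_homog_iff[OF lift_closed] by (simp add: theta_lift)

lemma restr_lift:
  assumes W: "W \<in> opens_in M V" and h: "h \<in> model_carrier m n M V"
  shows "restr M V W (lift V h) = lift W (restrict h W)"
proof -
  have "restr M V W \<in> superalgebra_hom (sections M V) (sections M W)"
    using restr_hom opens_inD[OF W] opens_inD[OF V] by simp
  then have r: "restr M V W (lift V h) \<in> carrier (sections M W)"
    using lift_closed[OF h] by (auto simp: superalgebra_hom_def ring_hom_def)
  have "\<theta> W (restr M V W (lift V h)) = restrict h W"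
    using theta_restr[OF V W lift_closed[OF h]] theta_lift[OF h] by simp
  moreover have "inj_on (\<theta> W) (carrier (sections M W))"
    using theta_iso[OF opens_in_trans[OF W V]] by (simp add: superalgebra_iso_def bij_betw_def)
  then have "lift W (\<theta> W (restr M V W (lift V h))) = restr M V W (lift V h)"
    unfolding lift_def[of W] by (rule inv_into_f_f) (rule r)
  ultimately show ?thesis by simp
qed

end

end

section \<open>Superderivations in splitting coordinates\<close>

locale derivation_in_chart = splitting_chart m n M U0 U \<phi> \<theta>
  for m n :: nat and M :: "('p, 's) supermfd" and U0 U \<phi> \<theta> +
  fixes D :: "'p set \<Rightarrow> 's \<Rightarrow> 's" and i :: bit
  assumes D: "D \<in> homogeneous_superderivations M (topspace (base M)) i"
begin

definition local_D :: "'p set \<Rightarrow> ('p \<Rightarrow> nat set \<Rightarrow> complex) \<Rightarrow> 'p \<Rightarrow> nat set \<Rightarrow> complex" where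
  "local_D V h = \<theta> V (D V (lift V h))"

lemma opens_in_topspace: "V \<in> opens_in M U \<Longrightarrow> V \<in> opens_in M (topspace (base M))"
  by (auto simp: opens_in_def dest: openin_subset)

context
  fixes V assumes V: "V \<in> opens_in M U"
begin

lemma D_linear: "complex_linear (sections M V) (sections M V) (D V)"
  using D opens_in_topspace[OF V] by (simp add: homogeneous_superderivations_def)

lemma D_homog: "D V ` homog (sections M V) j \<subseteq> homog (sections M V) (i + j)"
  using D opens_in_topspace[OF V] by (simp add: homogeneous_superderivations_def)

lemma D_leibniz: "\<lbrakk>f \<in> homog (sections M V) j; g \<in> carrier (sections M V)\<rbrakk> \<Longrightarrow>
   D V (f \<otimes>\<^bsub>sections M V\<^esub> g) = (D V f \<otimes>\<^bsub>sections M V\<^esub> g) \<oplus>\<^bsub>sections M V\<^esub>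
               koszul_sign i j \<odot>\<^bsub>sections M V\<^esub> (f \<otimes>\<^bsub>sections M V\<^esub> D V g)"
  using D opens_in_topspace[OF V] by (simp add: homogeneous_superderivations_def)

lemma D_restr: "\<lbrakk>W \<in> opens_in M V; f \<in> carrier (sections M V)\<rbrakk> \<Longrightarrow> restr M V W (D V f) = D W (restr M V W f)"
  using D opens_in_topspace[OF V] by (simp add: homogeneous_superderivations_def)

lemma D_closed: "f \<in> carrier (sections M V) \<Longrightarrow> D V f \<in> carrier (sections M V)"
  using D_linear by (auto simp: complex_linear_def)

lemma local_D_closed: "h \<in> model_carrier m n M V \<Longrightarrow> local_D V h \<in> model_carrier m n M V"
  unfolding local_D_def by (intro theta_closed[OF V] D_closed lift_closed[OF V])

lemma theta_D: "f \<in> carrier (sections M V) \<Longrightarrow> \<theta> V (D V f) = local_D V (\<theta> V f)"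
  by (simp add: local_D_def lift_theta[OF V])

lemma local_D_add:
  assumes "h \<in> model_carrier m n M V" "k \<in> model_carrier m n M V" "x \<in> V"
  shows "local_D V (model_add V h k) x S = local_D V h x S + local_D V k x S"
proof -
  have "D V (lift V h \<oplus>\<^bsub>sections M V\<^esub> lift V k) = D V (lift V h) \<oplus>\<^bsub>sections M V\<^esub> D V (lift V k)"
    using D_linear lift_closed[OF V] assms by (simp add: complex_linear_def)
  then show ?thesis unfolding local_D_def lift_add[OF V assms(1,2)]
    using theta_add[OF V D_closed[OF lift_closed[OF V assms(1)]] D_closed[OF lift_closed[OF V assms(2)]]] assms(3)
    by (simp add: model_add_def)
qed

lemma local_D_mult:
  assumes h: "h \<in> model_carrier m n M V" "has_parity V j h" and k: "k \<in> model_carrier m n M V" and x: "x \<in> V"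
  shows "local_D V (model_mult V h k) x S =
    wedge (local_D V h x) (k x) S + koszul_sign i j * wedge (h x) (local_D V k x) S"
proof -
  note hc = lift_closed[OF V h(1)] and kc = lift_closed[OF V k]
  note c = sections_closed[OF V]
  have "\<theta> V (D V (lift V h \<otimes>\<^bsub>sections M V\<^esub> lift V k)) =
    model_add V (model_mult V (\<theta> V (D V (lift V h))) k) (model_smult V (koszul_sign i j) (model_mult V h (\<theta> V (D V (lift V k)))))"
    by (simp add: D_leibniz[OF lift_homog[OF V h] kc] theta_add[OF V] theta_mult[OF V] theta_smult[OF V]
        theta_lift[OF V] hc kc D_closed c h k)
  then show ?thesis unfolding local_D_def lift_mult[OF V h(1) k]
    using x by (simp add: model_add_def model_mult_def model_smult_def)
qed

lemma local_D_restrict: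
  assumes W: "W \<in> opens_in M V" and h: "h \<in> model_carrier m n M V"
  shows "local_D W (restrict h W) = restrict (local_D V h) W"
  unfolding local_D_def
  using theta_restr[OF V W D_closed[OF lift_closed[OF V h]]] D_restr[OF W lift_closed[OF V h]] restr_lift[OF V W h]
  by simp

lemma local_D_parity:
  assumes h: "h \<in> model_carrier m n M V" "has_parity V j h"
  shows "has_parity V (i + j) (local_D V h)"
  using theta_homog_iff[OF V D_closed[OF lift_closed[OF V h(1)]]] D_homog[of j] lift_homog[OF V h]
  unfolding local_D_def by blast

text \<open>The Leibniz rule for \<open>1 = 1 \<cdot> 1\<close> gives \<open>D 1 = 2 D 1\<close>.\<close>

lemma local_D_const:
  assumes x: "x \<in> V"
  shows "local_D V (even_fun V (\<lambda>_. c)) x S = 0"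
proof -
  let ?one = "even_fun V (\<lambda>_. 1)"
  have 1: "?one \<in> model_carrier m n M V" by (rule even_const_closed[OF V])
  have ev: "?one x = (\<lambda>S. if S = {} then 1 else 0)" using x by (simp add: even_fun_def)
  have "model_mult V ?one ?one = ?one"
  proof (rule extensionalityI[of _ V])
    fix y assume "y \<in> V"
    then show "model_mult V ?one ?one y = ?one y"
      using wedge_scalar[OF model_carrierD(2)[OF 1], of y 1] by (simp add: model_mult_def even_fun_def)
  qed (simp_all add: model_mult_def even_fun_def)
  with local_D_mult[OF 1 even_fun_parity 1 x, of S]
  have "local_D V ?one x S = wedge (local_D V ?one x) (?one x) S + wedge (?one x) (local_D V ?one x) S"
    by (simp add: koszul_sign_def)
  also have "\<dots> = local_D V ?one x S + local_D V ?one x S"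
    unfolding ev using model_carrierD(2)[OF local_D_closed[OF 1] x] by (simp add: wedge_scalar wedge_scalar_right)
  finally have z: "local_D V ?one x S = 0" by simp
  have "D V (c \<odot>\<^bsub>sections M V\<^esub> \<one>\<^bsub>sections M V\<^esub>) = c \<odot>\<^bsub>sections M V\<^esub> D V \<one>\<^bsub>sections M V\<^esub>"
    using D_linear sections_closed(5)[OF V] by (simp add: complex_linear_def)
  then have "local_D V (even_fun V (\<lambda>_. c)) = model_smult V c (\<theta> V (D V \<one>\<^bsub>sections M V\<^esub>))"
    unfolding local_D_def lift_const[OF V] using theta_smult[OF V D_closed[OF sections_closed(5)[OF V]]] by simp
  also have "\<theta> V (D V \<one>\<^bsub>sections M V\<^esub>) = local_D V ?one"
    unfolding theta_D[OF sections_closed(5)[OF V]] theta_one[OF V] ..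
  finally show ?thesis using z x by (simp add: model_smult_def)
qed

end

text \<open>Write \<open>h\<close> as its body plus \<open>\<Sum>\<^sub>b \<xi>\<^sub>b u\<^sub>b\<close>, where \<open>\<xi>\<^sub>b u\<^sub>b\<close> collects the monomials with smallest index
  \<open>b\<close>. In \<open>D (\<xi>\<^sub>b u\<^sub>b)\<close> the term \<open>\<xi>\<^sub>b D u\<^sub>b\<close> has degree greater than \<open>k\<close>, and in degree \<open>k\<close>
  the term \<open>(D \<xi>\<^sub>b) u\<^sub>b\<close> only sees the body of
  \<open>u\<^sub>b\<close>, which is the coefficient of \<open>\<xi>\<^sub>b\<close> in \<open>h\<close>.\<close>

lemma leading_odd_step:
  assumes V: "V \<in> opens_in M U" and p: "p \<in> V" and T: "T \<subseteq> {..<n}" "card T = k" and h: "h \<in> model_carrier m n M V"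
    and filt: "\<And>V h q. \<lbrakk>V \<in> opens_in M U; h \<in> model_carrier m n M V; q \<in> V\<rbrakk> \<Longrightarrow> local_D V h q \<in> ext_filt n k"
  shows "local_D V h p T = local_D V (even_fun V (\<lambda>x. h x {})) p T + (\<Sum>b<n. h p {b} * local_D U (odd_monomial U {b}) p T)"
proof -
  note Vo = opens_inD(1)[OF V] and VU = opens_inD(2)[OF V]
  have UU: "U \<in> opens_in M U" using openin_U by (simp add: opens_in_def)
  have fT: "finite T" using T finite_subset by blast
  \<comment> \<open>The body together with the monomials whose smallest index is at least \<open>N\<close>.\<close>
  define tail where "tail N = (\<lambda>x\<in>V. \<lambda>S. if S \<subseteq> {N..} then h x S else 0)" for N
  have tail: "tail N \<in> model_carrier m n M V" for N
  proof (rule model_carrierI)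
    fix S
    show "holomorphic_fun m M V (\<lambda>x. tail N x S)"
    proof (cases "S \<subseteq> {N..}")
      case True
      then show ?thesis using model_carrierD(3)[OF h, of S]
        by (subst holomorphic_fun_cong[where g = "\<lambda>x. h x S"]) (auto simp: tail_def)
    next
      case False
      then show ?thesis using holomorphic_fun_const[OF Vo, of 0]
        by (subst holomorphic_fun_cong[where g = "\<lambda>_. 0"]) (auto simp: tail_def)
    qed
  qed (use model_carrierD(2)[OF h] in \<open>auto simp: tail_def exterior_carrier_def\<close>)
  \<comment> \<open>The factor \<open>u\<^sub>N\<close>.\<close>
  define quot where "quot N = (\<lambda>x\<in>V. \<lambda>S. if S \<subseteq> {Suc N..} then h x (insert N S) else 0)" for N
  have quot: "quot N \<in> model_carrier m n M V" for N
  proof (rule model_carrierI)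
    fix S
    show "holomorphic_fun m M V (\<lambda>x. quot N x S)"
    proof (cases "S \<subseteq> {Suc N..}")
      case True
      then show ?thesis using model_carrierD(3)[OF h, of "insert N S"]
        by (subst holomorphic_fun_cong[where g = "\<lambda>x. h x (insert N S)"]) (auto simp: quot_def)
    next
      case False
      then show ?thesis using holomorphic_fun_const[OF Vo, of 0]
        by (subst holomorphic_fun_cong[where g = "\<lambda>_. 0"]) (auto simp: quot_def)
    qed
  qed (use model_carrierD(2)[OF h] in \<open>auto simp: quot_def exterior_carrier_def\<close>)
  have step: "local_D V (tail N) p T = local_D V (tail (Suc N)) p T + h p {N} * local_D U (odd_monomial U {N}) p T"
    if N: "N < n" for N
  proof -
    let ?x = "odd_monomial V {N}"
    have x: "?x \<in> model_carrier m n M V" by (rule odd_monomial_closed[OF Vo]) (use N in simp)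
    have xU: "odd_monomial U {N} \<in> model_carrier m n M U" by (rule odd_monomial_closed[OF openin_U]) (use N in simp)
    have "tail N = model_add V (tail (Suc N)) (model_mult V ?x (quot N))"
    proof (rule extensionalityI[of _ V])
      fix y assume y: "y \<in> V"
      have "wedge (ext_basis {N}) (quot N y) = (\<lambda>S. if N \<in> S then quot N y (S - {N}) else 0)"
        by (rule wedge_ext_basis_singleton[OF model_carrierD(2)[OF quot y]]) (use y in \<open>auto simp: quot_def split: if_splits\<close>)
      then have w: "model_mult V ?x (quot N) y S = (if N \<in> S \<and> S - {N} \<subseteq> {Suc N..} then h y S else 0)" for S
        using y by (auto simp: model_mult_def odd_monomial_def quot_def insert_absorb)
      have "tail N y S = tail (Suc N) y S + (if N \<in> S \<and> S - {N} \<subseteq> {Suc N..} then h y S else 0)" for S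
      proof -
        have "S \<subseteq> {N..} \<longleftrightarrow> S \<subseteq> {Suc N..} \<or> N \<in> S \<and> S - {N} \<subseteq> {Suc N..}"
          by (auto simp: subset_iff Suc_le_eq le_less)
        moreover have "\<not> (S \<subseteq> {Suc N..} \<and> N \<in> S)" by auto
        ultimately show ?thesis using y by (auto simp: tail_def)
      qed
      then show "tail N y = model_add V (tail (Suc N)) (model_mult V ?x (quot N)) y"
        using y by (simp add: model_add_def w fun_eq_iff)
    qed (simp_all add: tail_def model_add_def)
    then have "local_D V (tail N) p T = local_D V (tail (Suc N)) p T + local_D V (model_mult V ?x (quot N)) p T"
      using local_D_add[OF V tail model_mult_closed[OF Vo x quot] p] by simp
    also have "local_D V (model_mult V ?x (quot N)) p T =
      wedge (local_D V ?x p) (quot N p) T + koszul_sign i (of_nat (card {N})) * wedge (?x p) (local_D V (quot N) p) T"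
      by (rule local_D_mult[OF V x odd_monomial_parity quot p])
    also have "wedge (local_D V ?x p) (quot N p) T = local_D V ?x p T * quot N p {}"
      using wedge_leading_left[OF filt[OF V x p] fT] T by simp
    also have "quot N p {} = h p {N}" using p by (simp add: quot_def)
    also have "wedge (?x p) (local_D V (quot N) p) T = 0"
    proof -
      have "?x p \<in> ext_filt n 1" using ext_basis_filt[of "{N}" n] N p by (simp add: odd_monomial_def)
      from ext_filtD[OF wedge_filt[OF this filt[OF V quot p]]] T show ?thesis by simp
    qed
    also have "local_D V ?x = restrict (local_D U (odd_monomial U {N})) V"
      using local_D_restrict[OF UU V xU] odd_monomial_restrict[OF VU] by simp
    finally show ?thesis using p by simp
  qed
  have "local_D V (tail 0) p T = local_D V (tail N) p T + (\<Sum>b<N. h p {b} * local_D U (odd_monomial U {b}) p T)" if "N \<le> n" for N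
    using that by (induction N) (simp_all add: step)
  from this[of n] have "local_D V (tail 0) p T = local_D V (tail n) p T + (\<Sum>b<n. h p {b} * local_D U (odd_monomial U {b}) p T)" by simp
  moreover have "tail 0 = h"
    by (rule extensionalityI[of _ V]) (use model_carrierD(1)[OF h] in \<open>auto simp: tail_def\<close>)
  moreover have "tail n = even_fun V (\<lambda>x. h x {})"
  proof (rule extensionalityI[of _ V])
    fix y assume y: "y \<in> V"
    have "tail n y S = even_fun V (\<lambda>x. h x {}) y S" for S
    proof (cases "S = {} \<or> \<not> S \<subseteq> {n..}")
      case False
      then obtain j where "j \<in> S" "n \<le> j" by blast
      then have "\<not> S \<subseteq> {..<n}" by (auto simp: subset_iff not_less)
      then have "h y S = 0" by (rule exterior_carrierD[OF model_carrierD(2)[OF h y]])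
      then show ?thesis using y False by (simp add: tail_def even_fun_def)
    qed (use y in \<open>auto simp: tail_def even_fun_def\<close>)
    then show "tail n y = even_fun V (\<lambda>x. h x {}) y" by (simp add: fun_eq_iff)
  qed (simp_all add: tail_def even_fun_def)
  ultimately show ?thesis by simp
qed

text \<open>By Hadamard's lemma \<open>f = f p + \<Sum>\<^sub>a (x\<^sub>a - x\<^sub>a p) H\<^sub>a\<close> near \<open>p\<close>. The operator \<open>D\<close> kills the constant,
  and since \<open>x\<^sub>a - x\<^sub>a p\<close> vanishes at \<open>p\<close>, only \<open>(D x\<^sub>a) H\<^sub>a\<close> remains of each product.\<close>

lemma leading_even_step:
  assumes V: "V \<in> opens_in M U" and p: "p \<in> V" and T: "T \<subseteq> {..<n}" "card T = k" and f: "holomorphic_fun m M V f"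
    and filt: "\<And>V h q. \<lbrakk>V \<in> opens_in M U; h \<in> model_carrier m n M V; q \<in> V\<rbrakk> \<Longrightarrow> local_D V h q \<in> ext_filt n k"
  shows "local_D V (even_fun V f) p T =
    (\<Sum>a<m. partial m a (\<lambda>z. f (inv_into U0 \<phi> z)) (\<phi> p) * local_D U (even_fun U (\<lambda>x. \<phi> x a)) p T)"
proof -
  note Vo = opens_inD(1)[OF V] and VU = opens_inD(2)[OF V]
  have VU0: "V \<subseteq> U0" using VU U_U0 by blast
  have UU: "U \<in> opens_in M U" using openin_U by (simp add: opens_in_def)
  have fT: "finite T" using T finite_subset by blast
  define F where "F = (\<lambda>z. f (inv_into U0 \<phi> z))"
  have F: "holomorphic_in m (\<phi> ` V) F" unfolding F_def by (rule holomorphic_fun_in_chart[OF chart VU0 f])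
  have Fp: "F (\<phi> x) = f x" if "x \<in> V" for x using chart_inv[OF chart] VU0 that by (auto simp: F_def)
  obtain r H where r: "r > 0" "ball1 m (\<phi> p) r \<subseteq> \<phi> ` V" and H: "\<And>a. a < m \<Longrightarrow> holomorphic_in m (ball1 m (\<phi> p) r) (H a)"
    and FH: "\<And>w. w \<in> ball1 m (\<phi> p) r \<Longrightarrow> F w = F (\<phi> p) + (\<Sum>a<m. (w a - \<phi> p a) * H a w)"
    and Hp: "\<And>a. a < m \<Longrightarrow> H a (\<phi> p) = partial m a F (\<phi> p)"
    by (rule hadamard[OF F imageI[OF p]]) (rule that)
  define W where "W = {x \<in> V. \<phi> x \<in> ball1 m (\<phi> p) r}"
  have Wo: "openin (base M) W" unfolding W_def by (rule chart_openin_preimage[OF chart openin_ball1 Vo VU0])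
  have WV: "W \<in> opens_in M V" using Wo by (auto simp: opens_in_def W_def)
  note WU = opens_in_trans[OF WV V]
  have WU0: "W \<subseteq> U0" using VU0 by (auto simp: W_def)
  have pW: "p \<in> W" using p r chart_extensional[OF chart] VU0 by (auto simp: W_def ball1_def)
  have hol: "holomorphic_fun m M W (\<lambda>x. H a (\<phi> x))" if "a < m" for a
    by (rule holomorphic_fun_chart[OF chart Wo WU0 H[OF that]]) (simp add: W_def)
  have coord: "holomorphic_fun m M W (\<lambda>x. \<phi> x a + c)" if "a < m" for a c
    by (intro holomorphic_fun_add holomorphic_fun_coordinate[OF chart Wo WU0 that] holomorphic_fun_const Wo)
  have coordU: "even_fun U (\<lambda>x. \<phi> x a) \<in> model_carrier m n M U" if "a < m" for a
    by (intro even_fun_closed holomorphic_fun_coordinate[OF chart openin_U U_U0 that] openin_U)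
  \<comment> \<open>The partial sums of Hadamard's expansion; subtraction is written as addition of a constant to
    match \<open>holomorphic_fun_add\<close>.\<close>
  define G where "G N x = f p + (\<Sum>a<N. (\<phi> x a + - \<phi> p a) * H a (\<phi> x))" for N x
  have G: "holomorphic_fun m M W (G N)" if "N \<le> m" for N
    unfolding G_def
    by (intro holomorphic_fun_add holomorphic_fun_sum holomorphic_fun_mult holomorphic_fun_const coord hol Wo) (use that in auto)
  have "local_D W (even_fun W (G N)) p T = (\<Sum>a<N. H a (\<phi> p) * local_D U (even_fun U (\<lambda>x. \<phi> x a)) p T)" if "N \<le> m" for N
    using that
  proof (induction N)
    case 0
    then show ?case using local_D_const[OF WU pW] by (simp add: G_def)
  next
    case (Suc N)
    then have N: "N < m" by simp
    let ?y = "even_fun W (\<lambda>x. \<phi> x N + - \<phi> p N)" and ?h = "even_fun W (\<lambda>x. H N (\<phi> x))"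
    have y: "?y \<in> model_carrier m n M W" by (intro even_fun_closed coord N Wo)
    have h: "?h \<in> model_carrier m n M W" by (intro even_fun_closed hol N Wo)
    have g: "even_fun W (G N) \<in> model_carrier m n M W" using N by (intro even_fun_closed G Wo) simp
    have eq: "even_fun W (G (Suc N)) = model_add W (even_fun W (G N)) (model_mult W ?y ?h)"
    proof (rule extensionalityI[of _ W])
      fix x assume x: "x \<in> W"
      have "model_mult W ?y ?h x = (\<lambda>S. (\<phi> x N + - \<phi> p N) * ?h x S)"
        using x wedge_scalar[OF model_carrierD(2)[OF h x], of "\<phi> x N + - \<phi> p N"]
        by (simp add: model_mult_def even_fun_def del: add_uminus_conv_diff)
      then show "even_fun W (G (Suc N)) x = model_add W (even_fun W (G N)) (model_mult W ?y ?h) x"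
        using x by (simp add: model_add_def even_fun_def G_def fun_eq_iff)
    qed (simp_all add: even_fun_def model_add_def)
    have "local_D W (even_fun W (G (Suc N))) p T = local_D W (even_fun W (G N)) p T + local_D W (model_mult W ?y ?h) p T"
      unfolding eq by (rule local_D_add[OF WU g model_mult_closed[OF Wo y h] pW])
    also have "local_D W (model_mult W ?y ?h) p T =
      wedge (local_D W ?y p) (?h p) T + koszul_sign i 0 * wedge (?y p) (local_D W ?h p) T"
      by (rule local_D_mult[OF WU y even_fun_parity h pW])
    also have "wedge (local_D W ?y p) (?h p) T = local_D W ?y p T * ?h p {}"
      using wedge_leading_left[OF filt[OF WU y pW] fT] T by simp
    also have "?h p {} = H N (\<phi> p)" using pW by (simp add: even_fun_def)
    also have "wedge (?y p) (local_D W ?h p) T = 0"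
    proof -
      have "?y p = (\<lambda>_. 0)" using pW by (auto simp: even_fun_def)
      then show ?thesis by (simp add: wedge_def)
    qed
    also have "local_D W ?y p T = local_D U (even_fun U (\<lambda>x. \<phi> x N)) p T"
    proof -
      have yW: "even_fun W (\<lambda>x. \<phi> x N) \<in> model_carrier m n M W"
        using coord[OF N, of 0] by (intro even_fun_closed Wo) simp
      have "?y = model_add W (even_fun W (\<lambda>x. \<phi> x N)) (even_fun W (\<lambda>_. - \<phi> p N))"
        by (rule extensionalityI[of _ W]) (auto simp: even_fun_def model_add_def fun_eq_iff)
      then have "local_D W ?y p T = local_D W (even_fun W (\<lambda>x. \<phi> x N)) p T"
        using local_D_add[OF WU yW even_const_closed[OF WU] pW] local_D_const[OF WU pW] by simp
      also have "even_fun W (\<lambda>x. \<phi> x N) = restrict (even_fun U (\<lambda>x. \<phi> x N)) W"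
        by (rule even_fun_restrict[OF opens_inD(2)[OF WU], symmetric])
      also have "local_D W (restrict (even_fun U (\<lambda>x. \<phi> x N)) W) p T = local_D U (even_fun U (\<lambda>x. \<phi> x N)) p T"
        unfolding local_D_restrict[OF UU WU coordU[OF N]] using pW by simp
      finally show ?thesis .
    qed
    finally show ?case using Suc by (simp add: mult.commute)
  qed
  from this[of m] have "local_D W (even_fun W (G m)) p T = (\<Sum>a<m. partial m a F (\<phi> p) * local_D U (even_fun U (\<lambda>x. \<phi> x a)) p T)"
    using Hp by simp
  also have "even_fun W (G m) = restrict (even_fun V f) W"
  proof -
    have "G m x = f x" if "x \<in> W" for x
      using FH[of "\<phi> x"] Fp[of x] Fp[OF p] that by (simp add: G_def W_def)
    then have "even_fun W (G m) = even_fun W f" by (auto simp: even_fun_def fun_eq_iff)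
    then show ?thesis using even_fun_restrict[OF opens_inD(2)[OF WV], of f] by (simp only:)
  qed
  also have "local_D W (restrict (even_fun V f) W) p T = local_D V (even_fun V f) p T"
    unfolding local_D_restrict[OF V WV even_fun_closed[OF f Vo]] using pW by simp
  finally show ?thesis by (simp add: F_def)
qed

text \<open>Modulo degree \<open>k + 1\<close> the operator \<open>D\<close> acts at \<open>p\<close> like a tangent vector.\<close>

lemma leading_coefficient_formula:
  assumes V: "V \<in> opens_in M U" and p: "p \<in> V" and T: "T \<subseteq> {..<n}" "card T = k" and h: "h \<in> model_carrier m n M V"
    and filt: "\<And>V h q. \<lbrakk>V \<in> opens_in M U; h \<in> model_carrier m n M V; q \<in> V\<rbrakk> \<Longrightarrow> local_D V h q \<in> ext_filt n k"
  shows "local_D V h p T =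
     (\<Sum>a<m. partial m a (\<lambda>z. h (inv_into U0 \<phi> z) {}) (\<phi> p) * local_D U (even_fun U (\<lambda>x. \<phi> x a)) p T)
   + (\<Sum>b<n. h p {b} * local_D U (odd_monomial U {b}) p T)"
  using leading_odd_step[OF V p T h filt] leading_even_step[OF V p T model_carrierD(3)[OF h] filt] by simp

end

section \<open>Change of splitting\<close>

locale splitting_change = A: splitting_chart m n M U0 U \<phi> \<theta> + B: splitting_chart m n M U0' U' \<phi>' \<theta>'
  for m n :: nat and M :: "('p, 's) supermfd" and U0 U \<phi> \<theta> U0' U' \<phi>' \<theta>'
begin

definition transfer :: "'p set \<Rightarrow> ('p \<Rightarrow> nat set \<Rightarrow> complex) \<Rightarrow> 'p \<Rightarrow> nat set \<Rightarrow> complex" where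
  "transfer V h = \<theta>' V (A.lift V h)"

context
  fixes V assumes V: "V \<in> opens_in M U" and V': "V \<in> opens_in M U'"
begin

lemma transfer_closed: "h \<in> model_carrier m n M V \<Longrightarrow> transfer V h \<in> model_carrier m n M V"
  unfolding transfer_def by (intro B.theta_closed[OF V'] A.lift_closed[OF V])

lemma transfer_theta: "f \<in> carrier (sections M V) \<Longrightarrow> transfer V (\<theta> V f) = \<theta>' V f"
  by (simp add: transfer_def A.lift_theta[OF V])

lemma transfer_add:
  "\<lbrakk>h \<in> model_carrier m n M V; k \<in> model_carrier m n M V\<rbrakk> \<Longrightarrow>
    transfer V (model_add V h k) = model_add V (transfer V h) (transfer V k)"
  by (simp add: transfer_def A.lift_add[OF V] B.theta_add[OF V'] A.lift_closed[OF V])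

lemma transfer_mult:
  "\<lbrakk>h \<in> model_carrier m n M V; k \<in> model_carrier m n M V\<rbrakk> \<Longrightarrow>
    transfer V (model_mult V h k) = model_mult V (transfer V h) (transfer V k)"
  by (simp add: transfer_def A.lift_mult[OF V] B.theta_mult[OF V'] A.lift_closed[OF V])

lemma transfer_const: "transfer V (even_fun V (\<lambda>_. c)) = even_fun V (\<lambda>_. c)"
  unfolding transfer_def A.lift_const[OF V] B.theta_smult[OF V' B.sections_closed(5)[OF V']] B.theta_one[OF V']
  by (rule A.even_fun_const[OF V, symmetric])

lemma transfer_parity:
  assumes h: "h \<in> model_carrier m n M V" "has_parity V j h"
  shows "has_parity V j (transfer V h)"
  unfolding transfer_def
  using B.theta_homog_iff[OF V' A.lift_closed[OF V h(1)]] A.lift_homog[OF V h] by blast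

end

lemma transfer_restrict:
  assumes V: "V \<in> opens_in M U" and V': "V \<in> opens_in M U'" and W: "W \<in> opens_in M V" and h: "h \<in> model_carrier m n M V"
  shows "transfer W (restrict h W) = restrict (transfer V h) W"
  unfolding transfer_def A.restr_lift[OF V W h, symmetric]
  by (rule B.theta_restr[OF V' W A.lift_closed[OF V h]])

text \<open>An algebra homomorphism preserves units, and the value of \<open>f\<close> at \<open>p\<close> is the only \<open>c\<close> for which \<open>f - c\<close> is not
  invertible near \<open>p\<close>.\<close>

lemma transfer_body:
  assumes V: "V \<in> opens_in M U" and V': "V \<in> opens_in M U'" and f: "holomorphic_fun m M V f" and p: "p \<in> V"
  shows "transfer V (even_fun V f) p {} = f p"
proof (rule ccontr)
  define c where "c = transfer V (even_fun V f) p {}"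
  assume "transfer V (even_fun V f) p {} \<noteq> f p"
  then have fp: "f p \<noteq> c" by (simp add: c_def)
  note Vo = opens_inD(1)[OF V]
  have VU0: "V \<subseteq> U0" using opens_inD(2)[OF V] A.U_U0 by blast
  \<comment> \<open>On \<open>W\<close> the function \<open>f - c\<close> is a unit, but the body of its transfer vanishes at \<open>p\<close>.\<close>
  define W where "W = {x \<in> V. f x \<in> - {c}}"
  have top: "topspace (subtopology (base M) V) = V" using openin_subset[OF Vo] by auto
  have "openin (subtopology (base M) V) {x \<in> topspace (subtopology (base M) V). f x \<in> - {c}}"
    by (rule openin_continuous_map_preimage[OF A.holomorphic_fun_continuous[OF A.chart VU0 f]]) auto
  then have "openin (subtopology (base M) V) W" unfolding W_def top .
  then have Wo: "openin (base M) W" using Vo openin_trans_full by blast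
  have WV: "W \<in> opens_in M V" using Wo by (auto simp: opens_in_def W_def)
  note WU = opens_in_trans[OF WV V] and WU' = opens_in_trans[OF WV V']
  have pW: "p \<in> W" using p fp by (simp add: W_def)
  have fW: "holomorphic_fun m M W f" by (rule A.holomorphic_fun_subset[OF f Wo]) (auto simp: W_def)
  have cW: "holomorphic_fun m M W (\<lambda>_. - c)" by (rule A.holomorphic_fun_const[OF Wo])
  note gW = A.holomorphic_fun_add[OF fW cW]
  have iW: "holomorphic_fun m M W (\<lambda>x. inverse (f x + - c))"
    by (rule A.holomorphic_fun_inverse[OF gW]) (auto simp: W_def)
  let ?g = "even_fun W (\<lambda>x. f x + - c)" and ?i = "even_fun W (\<lambda>x. inverse (f x + - c))"
  note gc = A.even_fun_closed[OF gW Wo] and ic = A.even_fun_closed[OF iW Wo]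
  have "model_mult W ?g ?i = even_fun W (\<lambda>_. 1)"
  proof (rule extensionalityI[of _ W])
    fix x assume x: "x \<in> W"
    have "model_mult W ?g ?i x = (\<lambda>S. (f x + - c) * ?i x S)"
      using x wedge_scalar[OF A.model_carrierD(2)[OF ic x], of "f x + - c"]
      by (simp add: model_mult_def even_fun_def del: add_uminus_conv_diff)
    then show "model_mult W ?g ?i x = even_fun W (\<lambda>_. 1) x" using x by (auto simp: even_fun_def W_def fun_eq_iff)
  qed (simp_all add: even_fun_def model_mult_def)
  then have "model_mult W (transfer W ?g) (transfer W ?i) = even_fun W (\<lambda>_. 1)"
    using transfer_mult[OF WU WU' gc ic] transfer_const[OF WU WU'] by simp
  then have "model_mult W (transfer W ?g) (transfer W ?i) p {} = 1" using pW by (simp add: even_fun_def)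
  then have nz: "transfer W ?g p {} \<noteq> 0" using pW by (auto simp: model_mult_def wedge_empty)
  have "?g = model_add W (even_fun W f) (even_fun W (\<lambda>_. - c))"
    by (rule extensionalityI[of _ W]) (auto simp: even_fun_def model_add_def fun_eq_iff)
  then have "transfer W ?g p {} = transfer W (even_fun W f) p {} - c"
    using transfer_add[OF WU WU' A.even_fun_closed[OF fW Wo] A.even_fun_closed[OF cW Wo]] transfer_const[OF WU WU', of "- c"] pW
    by (simp add: model_add_def even_fun_def)
  moreover have "transfer W (even_fun W f) = restrict (transfer V (even_fun V f)) W"
    using transfer_restrict[OF V V' WV A.even_fun_closed[OF f Vo]] A.even_fun_restrict[OF opens_inD(2)[OF WV]] by simp
  ultimately show False using nz pW by (simp add: c_def)
qed

text \<open>The transfer of an odd coordinate is odd, hence without body; a product of \<open>card S\<close> such elements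
  has degree at least \<open>card S\<close>.\<close>

lemma transfer_monomial:
  assumes V: "V \<in> opens_in M U" and V': "V \<in> opens_in M U'" and S: "S \<subseteq> {..<n}" and p: "p \<in> V"
  shows "transfer V (odd_monomial V S) p \<in> ext_filt n (card S)"
proof -
  note Vo = opens_inD(1)[OF V]
  have "finite S" using S finite_subset by blast
  then show ?thesis using S
  proof (induction S rule: finite_linorder_min_induct)
    case empty
    have "transfer V (odd_monomial V {}) \<in> model_carrier m n M V"
      by (intro transfer_closed[OF V V'] A.odd_monomial_closed[OF Vo]) simp
    then show ?case using A.model_carrierD(2) p by (simp add: ext_filt_0)
  next
    case (insert b S)
    have bS: "b \<notin> S" using insert.hyps by blast
    have b: "odd_monomial V {b} \<in> model_carrier m n M V" by (rule A.odd_monomial_closed[OF Vo]) (use insert.prems in simp)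
    have s: "odd_monomial V S \<in> model_carrier m n M V" by (rule A.odd_monomial_closed[OF Vo]) (use insert.prems in simp)
    have "odd_monomial V (insert b S) = model_mult V (odd_monomial V {b}) (odd_monomial V S)"
    proof (rule extensionalityI[of _ V])
      fix x assume x: "x \<in> V"
      have "wedge (ext_basis {b}) (odd_monomial V S x) = (\<lambda>T. if b \<in> T then odd_monomial V S x (T - {b}) else 0)"
        by (rule wedge_ext_basis_singleton[OF A.model_carrierD(2)[OF s x]])
          (use x insert.hyps in \<open>auto simp: odd_monomial_def ext_basis_def Suc_le_eq split: if_splits\<close>)
      moreover have "T = insert b S \<longleftrightarrow> b \<in> T \<and> T - {b} = S" for T using bS by auto
      ultimately show "odd_monomial V (insert b S) x = model_mult V (odd_monomial V {b}) (odd_monomial V S) x"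
        using x by (auto simp: odd_monomial_def model_mult_def ext_basis_def fun_eq_iff)
    qed (simp_all add: odd_monomial_def model_mult_def)
    then have "transfer V (odd_monomial V (insert b S)) p = wedge (transfer V (odd_monomial V {b}) p) (transfer V (odd_monomial V S) p)"
      using transfer_mult[OF V V' b s] p by (simp add: model_mult_def)
    moreover have "transfer V (odd_monomial V {b}) p \<in> ext_filt n 1"
    proof -
      let ?t = "transfer V (odd_monomial V {b}) p"
      have t: "?t \<in> exterior_carrier n" using A.model_carrierD(2)[OF transfer_closed[OF V V' b] p] .
      have par: "has_parity V (of_nat (card {b})) (transfer V (odd_monomial V {b}))"
        by (rule transfer_parity[OF V V' b odd_monomial_parity])
      have "?t T = 0" if "card T < 1" for T
      proof (cases "finite T")
        case True
        then show ?thesis using par p that by (force simp: has_parity_def)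
      next
        case False
        then have "\<not> T \<subseteq> {..<n}" using finite_subset by blast
        then show ?thesis by (rule exterior_carrierD[OF t])
      qed
      with t show ?thesis by (simp add: ext_filt_def)
    qed
    ultimately show ?case using wedge_filt insert.IH insert.prems bS insert.hyps(1) by fastforce
  qed
qed

text \<open>Expand \<open>h\<close> in monomials. A monomial of degree greater than \<open>k\<close> does not contribute, and for one of
  degree \<open>k\<close> only the body of the transferred coefficient matters, which is the coefficient itself.
  The hypothesis concerns all \<open>q\<close>, not only \<open>p\<close>: a coefficient of degree less than \<open>k\<close> that merely
  vanishes at \<open>p\<close> could contribute through its derivatives.\<close>

lemma transfer_leading:
  assumes V: "V \<in> opens_in M U" and V': "V \<in> opens_in M U'" and h: "h \<in> model_carrier m n M V"
    and filt: "\<And>q. q \<in> V \<Longrightarrow> h q \<in> ext_filt n k" and p: "p \<in> V" and T: "T \<subseteq> {..<n}" "card T \<le> k"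
  shows "transfer V h p T = (\<Sum>S\<in>{S. S \<subseteq> {..<n} \<and> card S = k}. h p S * transfer V (odd_monomial V S) p T)"
proof -
  note Vo = opens_inD(1)[OF V]
  have fT: "finite T" using T finite_subset by blast
  define part where "part \<S> = (\<lambda>x\<in>V. \<lambda>S. if S \<in> \<S> then h x S else 0)" for \<S> :: "nat set set"
  have part: "part \<S> \<in> model_carrier m n M V" for \<S>
  proof (rule A.model_carrierI)
    fix S
    show "holomorphic_fun m M V (\<lambda>x. part \<S> x S)"
    proof (cases "S \<in> \<S>")
      case True
      then show ?thesis using A.model_carrierD(3)[OF h, of S]
        by (subst A.holomorphic_fun_cong[where g = "\<lambda>x. h x S"]) (auto simp: part_def)
    next
      case False
      then show ?thesis using A.holomorphic_fun_const[OF Vo, of 0]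
        by (subst A.holomorphic_fun_cong[where g = "\<lambda>_. 0"]) (auto simp: part_def)
    qed
  qed (use A.model_carrierD(2)[OF h] in \<open>auto simp: part_def exterior_carrier_def\<close>)
  have *: "transfer V (part \<S>) p T = (\<Sum>S\<in>\<S>. if card S = k then h p S * transfer V (odd_monomial V S) p T else 0)"
    if "finite \<S>" "\<S> \<subseteq> Pow {..<n}" for \<S>
    using that
  proof (induction \<S> rule: finite_induct)
    case empty
    have "part {} = even_fun V (\<lambda>_. 0)" by (rule extensionalityI[of _ V]) (auto simp: part_def even_fun_def)
    then have "transfer V (part {}) = even_fun V (\<lambda>_. 0)" using transfer_const[OF V V', of 0] by (simp only:)
    then show ?case using p by (simp add: even_fun_def)
  next
    case (insert S \<S>)
    have S: "S \<subseteq> {..<n}" using insert.prems by simp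
    let ?f = "even_fun V (\<lambda>x. h x S)" and ?e = "odd_monomial V S"
    have f: "?f \<in> model_carrier m n M V" by (rule A.even_fun_closed[OF A.model_carrierD(3)[OF h] Vo])
    have e: "?e \<in> model_carrier m n M V" by (rule A.odd_monomial_closed[OF Vo S])
    have "part (insert S \<S>) = model_add V (part \<S>) (model_mult V ?f ?e)"
    proof (rule extensionalityI[of _ V])
      fix x assume x: "x \<in> V"
      have "model_mult V ?f ?e x = (\<lambda>T. h x S * ?e x T)"
        using x wedge_scalar[OF A.model_carrierD(2)[OF e x], of "h x S"] by (simp add: model_mult_def even_fun_def)
      then show "part (insert S \<S>) x = model_add V (part \<S>) (model_mult V ?f ?e) x"
        using x insert.hyps(2) by (auto simp: part_def model_add_def odd_monomial_def ext_basis_def fun_eq_iff)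
    qed (simp_all add: part_def model_add_def)
    then have "transfer V (part (insert S \<S>)) p T = transfer V (part \<S>) p T + wedge (transfer V ?f p) (transfer V ?e p) T"
      using transfer_add[OF V V' part A.model_mult_closed[OF Vo f e]] transfer_mult[OF V V' f e] p
      by (simp add: model_add_def model_mult_def)
    moreover have "wedge (transfer V ?f p) (transfer V ?e p) T = (if card S = k then h p S * transfer V ?e p T else 0)"
    proof (cases "card S < k")
      case True
      then have "h x S = 0" if "x \<in> V" for x using ext_filtD[OF filt[OF that]] by blast
      then have "?f = even_fun V (\<lambda>_. 0)" by (auto simp: even_fun_def fun_eq_iff)
      then have "transfer V ?f p = (\<lambda>_. 0)" using transfer_const[OF V V', of 0] p by (auto simp: even_fun_def)
      then show ?thesis using True by (simp add: wedge_def)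
    next
      case False
      note t = transfer_monomial[OF V V' S p]
      have "wedge (transfer V ?f p) (transfer V ?e p) T = transfer V ?f p {} * transfer V ?e p T"
        by (rule wedge_leading_right[OF t fT]) (use False T in simp)
      also have "transfer V ?f p {} = h p S" by (rule transfer_body[OF V V' A.model_carrierD(3)[OF h] p])
      finally show ?thesis using ext_filtD[OF t, of T] False T by auto
    qed
    ultimately show ?case using insert by simp
  qed
  have "part (Pow {..<n}) = h"
  proof (rule extensionalityI[of _ V])
    fix x assume x: "x \<in> V"
    then show "part (Pow {..<n}) x = h x"
      using exterior_carrierD[OF A.model_carrierD(2)[OF h x]] by (auto simp: part_def fun_eq_iff)
  qed (use A.model_carrierD(1)[OF h] in \<open>auto simp: part_def\<close>)
  then have "transfer V h p T = (\<Sum>S\<in>Pow {..<n}. if card S = k then h p S * transfer V (odd_monomial V S) p T else 0)"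
    using *[of "Pow {..<n}"] by simp
  also have "\<dots> = (\<Sum>S\<in>{S. S \<subseteq> {..<n} \<and> card S = k}. h p S * transfer V (odd_monomial V S) p T)"
    by (rule sum.mono_neutral_cong_right) auto
  finally show ?thesis .
qed

lemma continuous_on_overlap:
  assumes V: "V \<in> opens_in M U" and h: "h \<in> model_carrier m n M V"
  shows "continuous_map (subtopology (base M) V) euclidean (\<lambda>p. h p S)"
  by (rule A.holomorphic_fun_continuous[OF A.chart _ A.model_carrierD(3)[OF h]])
    (use opens_inD(2)[OF V] A.U_U0 in blast)

text \<open>A bound for the matrix that expresses the lowest-degree coefficients of \<open>D g\<close> in the second chart
  by those of \<open>D x\<^sub>a\<close> and \<open>D \<xi>\<^sub>b\<close> in the first: the entries of the change of splitting times the
  first-order data of \<open>g\<close>. It does not involve \<open>D\<close>.\<close>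

definition transition_bound :: "'s \<Rightarrow> 'p \<Rightarrow> real" where
  "transition_bound g p = (let V = U \<inter> U'; h = \<theta> V (restr M U' V g) in
     (\<Sum>S\<in>Pow {..<n}. \<Sum>T\<in>Pow {..<n}. cmod (transfer V (odd_monomial V S) p T)) *
     ((\<Sum>a<m. cmod (partial m a (\<lambda>z. h (inv_into U0 \<phi> z) {}) (\<phi> p))) + (\<Sum>b<n. cmod (h p {b}))))"

lemma overlap: "U \<inter> U' \<in> opens_in M U" "U \<inter> U' \<in> opens_in M U'"
  using A.openin_U B.openin_U by (auto simp: opens_in_def)

lemma transition_bound_continuous:
  assumes g: "g \<in> carrier (sections M U')"
  shows "continuous_map (subtopology (base M) (U \<inter> U')) euclideanreal (transition_bound g)"
proof -
  define V where "V = U \<inter> U'"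
  define h where "h = \<theta> V (restr M U' V g)"
  have V: "V \<in> opens_in M U" "V \<in> opens_in M U'" using overlap by (auto simp: V_def)
  have VU0: "V \<subseteq> U0" using opens_inD(2)[OF V(1)] A.U_U0 by blast
  have h: "h \<in> model_carrier m n M V"
    unfolding h_def by (intro A.theta_closed[OF V(1)] A.restr_closed V(2) B.openin_U g)
  have t: "transfer V (odd_monomial V S) \<in> model_carrier m n M V" if "S \<in> Pow {..<n}" for S
    by (intro transfer_closed[OF V] A.odd_monomial_closed) (use that opens_inD(1)[OF V(1)] in auto)
  have hF: "holomorphic_in m (\<phi> ` V) (\<lambda>z. h (inv_into U0 \<phi> z) {})"
    by (rule A.holomorphic_fun_in_chart[OF A.chart VU0 A.model_carrierD(3)[OF h]])
  have P: "continuous_map (subtopology (base M) V) euclidean (\<lambda>p. partial m a (\<lambda>z. h (inv_into U0 \<phi> z) {}) (\<phi> p))" if "a < m" for a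
    by (rule A.continuous_map_of_holomorphic_in_chart[OF A.chart VU0 holomorphic_in_partial[OF hF that]])
  have 1: "continuous_map (subtopology (base M) V) euclideanreal
      (\<lambda>p. \<Sum>S\<in>Pow {..<n}. \<Sum>T\<in>Pow {..<n}. cmod (transfer V (odd_monomial V S) p T))"
  proof (rule continuous_map_sum)
    fix S assume S: "S \<in> Pow {..<n}"
    show "continuous_map (subtopology (base M) V) euclideanreal (\<lambda>p. \<Sum>T\<in>Pow {..<n}. cmod (transfer V (odd_monomial V S) p T))"
      by (rule continuous_map_sum) (simp, rule continuous_map_norm, rule continuous_on_overlap[OF V(1) t[OF S]])
  qed simp
  have 2: "continuous_map (subtopology (base M) V) euclideanreal (\<lambda>p. \<Sum>a<m. cmod (partial m a (\<lambda>z. h (inv_into U0 \<phi> z) {}) (\<phi> p)))"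
    by (rule continuous_map_sum) (simp, rule continuous_map_norm, rule P, simp)
  have 3: "continuous_map (subtopology (base M) V) euclideanreal (\<lambda>p. \<Sum>b<n. cmod (h p {b}))"
    by (rule continuous_map_sum) (simp, rule continuous_map_norm, rule continuous_on_overlap[OF V(1) h])
  note continuous_map_real_mult[OF 1 continuous_map_add[OF 2 3]]
  then show ?thesis by (simp add: transition_bound_def[abs_def] Let_def V_def h_def)
qed

end

locale derivation_change = A: derivation_in_chart m n M U0 U \<phi> \<theta> D i + B: derivation_in_chart m n M U0' U' \<phi>' \<theta>' D i
  for m n :: nat and M :: "('p, 's) supermfd" and U0 U \<phi> \<theta> U0' U' \<phi>' \<theta>' and D i
begin

sublocale splitting_change m n M U0 U \<phi> \<theta> U0' U' \<phi>' \<theta>' ..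

text \<open>Apply \<open>leading_coefficient_formula\<close> to \<open>g\<close> in the first chart and carry the result to the second
  one by \<open>transfer_leading\<close>.\<close>

lemma leading_transition:
  assumes filt: "\<And>V h q. \<lbrakk>V \<in> opens_in M U; h \<in> model_carrier m n M V; q \<in> V\<rbrakk> \<Longrightarrow> A.local_D V h q \<in> ext_filt n k"
    and g: "g \<in> carrier (sections M U')" and p: "p \<in> U \<inter> U'" and T: "T \<subseteq> {..<n}" "card T = k"
    and even: "\<And>a S. \<lbrakk>a < m; S \<subseteq> {..<n}; card S = k\<rbrakk> \<Longrightarrow> cmod (A.local_D U (even_fun U (\<lambda>x. \<phi> x a)) p S) \<le> \<mu>"
    and odd: "\<And>b S. \<lbrakk>b < n; S \<subseteq> {..<n}; card S = k\<rbrakk> \<Longrightarrow> cmod (A.local_D U (odd_monomial U {b}) p S) \<le> \<mu>"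
    and mu: "0 \<le> \<mu>"
  shows "cmod (\<theta>' U' (D U' g) p T) \<le> transition_bound g p * \<mu>"
proof -
  define V where "V = U \<inter> U'"
  define h where "h = \<theta> V (restr M U' V g)"
  have V: "V \<in> opens_in M U" "V \<in> opens_in M U'" using overlap by (auto simp: V_def)
  have pV: "p \<in> V" using p by (simp add: V_def)
  have UU': "U' \<in> opens_in M U'" using B.openin_U by (simp add: opens_in_def)
  have gV: "restr M U' V g \<in> carrier (sections M V)" by (intro A.restr_closed V(2) B.openin_U g)
  have h: "h \<in> model_carrier m n M V" unfolding h_def by (rule A.theta_closed[OF V(1) gV])
  note DgV = A.D_closed[OF V(1) gV]
  let ?C1 = "\<lambda>S. \<Sum>T\<in>Pow {..<n}. cmod (transfer V (odd_monomial V S) p T)"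
  let ?C2 = "(\<Sum>a<m. cmod (partial m a (\<lambda>z. h (inv_into U0 \<phi> z) {}) (\<phi> p))) + (\<Sum>b<n. cmod (h p {b}))"
  have C1: "0 \<le> ?C1 S" for S by (intro sum_nonneg norm_ge_zero)
  have C2: "0 \<le> ?C2" by (rule add_nonneg_nonneg; rule sum_nonneg; rule norm_ge_zero)
  have "\<theta>' U' (D U' g) p = restrict (\<theta>' U' (D U' g)) V p" using pV by simp
  also have "restrict (\<theta>' U' (D U' g)) V = \<theta>' V (restr M U' V (D U' g))"
    by (rule B.theta_restr[OF UU' V(2) B.D_closed[OF UU' g], symmetric])
  also have "restr M U' V (D U' g) = D V (restr M U' V g)" by (rule B.D_restr[OF UU' V(2) g])
  also have "\<theta>' V (D V (restr M U' V g)) = transfer V (\<theta> V (D V (restr M U' V g)))"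
    by (rule transfer_theta[OF V DgV, symmetric])
  also have "\<theta> V (D V (restr M U' V g)) = A.local_D V h"
    unfolding h_def by (rule A.theta_D[OF V(1) gV])
  finally have "\<theta>' U' (D U' g) p T = transfer V (A.local_D V h) p T" by simp
  also have "\<dots> = (\<Sum>S\<in>{S. S \<subseteq> {..<n} \<and> card S = k}. A.local_D V h p S * transfer V (odd_monomial V S) p T)"
    by (rule transfer_leading[OF V A.local_D_closed[OF V(1) h] filt[OF V(1) h] pV T(1) eq_refl[OF T(2)]])
  finally have eq: "\<theta>' U' (D U' g) p T = (\<Sum>S\<in>{S. S \<subseteq> {..<n} \<and> card S = k}. A.local_D V h p S * transfer V (odd_monomial V S) p T)" .
  have "cmod (\<theta>' U' (D U' g) p T) \<le> (\<Sum>S\<in>{S. S \<subseteq> {..<n} \<and> card S = k}. (?C2 * \<mu>) * ?C1 S)"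
    unfolding eq
  proof (rule sum_norm_le)
    fix S assume "S \<in> {S. S \<subseteq> {..<n} \<and> card S = k}"
    then have S: "S \<subseteq> {..<n}" "card S = k" by auto
    have b1: "cmod (A.local_D V h p S) \<le> ?C2 * \<mu>"
    proof -
      have eq: "A.local_D V h p S =
           (\<Sum>a<m. partial m a (\<lambda>z. h (inv_into U0 \<phi> z) {}) (\<phi> p) * A.local_D U (even_fun U (\<lambda>x. \<phi> x a)) p S)
         + (\<Sum>b<n. h p {b} * A.local_D U (odd_monomial U {b}) p S)"
        by (rule A.leading_coefficient_formula[OF V(1) pV S h]) (rule filt)
      have "cmod (A.local_D V h p S) \<le>
        (\<Sum>a<m. cmod (partial m a (\<lambda>z. h (inv_into U0 \<phi> z) {}) (\<phi> p)) * \<mu>) + (\<Sum>b<n. cmod (h p {b}) * \<mu>)"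
        unfolding eq
      proof (rule norm_triangle_mono; rule sum_norm_le)
        fix a assume "a \<in> {..<m}"
        then have "a < m" by simp
        from mult_left_mono[OF even[OF this S] norm_ge_zero]
        show "cmod (partial m a (\<lambda>z. h (inv_into U0 \<phi> z) {}) (\<phi> p) * A.local_D U (even_fun U (\<lambda>x. \<phi> x a)) p S)
          \<le> cmod (partial m a (\<lambda>z. h (inv_into U0 \<phi> z) {}) (\<phi> p)) * \<mu>" unfolding norm_mult .
      next
        fix b assume "b \<in> {..<n}"
        then have "b < n" by simp
        from mult_left_mono[OF odd[OF this S] norm_ge_zero]
        show "cmod (h p {b} * A.local_D U (odd_monomial U {b}) p S) \<le> cmod (h p {b}) * \<mu>" unfolding norm_mult .
      qed
      then show ?thesis by (simp add: sum_distrib_right distrib_right)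
    qed
    have b2: "0 \<le> ?C2 * \<mu>" using C2 mu by (rule mult_nonneg_nonneg)
    have b3: "cmod (transfer V (odd_monomial V S) p T) \<le> ?C1 S"
      by (rule member_le_sum[where f = "\<lambda>T. cmod (transfer V (odd_monomial V S) p T)"]) (use T in auto)
    show "cmod (A.local_D V h p S * transfer V (odd_monomial V S) p T) \<le> (?C2 * \<mu>) * ?C1 S"
      unfolding norm_mult by (rule mult_mono[OF b1 b3 b2 norm_ge_zero])
  qed
  also have "\<dots> \<le> (\<Sum>S\<in>Pow {..<n}. (?C2 * \<mu>) * ?C1 S)"
    by (rule sum_mono2) (use mult_nonneg_nonneg[OF mult_nonneg_nonneg[OF C2 mu] C1] in auto)
  also have "\<dots> = transition_bound g p * \<mu>"
    by (simp add: transition_bound_def Let_def V_def h_def sum_distrib_left[symmetric])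
  finally show ?thesis .
qed

end

section \<open>Coordinate discs on a compact manifold\<close>

lemma compactin_closed_ball1: "compactin (complex_space m) {w \<in> extensional {..<m}. dist1 m w z \<le> r}"
proof (rule closed_compactin)
  show "compactin (complex_space m) (PiE {..<m} (\<lambda>i. cball (z i) r))"
    unfolding complex_space_def by (simp add: compactin_PiE)
  show "{w \<in> extensional {..<m}. dist1 m w z \<le> r} \<subseteq> PiE {..<m} (\<lambda>i. cball (z i) r)"
  proof
    fix w assume w: "w \<in> {w \<in> extensional {..<m}. dist1 m w z \<le> r}"
    have "cmod (z i - w i) \<le> r" if "i < m" for i
      using dist1_component[OF that, of w z] w by (simp add: norm_minus_commute)
    then show "w \<in> PiE {..<m} (\<lambda>i. cball (z i) r)" using w by (simp add: PiE_iff dist_norm)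
  qed
  have "openin (complex_space m) (extensional {..<m} - {w \<in> extensional {..<m}. dist1 m w z \<le> r})"
    unfolding openin_complex_space_iff
  proof (intro conjI ballI)
    fix w assume w: "w \<in> extensional {..<m} - {w \<in> extensional {..<m}. dist1 m w z \<le> r}"
    have "ball1 m w (dist1 m w z - r) \<subseteq> extensional {..<m} - {w \<in> extensional {..<m}. dist1 m w z \<le> r}"
    proof
      fix u assume u: "u \<in> ball1 m w (dist1 m w z - r)"
      then show "u \<in> extensional {..<m} - {w \<in> extensional {..<m}. dist1 m w z \<le> r}"
        using dist1_triangle[of m w z u] dist1_commute[of m w u] by (simp add: ball1_def)
    qed
    then show "\<exists>e>0. ball1 m w e \<subseteq> extensional {..<m} - {w \<in> extensional {..<m}. dist1 m w z \<le> r}"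
      using w by (intro exI[of _ "dist1 m w z - r"]) (auto simp: not_le)
  qed blast
  then show "closedin (complex_space m) {w \<in> extensional {..<m}. dist1 m w z \<le> r}"
    by (auto simp: closedin_def)
qed

definition closed_disc :: "nat \<Rightarrow> 'p set \<Rightarrow> ('p \<Rightarrow> nat \<Rightarrow> complex) \<Rightarrow> (nat \<Rightarrow> complex) \<Rightarrow> real \<Rightarrow> 'p set" where
  "closed_disc m U \<phi> c r = {y \<in> U. dist1 m (\<phi> y) c \<le> r}"

definition coordinate_functions ::
  "nat \<Rightarrow> nat \<Rightarrow> 'p set \<Rightarrow> ('p \<Rightarrow> nat \<Rightarrow> complex) \<Rightarrow> ('p \<Rightarrow> nat set \<Rightarrow> complex) set" where
  "coordinate_functions m n U \<phi> =
     (\<lambda>a. even_fun U (\<lambda>x. \<phi> x a)) ` {..<m} \<union> (\<lambda>b. odd_monomial U {b}) ` {..<n}"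

lemma finite_coordinate_functions: "finite (coordinate_functions m n U \<phi>)"
  by (simp add: coordinate_functions_def)

lemma coordinate_functions_parity: "g \<in> coordinate_functions m n U \<phi> \<Longrightarrow> \<exists>j. has_parity U j g"
  unfolding coordinate_functions_def using even_fun_parity odd_monomial_parity by blast

lemma bounded_on_compactin:
  fixes f :: "'p \<Rightarrow> 'b :: real_normed_vector"
  assumes K: "compactin X K" "K \<subseteq> V" and f: "continuous_map (subtopology X V) euclidean f"
  obtains B where "0 \<le> B" "\<And>x. x \<in> K \<Longrightarrow> norm (f x) \<le> B"
proof -
  have "compactin (subtopology X V) K" using K by (simp add: compactin_subtopology)
  from image_compactin[OF this f] have "compact (f ` K)" by simp
  then have "bounded (f ` K)" by (rule compact_imp_bounded)
  then obtain B where "\<And>x. x \<in> K \<Longrightarrow> norm (f x) \<le> B" by (auto simp: bounded_iff)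
  then have "norm (f x) \<le> max 0 B" if "x \<in> K" for x using that by (meson max.coboundedI2)
  then show ?thesis using that[of "max 0 B"] by simp
qed

text \<open>Radius \<open>3 r\<close> in the chart leaves room for the compact disc of radius \<open>2 r\<close>.\<close>

locale coordinate_disc = splitting_chart m n M U0 U \<phi> \<theta>
  for m n :: nat and M :: "('p, 's) supermfd" and U0 U \<phi> \<theta> +
  fixes c :: "nat \<Rightarrow> complex" and r :: real
  assumes r: "r > 0" and disc: "ball1 m c (3 * r) \<subseteq> \<phi> ` U" and c: "c \<in> extensional {..<m}"
begin

lemma phi_extensional: "x \<in> U \<Longrightarrow> \<phi> x \<in> extensional {..<m}"
  using chart_extensional[OF chart] U_U0 by blast

lemma closed_disc_compact:
  assumes s: "s \<le> 2 * r"
  shows "compactin (base M) (closed_disc m U \<phi> c s)"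
proof -
  let ?K = "{w \<in> extensional {..<m}. dist1 m w c \<le> s}"
  have K: "?K \<subseteq> \<phi> ` U" using disc s r by (force simp: ball1_def)
  have "\<phi> ` closed_disc m U \<phi> c s = ?K"
    using K phi_extensional by (auto simp: closed_disc_def image_iff subset_iff)
  then have cK: "compactin (subtopology (complex_space m) (\<phi> ` U0)) (\<phi> ` closed_disc m U \<phi> c s)"
    using compactin_closed_ball1[of m c s] subset_trans[OF K image_mono[OF U_U0]] by (simp only: compactin_subtopology)
  have sub: "closed_disc m U \<phi> c s \<subseteq> topspace (subtopology (base M) U0)"
    using U_U0 openin_subset[OF openin_U] by (auto simp: closed_disc_def)
  from homeomorphic_map_compactness[OF chart_homeomorphism[OF chart] sub] cK
  show ?thesis by (simp add: compactin_subtopology)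
qed

lemma finite_net:
  assumes \<delta>: "\<delta> > 0"
  obtains N where "finite N" "N \<subseteq> closed_disc m U \<phi> c r"
    "\<And>y. y \<in> closed_disc m U \<phi> c r \<Longrightarrow> \<exists>q\<in>N. dist1 m (\<phi> y) (\<phi> q) < \<delta>"
proof -
  define B where "B q = {y \<in> U. \<phi> y \<in> ball1 m (\<phi> q) \<delta>}" for q
  have op: "openin (base M) (B q)" for q
    unfolding B_def by (rule chart_openin_preimage[OF chart openin_ball1 openin_U U_U0])
  have cov: "closed_disc m U \<phi> c r \<subseteq> \<Union> (B ` closed_disc m U \<phi> c r)"
    using \<delta> phi_extensional by (auto simp: B_def ball1_def closed_disc_def)
  have "compactin (base M) (closed_disc m U \<phi> c r)" using r by (intro closed_disc_compact) simp
  from compactinD[OF this _ cov] op obtain \<F> where F: "finite \<F>" "\<F> \<subseteq> B ` closed_disc m U \<phi> c r" "closed_disc m U \<phi> c r \<subseteq> \<Union>\<F>"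
    by blast
  then obtain N where N: "N \<subseteq> closed_disc m U \<phi> c r" "finite N" "\<F> = B ` N"
    using finite_subset_image by metis
  have "\<exists>q\<in>N. dist1 m (\<phi> y) (\<phi> q) < \<delta>" if "y \<in> closed_disc m U \<phi> c r" for y
  proof -
    from that F(3) N(3) obtain q where "q \<in> N" "y \<in> B q" by blast
    then show ?thesis by (auto simp: B_def ball1_def)
  qed
  with N that show ?thesis by blast
qed

text \<open>This is the Lipschitz estimate between \<open>y\<close> and the net point \<open>q\<close>, made on the ball of radius
  \<open>r\<close> around \<open>q\<close>, which lies in the disc of radius \<open>2 r\<close>.\<close>

lemma small_if_zero_on_net:
  assumes f: "holomorphic_fun m M U f" and A: "\<And>y. y \<in> closed_disc m U \<phi> c (2 * r) \<Longrightarrow> cmod (f y) \<le> A"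
    and \<delta>: "2 * \<delta> \<le> r" and y: "y \<in> closed_disc m U \<phi> c r" and q: "q \<in> closed_disc m U \<phi> c r"
    and d: "dist1 m (\<phi> y) (\<phi> q) < \<delta>" and z: "f q = 0"
  shows "cmod (f y) \<le> 2 * A / r * \<delta>"
proof -
  define F where "F = (\<lambda>z. f (inv_into U0 \<phi> z))"
  have F: "holomorphic_in m (\<phi> ` U) F" unfolding F_def by (rule holomorphic_fun_in_chart[OF chart U_U0 f])
  have Fp: "F (\<phi> x) = f x" if "x \<in> U" for x using chart_inv[OF chart] U_U0 that by (auto simp: F_def)
  have yU: "y \<in> U" "q \<in> U" using y q by (auto simp: closed_disc_def)
  have sub: "u \<in> \<phi> ` U \<and> dist1 m u c \<le> 2 * r" if "u \<in> ball1 m (\<phi> q) r" for u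
  proof -
    have "dist1 m u c \<le> 2 * r" using that q dist1_triangle[of m u c "\<phi> q"] by (auto simp: ball1_def closed_disc_def)
    moreover from this have "u \<in> ball1 m c (3 * r)" using that r by (simp add: ball1_def)
    ultimately show ?thesis using disc by blast
  qed
  have FB: "holomorphic_in m (ball1 m (\<phi> q) r) F"
    by (rule holomorphic_in_subset[OF F openin_ball1]) (use sub in blast)
  have bd: "cmod (F u) \<le> A" if u: "u \<in> ball1 m (\<phi> q) r" for u
  proof -
    obtain x where x: "x \<in> U" "u = \<phi> x" using sub[OF u] by blast
    then show ?thesis using Fp[OF x(1)] A[of x] sub[OF u] by (simp add: closed_disc_def)
  qed
  have d2: "2 * dist1 m (\<phi> y) (\<phi> q) < r" using d \<delta> by linarith
  have "cmod (F (\<phi> y) - F (\<phi> q)) \<le> 2 * A / r * dist1 m (\<phi> y) (\<phi> q)"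
    by (rule line_difference_estimates(1)[OF FB bd phi_extensional[OF yU(2)] phi_extensional[OF yU(1)] d2])
  also have "\<dots> \<le> 2 * A / r * \<delta>"
  proof (rule mult_left_mono)
    have "cmod (f q) \<le> A" using A[of q] q r by (simp add: closed_disc_def)
    from order_trans[OF norm_ge_zero this] show "0 \<le> 2 * A / r" using r by simp
  qed (use d in simp)
  finally show ?thesis using Fp yU z by simp
qed

lemma coordinate_functions_closed: "coordinate_functions m n U \<phi> \<subseteq> model_carrier m n M U"
  unfolding coordinate_functions_def
  using even_fun_closed[OF holomorphic_fun_coordinate[OF chart openin_U U_U0] openin_U] odd_monomial_closed[OF openin_U]
  by auto

end

lemma (in complex_supermanifold) coordinate_disc_exists:
  assumes x: "x \<in> topspace (base M)"
  shows "\<exists>U0 U \<phi> \<theta> c r. coordinate_disc m n M U0 U \<phi> \<theta> c r \<and> x \<in> U \<and> c = \<phi> x"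
proof -
  obtain U0 U \<phi> \<theta> where s: "splitting_chart m n M U0 U \<phi> \<theta>" and xU: "x \<in> U"
    using splitting_chart_exists[OF x] by blast
  interpret splitting_chart m n M U0 U \<phi> \<theta> by (rule s)
  have "openin (complex_space m) (\<phi> ` U)" by (rule openin_chart_image[OF chart openin_U U_U0])
  then obtain e where e: "e > 0" "ball1 m (\<phi> x) e \<subseteq> \<phi> ` U" using xU unfolding openin_complex_space_iff by blast
  have "coordinate_disc m n M U0 U \<phi> \<theta> (\<phi> x) (e / 3)"
    by unfold_locales (use e xU U_U0 chart_extensional[OF chart] in auto)
  with xU show ?thesis by blast
qed

locale disc_cover = complex_supermanifold m n M
  for m n :: nat and M :: "('p, 's) supermfd" +
  fixes J :: "'j set" and U0 U :: "'j \<Rightarrow> 'p set" and \<phi> :: "'j \<Rightarrow> 'p \<Rightarrow> nat \<Rightarrow> complex"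
    and \<theta> :: "'j \<Rightarrow> 'p set \<Rightarrow> 's \<Rightarrow> 'p \<Rightarrow> nat set \<Rightarrow> complex" and c :: "'j \<Rightarrow> nat \<Rightarrow> complex" and r :: "'j \<Rightarrow> real"
  assumes finite_J: "finite J"
    and discs: "j \<in> J \<Longrightarrow> coordinate_disc m n M (U0 j) (U j) (\<phi> j) (\<theta> j) (c j) (r j)"
    and cover: "topspace (base M) \<subseteq> (\<Union>j\<in>J. closed_disc m (U j) (\<phi> j) (c j) (r j))"

lemma (in complex_supermanifold) disc_cover_exists:
  assumes compact: "compact_space (base M)"
  shows "\<exists>(J :: 'p set) U0 U \<phi> \<theta> c r. disc_cover m n M J U0 U \<phi> \<theta> c r"
proof -
  have "\<exists>U0 U \<phi> \<theta> c r. x \<in> topspace (base M) \<longrightarrow> coordinate_disc m n M U0 U \<phi> \<theta> c r \<and> x \<in> U \<and> c = \<phi> x" for x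
    using coordinate_disc_exists[of x] by blast
  then have "\<forall>x. \<exists>t. x \<in> topspace (base M) \<longrightarrow>
      (case t of (U0, U, \<phi>, \<theta>, c, r) \<Rightarrow> coordinate_disc m n M U0 U \<phi> \<theta> c r \<and> x \<in> U \<and> c = \<phi> x)"
    by simp
  from choice[OF this] obtain t where t: "\<And>x. x \<in> topspace (base M) \<Longrightarrow>
      (case t x of (U0, U, \<phi>, \<theta>, c, r) \<Rightarrow> coordinate_disc m n M U0 U \<phi> \<theta> c r \<and> x \<in> U \<and> c = \<phi> x)" by blast
  define U0 U \<phi> \<theta> c r where "U0 x = fst (t x)" and "U x = fst (snd (t x))" and "\<phi> x = fst (snd (snd (t x)))"
    and "\<theta> x = fst (snd (snd (snd (t x))))" and "c x = fst (snd (snd (snd (snd (t x)))))"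
    and "r x = snd (snd (snd (snd (snd (t x)))))" for x
  note defs = this
  have d: "coordinate_disc m n M (U0 x) (U x) (\<phi> x) (\<theta> x) (c x) (r x) \<and> x \<in> U x \<and> c x = \<phi> x x"
    if "x \<in> topspace (base M)" for x
    using t[OF that] unfolding defs case_prod_beta .
  define B where "B x = {y \<in> U x. \<phi> x y \<in> ball1 m (c x) (r x)}" for x
  have B: "openin (base M) (B x)" "x \<in> B x" "B x \<subseteq> closed_disc m (U x) (\<phi> x) (c x) (r x)" if x: "x \<in> topspace (base M)" for x
  proof -
    interpret coordinate_disc m n M "U0 x" "U x" "\<phi> x" "\<theta> x" "c x" "r x" using d[OF x] by blast
    show "openin (base M) (B x)" unfolding B_def by (rule chart_openin_preimage[OF chart openin_ball1 openin_U U_U0])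
    show "x \<in> B x" using d[OF x] r c by (simp add: B_def ball1_def)
    show "B x \<subseteq> closed_disc m (U x) (\<phi> x) (c x) (r x)" by (auto simp: B_def ball1_def closed_disc_def)
  qed
  have "topspace (base M) \<subseteq> \<Union> (B ` topspace (base M))" using B(2) by blast
  moreover have "\<forall>V\<in>B ` topspace (base M). openin (base M) V" using B(1) by blast
  ultimately obtain \<F> where F: "finite \<F>" "\<F> \<subseteq> B ` topspace (base M)" "topspace (base M) \<subseteq> \<Union>\<F>"
    using compact unfolding compact_space_alt by meson
  then obtain J where J: "J \<subseteq> topspace (base M)" "finite J" "\<F> = B ` J" using finite_subset_image by metis
  have "disc_cover m n M J U0 U \<phi> \<theta> c r"
  proof (rule disc_cover.intro[OF complex_supermanifold_axioms disc_cover_axioms.intro])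
    show "topspace (base M) \<subseteq> (\<Union>j\<in>J. closed_disc m (U j) (\<phi> j) (c j) (r j))"
      using F(3) J B(3) by blast
    show "coordinate_disc m n M (U0 j) (U j) (\<phi> j) (\<theta> j) (c j) (r j)" if "j \<in> J" for j
      using d J(1) that by blast
  qed (rule J(2))
  then show ?thesis by blast
qed

section \<open>Superderivations that vanish on a fine net\<close>

context disc_cover
begin

abbreviation gens :: "'j \<Rightarrow> ('p \<Rightarrow> nat set \<Rightarrow> complex) set" where
  "gens j \<equiv> coordinate_functions m n (U j) (\<phi> j)"

text \<open>The local expression of \<open>D\<close>, here without the assumption that \<open>D\<close> is a homogeneous
  superderivation: it serves as a linear functional of \<open>D\<close> on all of \<open>Vec M\<close>.\<close>

definition chart_D :: "('p set \<Rightarrow> 's \<Rightarrow> 's) \<Rightarrow> 'j \<Rightarrow> 'p set \<Rightarrow> ('p \<Rightarrow> nat set \<Rightarrow> complex) \<Rightarrow> 'p \<Rightarrow> nat set \<Rightarrow> complex" where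
  "chart_D D j V h = \<theta> j V (D V (splitting_chart.lift M (\<theta> j) V h))"

definition filtered :: "('p set \<Rightarrow> 's \<Rightarrow> 's) \<Rightarrow> nat \<Rightarrow> bool" where
  "filtered D k \<longleftrightarrow> (\<forall>j\<in>J. \<forall>V\<in>opens_in M (U j). \<forall>h\<in>model_carrier m n M V. \<forall>q\<in>V. chart_D D j V h q \<in> ext_filt n k)"

lemma derivation_chart:
  assumes "j \<in> J" "D \<in> homogeneous_superderivations M (topspace (base M)) i"
  shows "derivation_in_chart m n M (U0 j) (U j) (\<phi> j) (\<theta> j) D i"
proof -
  interpret coordinate_disc m n M "U0 j" "U j" "\<phi> j" "\<theta> j" "c j" "r j" by (rule discs[OF assms(1)])
  show ?thesis by unfold_locales (rule assms(2))
qed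

lemma chart_D_eq_local_D:
  assumes "j \<in> J" "D \<in> homogeneous_superderivations M (topspace (base M)) i"
  shows "chart_D D j V h = derivation_in_chart.local_D M (\<theta> j) D V h"
proof -
  interpret derivation_in_chart m n M "U0 j" "U j" "\<phi> j" "\<theta> j" D i by (rule derivation_chart[OF assms])
  show ?thesis by (simp add: chart_D_def local_D_def)
qed

lemma chart_D_closed:
  assumes j: "j \<in> J" and D: "D \<in> homogeneous_superderivations M (topspace (base M)) i"
    and V: "V \<in> opens_in M (U j)" and h: "h \<in> model_carrier m n M V"
  shows "chart_D D j V h \<in> model_carrier m n M V"
proof -
  interpret derivation_in_chart m n M "U0 j" "U j" "\<phi> j" "\<theta> j" D i by (rule derivation_chart[OF j D])
  show ?thesis unfolding chart_D_eq_local_D[OF j D] by (rule local_D_closed[OF V h])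
qed

lemma U_open: "j \<in> J \<Longrightarrow> U j \<in> opens_in M (U j)"
proof -
  assume "j \<in> J"
  then interpret coordinate_disc m n M "U0 j" "U j" "\<phi> j" "\<theta> j" "c j" "r j" by (rule discs)
  show "U j \<in> opens_in M (U j)" using openin_U by (simp add: opens_in_def)
qed

lemma gens_closed: "j \<in> J \<Longrightarrow> g \<in> gens j \<Longrightarrow> g \<in> model_carrier m n M (U j)"
proof -
  assume "j \<in> J"
  then interpret coordinate_disc m n M "U0 j" "U j" "\<phi> j" "\<theta> j" "c j" "r j" by (rule discs)
  show "g \<in> gens j \<Longrightarrow> g \<in> model_carrier m n M (U j)" using coordinate_functions_closed by blast
qed

text \<open>The function \<open>b\<close> is chosen before \<open>D\<close> and \<open>k\<close>. The case \<open>V = U j\<close> compares maxima over discs;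
  with \<open>\<mu> = 0\<close> and arbitrary \<open>V\<close> the same statement spreads the vanishing of the coefficients from
  the coordinates to all sections.\<close>

lemma transition_pair:
  assumes j: "j \<in> J" and l: "l \<in> J" and V: "V \<in> opens_in M (U j)" and g: "g \<in> model_carrier m n M V"
  shows "\<exists>b. continuous_map (subtopology (base M) (U l \<inter> V)) euclideanreal b \<and>
    (\<forall>D i k p T \<mu>. D \<in> homogeneous_superderivations M (topspace (base M)) i \<longrightarrow> filtered D k \<longrightarrow> p \<in> U l \<inter> V \<longrightarrow>
       T \<subseteq> {..<n} \<longrightarrow> card T = k \<longrightarrow> 0 \<le> \<mu> \<longrightarrow>
       (\<forall>g'\<in>gens l. \<forall>S. S \<subseteq> {..<n} \<longrightarrow> card S = k \<longrightarrow> cmod (chart_D D l (U l) g' p S) \<le> \<mu>) \<longrightarrow>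
       cmod (chart_D D j V g p T) \<le> b p * \<mu>)"
proof -
  interpret A: coordinate_disc m n M "U0 l" "U l" "\<phi> l" "\<theta> l" "c l" "r l" by (rule discs[OF l])
  interpret C: coordinate_disc m n M "U0 j" "U j" "\<phi> j" "\<theta> j" "c j" "r j" by (rule discs[OF j])
  interpret B: splitting_chart m n M "U0 j" V "\<phi> j" "\<theta> j"
    by unfold_locales
      (use C.chart C.U_U0 C.theta_iso C.theta_restr opens_inD[OF V] opens_in_trans[OF _ V] in auto)
  interpret splitting_change m n M "U0 l" "U l" "\<phi> l" "\<theta> l" "U0 j" V "\<phi> j" "\<theta> j" ..
  have VV: "V \<in> opens_in M V" using opens_inD[OF V] by (simp add: opens_in_def)
  let ?g = "C.lift V g"
  have gc: "?g \<in> carrier (sections M V)" by (rule C.lift_closed[OF V g])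
  have "cmod (chart_D D j V g p T) \<le> transition_bound ?g p * \<mu>"
    if D: "D \<in> homogeneous_superderivations M (topspace (base M)) i" and filt: "filtered D k" and p: "p \<in> U l \<inter> V"
      and T: "T \<subseteq> {..<n}" "card T = k" and mu: "0 \<le> \<mu>"
      and bd: "\<forall>g'\<in>gens l. \<forall>S. S \<subseteq> {..<n} \<longrightarrow> card S = k \<longrightarrow> cmod (chart_D D l (U l) g' p S) \<le> \<mu>" for D i k p T \<mu>
  proof -
    interpret DC: derivation_change m n M "U0 l" "U l" "\<phi> l" "\<theta> l" "U0 j" V "\<phi> j" "\<theta> j" D i
      by unfold_locales (rule D)
    have eq: "DC.A.local_D W h = chart_D D l W h" for W h by (simp add: chart_D_def DC.A.local_D_def)
    have "cmod (\<theta> j V (D V ?g) p T) \<le> transition_bound ?g p * \<mu>"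
    proof (rule DC.leading_transition[OF _ gc p T _ _ mu])
      show "DC.A.local_D W h q \<in> ext_filt n k" if "W \<in> opens_in M (U l)" "h \<in> model_carrier m n M W" "q \<in> W" for W h q
        using filt l that by (simp add: eq filtered_def)
      show "cmod (DC.A.local_D (U l) (even_fun (U l) (\<lambda>x. \<phi> l x a)) p S) \<le> \<mu>" if "a < m" "S \<subseteq> {..<n}" "card S = k" for a S
        using bd that by (auto simp: eq coordinate_functions_def)
      show "cmod (DC.A.local_D (U l) (odd_monomial (U l) {b}) p S) \<le> \<mu>" if "b < n" "S \<subseteq> {..<n}" "card S = k" for b S
        using bd that by (auto simp: eq coordinate_functions_def)
    qed
    then show ?thesis by (simp add: chart_D_def)
  qed
  with transition_bound_continuous[OF gc] show ?thesis by blast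
qed

end

context complex_supermanifold
begin

lemma sections_zero_closed: "openin (base M) V \<Longrightarrow> \<zero>\<^bsub>sections M V\<^esub> \<in> carrier (sections M V)"
proof -
  assume "openin (base M) V"
  then have "ring (sections M V)" using sections_superalgebra by (simp add: complex_superalgebra_def)
  then show ?thesis
    by (rule abelian_monoid.zero_closed[OF abelian_group.axioms(1)[OF ring.is_abelian_group]])
qed

lemma sections_smult_zero:
  assumes "openin (base M) V" "f \<in> carrier (sections M V)"
  shows "0 \<odot>\<^bsub>sections M V\<^esub> f = \<zero>\<^bsub>sections M V\<^esub>"
proof -
  interpret A: complex_superalgebra "sections M V" by (rule sections_superalgebra[OF assms(1)])
  show ?thesis using A.smult_l_null[OF assms(2)] by (simp add: complex_field_def)
qed

lemma restr_zero:
  assumes V: "openin (base M) V" and W: "W \<in> opens_in M V"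
  shows "restr M V W \<zero>\<^bsub>sections M V\<^esub> = \<zero>\<^bsub>sections M W\<^esub>"
proof -
  note z = sections_zero_closed[OF V]
  have "restr M V W (0 \<odot>\<^bsub>sections M V\<^esub> \<zero>\<^bsub>sections M V\<^esub>) = 0 \<odot>\<^bsub>sections M W\<^esub> restr M V W \<zero>\<^bsub>sections M V\<^esub>"
    using restr_hom[OF V opens_inD[OF W]] z by (simp add: superalgebra_hom_def complex_linear_def)
  then show ?thesis
    unfolding sections_smult_zero[OF V z] sections_smult_zero[OF opens_inD(1)[OF W] restr_closed[OF W V z]] .
qed

text \<open>Uniqueness in the gluing axiom, for the family of zero sections.\<close>

lemma section_zero_locally:
  assumes V: "openin (base M) V" and f: "f \<in> carrier (sections M V)" and cov: "\<Union>\<U> = V"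
    and op: "\<And>W. W \<in> \<U> \<Longrightarrow> openin (base M) W" and z: "\<And>W. W \<in> \<U> \<Longrightarrow> restr M V W f = \<zero>\<^bsub>sections M W\<^esub>"
  shows "f = \<zero>\<^bsub>sections M V\<^esub>"
proof -
  have WV: "W \<in> opens_in M V" if "W \<in> \<U>" for W using op[OF that] cov that by (auto simp: opens_in_def)
  note z0 = sections_zero_closed
  have "\<exists>!f. f \<in> carrier (sections M (\<Union>\<U>)) \<and> (\<forall>W\<in>\<U>. restr M (\<Union>\<U>) W f = \<zero>\<^bsub>sections M W\<^esub>)"
  proof (rule gluing)
    fix W W' assume "W \<in> \<U>" "W' \<in> \<U>"
    then have "W \<inter> W' \<in> opens_in M W" "W \<inter> W' \<in> opens_in M W'" "openin (base M) W" "openin (base M) W'"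
      using op by (auto simp: opens_in_def)
    then show "restr M W (W \<inter> W') \<zero>\<^bsub>sections M W\<^esub> = restr M W' (W \<inter> W') \<zero>\<^bsub>sections M W'\<^esub>"
      by (simp add: restr_zero)
  qed (use op z0 in auto)
  then show ?thesis
    unfolding cov using f z z0[OF V] restr_zero[OF V WV] by blast
qed

end

context disc_cover
begin

abbreviation inner :: "'j \<Rightarrow> 'p set" where
  "inner j \<equiv> closed_disc m (U j) (\<phi> j) (c j) (r j)"

abbreviation outer :: "'j \<Rightarrow> 'p set" where
  "outer j \<equiv> closed_disc m (U j) (\<phi> j) (c j) (2 * r j)"

definition leading_bound :: "('p set \<Rightarrow> 's \<Rightarrow> 's) \<Rightarrow> nat \<Rightarrow> 'j \<Rightarrow> 'p \<Rightarrow> real \<Rightarrow> bool" where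
  "leading_bound D k j p \<mu> \<longleftrightarrow>
     (\<forall>g\<in>gens j. \<forall>S. S \<subseteq> {..<n} \<longrightarrow> card S = k \<longrightarrow> cmod (chart_D D j (U j) g p S) \<le> \<mu>)"

lemma disc_facts:
  assumes "j \<in> J"
  shows "r j > 0" "compactin (base M) (outer j)" "compactin (base M) (inner j)"
    "inner j \<subseteq> outer j" "outer j \<subseteq> U j" "U j \<subseteq> topspace (base M)" "U j \<subseteq> U0 j" "(U0 j, \<phi> j) \<in> charts M"
proof -
  interpret coordinate_disc m n M "U0 j" "U j" "\<phi> j" "\<theta> j" "c j" "r j" by (rule discs[OF assms])
  show "r j > 0" by (rule r)
  show "compactin (base M) (outer j)" by (rule closed_disc_compact) simp
  show "compactin (base M) (inner j)" by (rule closed_disc_compact) (use r in simp)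
  show "inner j \<subseteq> outer j" using r by (auto simp: closed_disc_def)
  show "outer j \<subseteq> U j" by (auto simp: closed_disc_def)
  show "U j \<subseteq> topspace (base M)" by (rule openin_subset[OF openin_U])
  show "U j \<subseteq> U0 j" by (rule U_U0)
  show "(U0 j, \<phi> j) \<in> charts M" by (rule chart)
qed

lemma finite_sum_bound:
  fixes B :: "'i \<Rightarrow> real"
  assumes "finite I" "i \<in> I" "\<And>i. i \<in> I \<Longrightarrow> 0 \<le> B i"
  shows "B i \<le> (\<Sum>i\<in>I. B i)"
  using member_le_sum[of i I B] assms by blast

text \<open>The bounds of \<open>transition_pair\<close> are continuous on the overlap of \<open>U j\<close> and \<open>U l\<close>, which contains
  the compact set \<open>outer j \<inter> inner l\<close>; finitely many charts and coordinates remain.\<close>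

lemma uniform_transition:
  "\<exists>C\<ge>0. \<forall>j\<in>J. \<forall>l\<in>J. \<forall>p\<in>outer j \<inter> inner l. \<forall>D i k \<mu>.
     D \<in> homogeneous_superderivations M (topspace (base M)) i \<longrightarrow> filtered D k \<longrightarrow> 0 \<le> \<mu> \<longrightarrow>
     leading_bound D k l p \<mu> \<longrightarrow> leading_bound D k j p (C * \<mu>)"
proof -
  define I where "I = (SIGMA j:J. gens j \<times> J)"
  have fI: "finite I" unfolding I_def by (intro finite_SigmaI finite_J finite_cartesian_product finite_coordinate_functions)
  have pair: "\<exists>B. 0 \<le> B \<and> (\<forall>p\<in>outer j \<inter> inner l. \<forall>D i k T \<mu>. D \<in> homogeneous_superderivations M (topspace (base M)) i \<longrightarrow>
     filtered D k \<longrightarrow> T \<subseteq> {..<n} \<longrightarrow> card T = k \<longrightarrow> 0 \<le> \<mu> \<longrightarrow> leading_bound D k l p \<mu> \<longrightarrow> cmod (chart_D D j (U j) g p T) \<le> B * \<mu>)"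
    if jgl: "(j, g, l) \<in> I" for j g l
  proof -
    have j: "j \<in> J" and l: "l \<in> J" and g: "g \<in> gens j" using jgl by (auto simp: I_def)
    obtain b where b: "continuous_map (subtopology (base M) (U l \<inter> U j)) euclideanreal b"
      "\<And>D i k p T \<mu>. \<lbrakk>D \<in> homogeneous_superderivations M (topspace (base M)) i; filtered D k; p \<in> U l \<inter> U j;
       T \<subseteq> {..<n}; card T = k; 0 \<le> \<mu>; leading_bound D k l p \<mu>\<rbrakk> \<Longrightarrow> cmod (chart_D D j (U j) g p T) \<le> b p * \<mu>"
      using transition_pair[OF j l U_open[OF j] gens_closed[OF j g]] unfolding leading_bound_def by blast
    have K: "compactin (base M) (outer j \<inter> inner l)"
      by (rule compactin_Int[OF hausdorff disc_facts(2)[OF j] disc_facts(3)[OF l]])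
    have sub: "outer j \<inter> inner l \<subseteq> U l \<inter> U j" using disc_facts(4,5)[OF l] disc_facts(5)[OF j] by blast
    obtain B where B: "0 \<le> B" "\<And>p. p \<in> outer j \<inter> inner l \<Longrightarrow> norm (b p) \<le> B"
      by (rule bounded_on_compactin[OF K sub b(1)]) (rule that)
    have "cmod (chart_D D j (U j) g p T) \<le> B * \<mu>"
      if p: "p \<in> outer j \<inter> inner l" and h: "D \<in> homogeneous_superderivations M (topspace (base M)) i" "filtered D k"
        "T \<subseteq> {..<n}" "card T = k" "0 \<le> \<mu>" "leading_bound D k l p \<mu>" for p D i k T \<mu>
    proof -
      have "cmod (chart_D D j (U j) g p T) \<le> b p * \<mu>"
        by (rule b(2)[OF h(1,2) subsetD[OF sub p] h(3-6)])
      also have "\<dots> \<le> B * \<mu>" using B(2)[OF p] h(5) by (intro mult_right_mono) auto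
      finally show ?thesis .
    qed
    with B(1) show ?thesis by blast
  qed
  have "\<forall>t\<in>I. \<exists>B. 0 \<le> B \<and> (case t of (j, g, l) \<Rightarrow> \<forall>p\<in>outer j \<inter> inner l. \<forall>D i k T \<mu>. D \<in> homogeneous_superderivations M (topspace (base M)) i \<longrightarrow>
     filtered D k \<longrightarrow> T \<subseteq> {..<n} \<longrightarrow> card T = k \<longrightarrow> 0 \<le> \<mu> \<longrightarrow> leading_bound D k l p \<mu> \<longrightarrow> cmod (chart_D D j (U j) g p T) \<le> B * \<mu>)"
    (is "\<forall>t\<in>I. \<exists>B. 0 \<le> B \<and> ?Q t B")
  proof
    fix t assume t: "t \<in> I"
    obtain j g l where e: "t = (j, g, l)" by (cases t)
    from pair[OF t[unfolded e]] show "\<exists>B. 0 \<le> B \<and> ?Q t B" unfolding e prod.case .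
  qed
  from bchoice[OF this] obtain B where B: "\<forall>t\<in>I. 0 \<le> B t \<and> ?Q t (B t)" by blast
  then have B0: "0 \<le> B t" if "t \<in> I" for t using that by blast
  define C where "C = sum B I"
  have C0: "0 \<le> C" unfolding C_def by (rule sum_nonneg) (rule B0)
  have "leading_bound D k j p (C * \<mu>)"
    if j: "j \<in> J" and l: "l \<in> J" and p: "p \<in> outer j \<inter> inner l" and D: "D \<in> homogeneous_superderivations M (topspace (base M)) i"
      and f: "filtered D k" and mu: "0 \<le> \<mu>" and b: "leading_bound D k l p \<mu>" for j l p D i k \<mu>
    unfolding leading_bound_def
  proof (intro ballI allI impI)
    fix g T assume g: "g \<in> gens j" and T: "T \<subseteq> {..<n}" "card T = k"
    have I: "(j, g, l) \<in> I" using j l g by (simp add: I_def)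
    have "cmod (chart_D D j (U j) g p T) \<le> B (j, g, l) * \<mu>" using conjunct2[OF bspec[OF B I]] p D f T mu b unfolding prod.case by blast
    also have "\<dots> \<le> C * \<mu>" unfolding C_def by (rule mult_right_mono[OF finite_sum_bound[OF fI I B0] mu])
    finally show "cmod (chart_D D j (U j) g p T) \<le> C * \<mu>" .
  qed
  with C0 show ?thesis by blast
qed

text \<open>Every bound \<open>A\<close> over the outer discs can be halved: the net improves it to \<open>A / (2 (C + 1))\<close> on
  the inner discs, and these cover, so the transition carries it back at the cost of a factor \<open>C\<close>.\<close>

lemma leading_zero_if_zero_on_net:
  assumes C: "0 \<le> C" "\<And>j l p D i k \<mu>. \<lbrakk>j \<in> J; l \<in> J; p \<in> outer j \<inter> inner l;
       D \<in> homogeneous_superderivations M (topspace (base M)) i; filtered D k; 0 \<le> \<mu>; leading_bound D k l p \<mu>\<rbrakk> \<Longrightarrow>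
       leading_bound D k j p (C * \<mu>)"
    and N: "\<And>j. j \<in> J \<Longrightarrow> N j \<subseteq> inner j"
      "\<And>j y. \<lbrakk>j \<in> J; y \<in> inner j\<rbrakk> \<Longrightarrow> \<exists>q\<in>N j. dist1 m (\<phi> j y) (\<phi> j q) < r j / (4 * (C + 1))"
    and D: "D \<in> homogeneous_superderivations M (topspace (base M)) i" and filt: "filtered D k"
    and zero: "\<And>j g q S. \<lbrakk>j \<in> J; g \<in> gens j; q \<in> N j; S \<subseteq> {..<n}\<rbrakk> \<Longrightarrow> chart_D D j (U j) g q S = 0"
    and j: "j \<in> J" and p: "p \<in> outer j"
  shows "leading_bound D k j p 0"
proof -
  have hol: "holomorphic_fun m M (U j) (\<lambda>y. chart_D D j (U j) g y S)" if "j \<in> J" "g \<in> gens j" for j g S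
    using model_carrierD(3)[OF chart_D_closed[OF that(1) D U_open[OF that(1)] gens_closed[OF that]]] .
  define I where "I = (SIGMA j:J. gens j \<times> Pow {..<n})"
  have fI: "finite I" unfolding I_def by (intro finite_SigmaI finite_J finite_cartesian_product finite_coordinate_functions) simp
  have single: "\<exists>B. 0 \<le> B \<and> (\<forall>y\<in>outer j. cmod (chart_D D j (U j) g y S) \<le> B)" if "(j, g, S) \<in> I" for j g S
  proof -
    have jg: "j \<in> J" "g \<in> gens j" using that by (auto simp: I_def)
    obtain B where "0 \<le> B" "\<And>y. y \<in> outer j \<Longrightarrow> norm (chart_D D j (U j) g y S) \<le> B"
      by (rule bounded_on_compactin[OF disc_facts(2,5)[OF jg(1)]
            holomorphic_fun_continuous[OF disc_facts(8,7)[OF jg(1)] hol[OF jg, of S]]]) (rule that)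
    then show ?thesis by blast
  qed
  have "\<forall>t\<in>I. \<exists>B. 0 \<le> B \<and> (case t of (j, g, S) \<Rightarrow> \<forall>y\<in>outer j. cmod (chart_D D j (U j) g y S) \<le> B)"
    (is "\<forall>t\<in>I. \<exists>B. 0 \<le> B \<and> ?Q t B")
  proof
    fix t assume t: "t \<in> I"
    obtain j g S where e: "t = (j, g, S)" by (cases t)
    from single[OF t[unfolded e]] show "\<exists>B. 0 \<le> B \<and> ?Q t B" unfolding e prod.case .
  qed
  from bchoice[OF this] obtain B where B: "\<forall>t\<in>I. 0 \<le> B t \<and> ?Q t (B t)" by blast
  then have B0: "0 \<le> B t" if "t \<in> I" for t using that by blast
  define A where "A = sum B I"
  have A0: "0 \<le> A" unfolding A_def by (rule sum_nonneg) (rule B0)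
  have A: "leading_bound D k j y A" if "j \<in> J" "y \<in> outer j" for j y
    unfolding leading_bound_def
  proof (intro ballI allI impI)
    fix g S assume g: "g \<in> gens j" and S: "S \<subseteq> {..<n}"
    have I: "(j, g, S) \<in> I" using that g S by (simp add: I_def)
    show "cmod (chart_D D j (U j) g y S) \<le> A"
    proof (rule order_trans)
      show "cmod (chart_D D j (U j) g y S) \<le> B (j, g, S)"
        using conjunct2[OF bspec[OF B I]] that(2) unfolding prod.case by blast
      show "B (j, g, S) \<le> A" unfolding A_def by (rule finite_sum_bound[OF fI I B0])
    qed
  qed
  have halve: "leading_bound D k j y (A / 2)"
    if A: "0 \<le> A" "\<And>j y. \<lbrakk>j \<in> J; y \<in> outer j\<rbrakk> \<Longrightarrow> leading_bound D k j y A" and j: "j \<in> J" and y: "y \<in> outer j" for A j y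
  proof -
    obtain l where l: "l \<in> J" "y \<in> inner l" using cover disc_facts(5,6)[OF j] y by blast
    interpret L: coordinate_disc m n M "U0 l" "U l" "\<phi> l" "\<theta> l" "c l" "r l" by (rule discs[OF l(1)])
    obtain q where q: "q \<in> N l" "dist1 m (\<phi> l y) (\<phi> l q) < r l / (4 * (C + 1))" using N(2)[OF l] by blast
    have small: "2 * (r l / (4 * (C + 1))) \<le> r l"
    proof -
      have "r l * 2 \<le> r l * (4 * (C + 1))" using L.r C(1) by (intro mult_left_mono) auto
      then show ?thesis using C(1) by (simp add: field_simps)
    qed
    have "leading_bound D k l y (A / (2 * (C + 1)))"
      unfolding leading_bound_def
    proof (intro ballI allI impI)
      fix g S assume g: "g \<in> gens l" and S: "S \<subseteq> {..<n}" "card S = k"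
      have "cmod (chart_D D l (U l) g y S) \<le> 2 * A / r l * (r l / (4 * (C + 1)))"
      proof (rule L.small_if_zero_on_net[OF hol[OF l(1) g] _ small l(2) _ q(2) zero[OF l(1) g q(1) S(1)]])
        show "cmod (chart_D D l (U l) g u S) \<le> A" if "u \<in> outer l" for u
          using A(2)[OF l(1) that] g S by (simp add: leading_bound_def)
        show "q \<in> inner l" using q(1) N(1)[OF l(1)] by blast
      qed
      also have "\<dots> = A / (2 * (C + 1))" using L.r C(1) by (simp add: field_simps)
      finally show "cmod (chart_D D l (U l) g y S) \<le> A / (2 * (C + 1))" .
    qed
    then have "leading_bound D k j y (C * (A / (2 * (C + 1))))"
      by (intro C(2)[OF j l(1) IntI[OF y l(2)] D filt]) (use A(1) C(1) in auto)
    moreover have "C * (A / (2 * (C + 1))) \<le> A / 2"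
    proof -
      have "C * A \<le> (C + 1) * A" using A(1) by (intro mult_right_mono) auto
      then show ?thesis using C(1) by (simp add: field_simps)
    qed
    ultimately show ?thesis unfolding leading_bound_def by (meson order_trans)
  qed
  have bd: "leading_bound D k j y (A / 2 ^ N)" if "j \<in> J" "y \<in> outer j" for N j y
    using that
  proof (induction N arbitrary: j y)
    case (Suc N)
    have "leading_bound D k j y (A / 2 ^ N / 2)"
      by (rule halve[OF _ Suc.IH Suc.prems]) (use A0 in auto)
    then show ?case by (simp add: field_simps)
  qed (use A in simp)
  show ?thesis unfolding leading_bound_def
  proof (intro ballI allI impI)
    fix g S assume g: "g \<in> gens j" "S \<subseteq> {..<n}" "card S = k"
    have "cmod (chart_D D j (U j) g p S) \<le> A / 2 ^ N" for N
      using bd[OF j p] g unfolding leading_bound_def by blast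
    then show "cmod (chart_D D j (U j) g p S) \<le> 0"
      by (intro LIMSEQ_le_const[OF LIMSEQ_divide_realpow_zero[of 2 A]]) auto
  qed
qed

text \<open>The chart \<open>j\<close> is given, but a point \<open>q\<close> need not lie in the disc of \<open>j\<close>. It lies in the disc of
  some \<open>l\<close>, and the transition from \<open>l\<close> to \<open>j\<close> with bound \<open>0\<close> applies.\<close>

lemma filtered_Suc:
  assumes D: "D \<in> homogeneous_superderivations M (topspace (base M)) i" and filt: "filtered D k"
    and zero: "\<And>j p. \<lbrakk>j \<in> J; p \<in> inner j\<rbrakk> \<Longrightarrow> leading_bound D k j p 0"
  shows "filtered D (Suc k)"
  unfolding filtered_def
proof (intro ballI)
  fix j V h q assume j: "j \<in> J" and V: "V \<in> opens_in M (U j)" and h: "h \<in> model_carrier m n M V" and q: "q \<in> V"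
  have "chart_D D j V h q T = 0" if T: "T \<subseteq> {..<n}" "card T = k" for T
  proof -
    have "q \<in> topspace (base M)" using q opens_inD(2)[OF V] disc_facts(6)[OF j] by blast
    then obtain l where l: "l \<in> J" "q \<in> inner l" using cover by blast
    then have ql: "q \<in> U l \<inter> V" using q disc_facts(4,5)[OF l(1)] by blast
    obtain b where b: "\<And>D i k p T \<mu>. \<lbrakk>D \<in> homogeneous_superderivations M (topspace (base M)) i; filtered D k; p \<in> U l \<inter> V;
       T \<subseteq> {..<n}; card T = k; 0 \<le> \<mu>; leading_bound D k l p \<mu>\<rbrakk> \<Longrightarrow> cmod (chart_D D j V h p T) \<le> b p * \<mu>"
      using transition_pair[OF j l(1) V h] unfolding leading_bound_def by blast
    show ?thesis using b[OF D filt ql T _ zero[OF l]] by simp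
  qed
  then show "chart_D D j V h q \<in> ext_filt n (Suc k)"
    using filt j V h q by (simp add: ext_filt_Suc filtered_def)
qed

lemma filtered_beyond_zero:
  assumes D: "D \<in> homogeneous_superderivations M (topspace (base M)) i" and filt: "filtered D (Suc n)"
    and V: "openin (base M) V" and f: "f \<in> carrier (sections M V)"
  shows "D V f = \<zero>\<^bsub>sections M V\<^esub>"
proof -
  have VX: "V \<in> opens_in M (topspace (base M))" using V openin_subset by (auto simp: opens_in_def)
  have lin: "complex_linear (sections M V) (sections M V) (D V)"
    using D VX by (simp add: homogeneous_superderivations_def)
  then have Df: "D V f \<in> carrier (sections M V)" using f by (auto simp: complex_linear_def)
  show ?thesis
  proof (rule section_zero_locally[OF V Df])
    show "(\<Union>j\<in>J. V \<inter> U j) = V"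
    proof
      show "V \<subseteq> (\<Union>j\<in>J. V \<inter> U j)"
      proof
        fix x assume x: "x \<in> V"
        then have "x \<in> topspace (base M)" using openin_subset[OF V] by blast
        then obtain j where "j \<in> J" "x \<in> inner j" using cover by blast
        with x show "x \<in> (\<Union>j\<in>J. V \<inter> U j)" using disc_facts(4,5)[of j] by blast
      qed
    qed blast
    fix W assume "W \<in> (\<lambda>j. V \<inter> U j) ` J"
    then obtain j where j: "j \<in> J" "W = V \<inter> U j" by blast
    interpret L: derivation_in_chart m n M "U0 j" "U j" "\<phi> j" "\<theta> j" D i by (rule derivation_chart[OF j(1) D])
    have WV: "W \<in> opens_in M V" and WU: "W \<in> opens_in M (U j)" using V L.openin_U j(2) by (auto simp: opens_in_def)
    show "openin (base M) W" by (rule opens_inD(1)[OF WV])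
    let ?g = "restr M V W f"
    have g: "?g \<in> carrier (sections M W)" by (rule restr_closed[OF WV V f])
    have "D W ?g = \<zero>\<^bsub>sections M W\<^esub>"
    proof (rule L.theta_eq_zeroI[OF WU L.D_closed[OF WU g]])
      fix x S assume x: "x \<in> W"
      have "chart_D D j W (\<theta> j W ?g) x \<in> ext_filt n (Suc n)"
        using filt j(1) WU L.theta_closed[OF WU g] x by (simp add: filtered_def)
      then have "L.local_D W (\<theta> j W ?g) x S = 0"
        unfolding chart_D_eq_local_D[OF j(1) D] by (rule ext_filt_beyond)
      then show "\<theta> j W (D W ?g) x S = 0" by (simp add: L.theta_D[OF WU g])
    qed
    moreover have "restr M V W (D V f) = D W ?g"
      using D VX WV f by (simp add: homogeneous_superderivations_def)
    ultimately show "restr M V W (D V f) = \<zero>\<^bsub>sections M W\<^esub>" by simp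
  qed
qed

text \<open>The mesh of the net depends only on the radii and on the transition constant, so one net serves
  in every degree of the induction.\<close>

theorem zero_if_zero_on_net:
  "\<exists>N. (\<forall>j\<in>J. finite (N j) \<and> N j \<subseteq> U j) \<and>
    (\<forall>D i. D \<in> homogeneous_superderivations M (topspace (base M)) i \<longrightarrow>
      (\<forall>j\<in>J. \<forall>g\<in>gens j. \<forall>q\<in>N j. \<forall>S. S \<subseteq> {..<n} \<longrightarrow> chart_D D j (U j) g q S = 0) \<longrightarrow>
      (\<forall>V f. openin (base M) V \<longrightarrow> f \<in> carrier (sections M V) \<longrightarrow> D V f = \<zero>\<^bsub>sections M V\<^esub>))"
proof -
  obtain C where C: "0 \<le> C" "\<And>j l p D i k \<mu>. \<lbrakk>j \<in> J; l \<in> J; p \<in> outer j \<inter> inner l;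
       D \<in> homogeneous_superderivations M (topspace (base M)) i; filtered D k; 0 \<le> \<mu>; leading_bound D k l p \<mu>\<rbrakk> \<Longrightarrow>
       leading_bound D k j p (C * \<mu>)"
    using uniform_transition by blast
  have "\<exists>N. finite N \<and> N \<subseteq> inner j \<and> (\<forall>y\<in>inner j. \<exists>q\<in>N. dist1 m (\<phi> j y) (\<phi> j q) < r j / (4 * (C + 1)))"
    if "j \<in> J" for j
  proof -
    interpret coordinate_disc m n M "U0 j" "U j" "\<phi> j" "\<theta> j" "c j" "r j" by (rule discs[OF that])
    have "0 < r j / (4 * (C + 1))" using r C(1) by simp
    then obtain N where "finite N" "N \<subseteq> inner j" "\<And>y. y \<in> inner j \<Longrightarrow> \<exists>q\<in>N. dist1 m (\<phi> j y) (\<phi> j q) < r j / (4 * (C + 1))"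
      by (rule finite_net) (rule that)
    then show ?thesis by blast
  qed
  then have "\<forall>j\<in>J. \<exists>N. finite N \<and> N \<subseteq> inner j \<and> (\<forall>y\<in>inner j. \<exists>q\<in>N. dist1 m (\<phi> j y) (\<phi> j q) < r j / (4 * (C + 1)))"
    by blast
  from bchoice[OF this] obtain N where "\<forall>j\<in>J. finite (N j) \<and> N j \<subseteq> inner j \<and>
    (\<forall>y\<in>inner j. \<exists>q\<in>N j. dist1 m (\<phi> j y) (\<phi> j q) < r j / (4 * (C + 1)))" by blast
  note * = bspec[OF this]
  have N: "finite (N j)" "N j \<subseteq> inner j" if "j \<in> J" for j using *[OF that] by blast+
  have net: "\<exists>q\<in>N j. dist1 m (\<phi> j y) (\<phi> j q) < r j / (4 * (C + 1))" if "j \<in> J" "y \<in> inner j" for j y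
    using bspec[OF conjunct2[OF conjunct2[OF *[OF that(1)]]] that(2)] .
  have main: "D V f = \<zero>\<^bsub>sections M V\<^esub>"
    if D: "D \<in> homogeneous_superderivations M (topspace (base M)) i"
      and zero: "\<forall>j\<in>J. \<forall>g\<in>gens j. \<forall>q\<in>N j. \<forall>S. S \<subseteq> {..<n} \<longrightarrow> chart_D D j (U j) g q S = 0"
      and V: "openin (base M) V" "f \<in> carrier (sections M V)" for D i V f
  proof -
    have "filtered D k" for k
    proof (induction k)
      case 0
      show ?case unfolding filtered_def ext_filt_0
        using model_carrierD(2)[OF chart_D_closed[OF _ D]] by blast
    next
      case (Suc k)
      show ?case
      proof (rule filtered_Suc[OF D Suc.IH])
        fix j p assume j: "j \<in> J" and p: "p \<in> inner j"
        then have "p \<in> outer j" using disc_facts(4) by blast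
        show "leading_bound D k j p 0"
        proof (rule leading_zero_if_zero_on_net[where N = N and C = C and i = i])
          show "leading_bound D k j p (C * \<mu>)"
            if "j \<in> J" "l \<in> J" "p \<in> outer j \<inter> inner l" "D \<in> homogeneous_superderivations M (topspace (base M)) i"
              "filtered D k" "0 \<le> \<mu>" "leading_bound D k l p \<mu>" for j l p D i k \<mu>
            using that by (rule C(2))
          show "\<exists>q\<in>N j. dist1 m (\<phi> j y) (\<phi> j q) < r j / (4 * (C + 1))" if "j \<in> J" "y \<in> inner j" for j y
            using that by (rule net)
          show "chart_D D j (U j) g q S = 0" if "j \<in> J" "g \<in> gens j" "q \<in> N j" "S \<subseteq> {..<n}" for j g q S
            using zero that by simp
          show "N j \<subseteq> inner j" if "j \<in> J" for j using that by (rule N(2))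
        qed (fact C(1) D Suc.IH j \<open>p \<in> outer j\<close>)+
      qed
    qed
    then show ?thesis by (rule filtered_beyond_zero[OF D _ V])
  qed
  show ?thesis
  proof (rule exI[of _ N], intro conjI allI impI)
    show "\<forall>j\<in>J. finite (N j) \<and> N j \<subseteq> U j" using N disc_facts(4,5) by blast
  qed (rule main, assumption+)
qed

end

section \<open>The complex vector space of super vector fields\<close>

lemma cring_complex_field: "cring complex_field"
proof (rule cringI)
  show "abelian_group complex_field"
  proof (rule abelian_groupI)
    fix x assume "x \<in> carrier complex_field"
    show "\<exists>y\<in>carrier complex_field. y \<oplus>\<^bsub>complex_field\<^esub> x = \<zero>\<^bsub>complex_field\<^esub>"
      by (intro bexI[of _ "- x"]) (auto simp: complex_field_def)
  qed (auto simp: complex_field_def)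
  show "comm_monoid complex_field"
    by (rule comm_monoidI) (auto simp: complex_field_def)
qed (auto simp: complex_field_def algebra_simps)

text \<open>The algebra behind the closure of the superderivations under the vector space operations.\<close>

lemma leibniz_rules:
  fixes A :: "(complex, 'b, 'x) superalgebra_scheme" (structure)
  assumes A: "complex_superalgebra A"
    and f: "f \<in> carrier A" and g: "g \<in> carrier A" and x: "x \<in> carrier A" and y: "y \<in> carrier A"
  shows "\<lbrakk>x' \<in> carrier A; y' \<in> carrier A\<rbrakk> \<Longrightarrow> (x \<otimes> g \<oplus> s \<odot> (f \<otimes> y)) \<oplus> (x' \<otimes> g \<oplus> s \<odot> (f \<otimes> y')) =
      (x \<oplus> x') \<otimes> g \<oplus> s \<odot> (f \<otimes> (y \<oplus> y'))" (is "\<lbrakk>_; _\<rbrakk> \<Longrightarrow> ?add")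
    and "c \<odot> (x \<otimes> g \<oplus> s \<odot> (f \<otimes> y)) = (c \<odot> x) \<otimes> g \<oplus> s \<odot> (f \<otimes> (c \<odot> y))"
    and "\<zero> = \<zero> \<otimes> g \<oplus> s \<odot> (f \<otimes> \<zero>)"
proof -
  interpret R: ring A using A by (simp add: complex_superalgebra_def)
  interpret V: Module.module complex_field A using A by (simp add: complex_superalgebra_def)
  have c: "c \<in> carrier complex_field" for c by (simp add: complex_field_def)
  note closed = R.m_closed R.a_closed V.smult_closed[OF c] f g x y
  show ?add if "x' \<in> carrier A" "y' \<in> carrier A"
    using that by (simp add: closed R.l_distr R.r_distr V.smult_r_distr[OF c] R.a_ac)
  have "c \<odot> (s \<odot> (f \<otimes> y)) = s \<odot> (c \<odot> (f \<otimes> y))"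
    using V.smult_assoc1[OF c c R.m_closed[OF f y], of c s] V.smult_assoc1[OF c c R.m_closed[OF f y], of s c]
    by (simp add: complex_field_def mult.commute)
  then show "c \<odot> (x \<otimes> g \<oplus> s \<odot> (f \<otimes> y)) = (c \<odot> x) \<otimes> g \<oplus> s \<odot> (f \<otimes> (c \<odot> y))"
    by (simp add: closed V.smult_r_distr[OF c] complex_superalgebra.smult_mult_left[OF A] complex_superalgebra.smult_mult_right[OF A])
  show "\<zero> = \<zero> \<otimes> g \<oplus> s \<odot> (f \<otimes> \<zero>)"
    by (simp add: f g V.smult_r_null[OF c])
qed

context complex_supermanifold
begin

abbreviation "X \<equiv> topspace (base M)"

text \<open>All families of maps that are undefined where a superderivation is. Equality in this set is
  pointwise equality, so the vector space axioms for \<open>Vec M\<close> reduce to those for the sections.\<close>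

definition section_maps :: "('p set \<Rightarrow> 's \<Rightarrow> 's) set" where
  "section_maps = {D \<in> extensional (opens_in M X). \<forall>V\<in>opens_in M X.
     D V \<in> extensional (carrier (sections M V)) \<and> D V \<in> carrier (sections M V) \<rightarrow> carrier (sections M V)}"

lemma section_maps_eqI:
  assumes "D \<in> section_maps" "E \<in> section_maps"
    and "\<And>V f. \<lbrakk>V \<in> opens_in M X; f \<in> carrier (sections M V)\<rbrakk> \<Longrightarrow> D V f = E V f"
  shows "D = E"
proof (rule extensionalityI[of D "opens_in M X" E])
  show "D V = E V" if "V \<in> opens_in M X" for V
    by (rule extensionalityI[of _ "carrier (sections M V)"]) (use assms that in \<open>auto simp: section_maps_def\<close>)
qed (use assms in \<open>auto simp: section_maps_def\<close>)

lemma section_maps_closed: "\<lbrakk>D \<in> section_maps; V \<in> opens_in M X; f \<in> carrier (sections M V)\<rbrakk> \<Longrightarrow> D V f \<in> carrier (sections M V)"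
  by (auto simp: section_maps_def)

lemma der_apply:
  assumes "V \<in> opens_in M X" "f \<in> carrier (sections M V)"
  shows "der_zero M X V f = \<zero>\<^bsub>sections M V\<^esub>" "der_add M X D E V f = D V f \<oplus>\<^bsub>sections M V\<^esub> E V f"
    "der_smult M X a D V f = a \<odot>\<^bsub>sections M V\<^esub> D V f"
  using assms by (simp_all add: der_zero_def der_add_def der_smult_def)

lemma sections_module_closed:
  assumes "V \<in> opens_in M X"
  shows "Module.module complex_field (sections M V)"
    "\<zero>\<^bsub>sections M V\<^esub> \<in> carrier (sections M V)"
    "\<lbrakk>f \<in> carrier (sections M V); g \<in> carrier (sections M V)\<rbrakk> \<Longrightarrow> f \<oplus>\<^bsub>sections M V\<^esub> g \<in> carrier (sections M V)"
    "f \<in> carrier (sections M V) \<Longrightarrow> a \<odot>\<^bsub>sections M V\<^esub> f \<in> carrier (sections M V)"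
proof -
  show m: "Module.module complex_field (sections M V)"
    using sections_superalgebra[OF opens_inD(1)[OF assms]] by (simp add: complex_superalgebra_def)
  show "\<zero>\<^bsub>sections M V\<^esub> \<in> carrier (sections M V)" by (rule sections_zero_closed[OF opens_inD(1)[OF assms]])
  show "\<lbrakk>f \<in> carrier (sections M V); g \<in> carrier (sections M V)\<rbrakk> \<Longrightarrow> f \<oplus>\<^bsub>sections M V\<^esub> g \<in> carrier (sections M V)"
    by (rule abelian_monoid.a_closed[OF abelian_group.axioms(1)[OF Module.module.axioms(2)[OF m]]])
  show "f \<in> carrier (sections M V) \<Longrightarrow> a \<odot>\<^bsub>sections M V\<^esub> f \<in> carrier (sections M V)"
    using Module.module.smult_closed[OF m] by (simp add: complex_field_def)
qed

lemma section_maps_ops: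
  "der_zero M X \<in> section_maps"
  "\<lbrakk>D \<in> section_maps; E \<in> section_maps\<rbrakk> \<Longrightarrow> der_add M X D E \<in> section_maps"
  "D \<in> section_maps \<Longrightarrow> der_smult M X a D \<in> section_maps"
  by (simp_all add: section_maps_def der_zero_def der_add_def der_smult_def sections_module_closed(2-4) Pi_iff)

lemma homogeneous_superderivationsI:
  assumes D: "D \<in> section_maps"
    and add: "\<And>V f g. \<lbrakk>V \<in> opens_in M X; f \<in> carrier (sections M V); g \<in> carrier (sections M V)\<rbrakk> \<Longrightarrow>
      D V (f \<oplus>\<^bsub>sections M V\<^esub> g) = D V f \<oplus>\<^bsub>sections M V\<^esub> D V g"
    and smult: "\<And>V a f. \<lbrakk>V \<in> opens_in M X; f \<in> carrier (sections M V)\<rbrakk> \<Longrightarrow>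
      D V (a \<odot>\<^bsub>sections M V\<^esub> f) = a \<odot>\<^bsub>sections M V\<^esub> D V f"
    and homog: "\<And>V j f. \<lbrakk>V \<in> opens_in M X; f \<in> homog (sections M V) j\<rbrakk> \<Longrightarrow> D V f \<in> homog (sections M V) (i + j)"
    and leibniz: "\<And>V j f g. \<lbrakk>V \<in> opens_in M X; f \<in> homog (sections M V) j; g \<in> carrier (sections M V)\<rbrakk> \<Longrightarrow>
      D V (f \<otimes>\<^bsub>sections M V\<^esub> g) = (D V f \<otimes>\<^bsub>sections M V\<^esub> g) \<oplus>\<^bsub>sections M V\<^esub>
               koszul_sign i j \<odot>\<^bsub>sections M V\<^esub> (f \<otimes>\<^bsub>sections M V\<^esub> D V g)"
    and restr: "\<And>V W f. \<lbrakk>V \<in> opens_in M X; W \<in> opens_in M V; f \<in> carrier (sections M V)\<rbrakk> \<Longrightarrow>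
      restr M V W (D V f) = D W (restr M V W f)"
  shows "D \<in> homogeneous_superderivations M X i"
  unfolding homogeneous_superderivations_def complex_linear_def
  using D add smult homog leibniz restr by (simp add: section_maps_def image_subset_iff)

lemma homogeneous_superderivationsD:
  assumes "D \<in> homogeneous_superderivations M X i"
  shows "D \<in> section_maps"
    and "\<And>V f g. \<lbrakk>V \<in> opens_in M X; f \<in> carrier (sections M V); g \<in> carrier (sections M V)\<rbrakk> \<Longrightarrow>
      D V (f \<oplus>\<^bsub>sections M V\<^esub> g) = D V f \<oplus>\<^bsub>sections M V\<^esub> D V g"
    and "\<And>V a f. \<lbrakk>V \<in> opens_in M X; f \<in> carrier (sections M V)\<rbrakk> \<Longrightarrow>
      D V (a \<odot>\<^bsub>sections M V\<^esub> f) = a \<odot>\<^bsub>sections M V\<^esub> D V f"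
    and "\<And>V j f. \<lbrakk>V \<in> opens_in M X; f \<in> homog (sections M V) j\<rbrakk> \<Longrightarrow> D V f \<in> homog (sections M V) (i + j)"
    and "\<And>V j f g. \<lbrakk>V \<in> opens_in M X; f \<in> homog (sections M V) j; g \<in> carrier (sections M V)\<rbrakk> \<Longrightarrow>
      D V (f \<otimes>\<^bsub>sections M V\<^esub> g) = (D V f \<otimes>\<^bsub>sections M V\<^esub> g) \<oplus>\<^bsub>sections M V\<^esub>
               koszul_sign i j \<odot>\<^bsub>sections M V\<^esub> (f \<otimes>\<^bsub>sections M V\<^esub> D V g)"
    and "\<And>V W f. \<lbrakk>V \<in> opens_in M X; W \<in> opens_in M V; f \<in> carrier (sections M V)\<rbrakk> \<Longrightarrow>
      restr M V W (D V f) = D W (restr M V W f)"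
  using assms by (auto simp: homogeneous_superderivations_def complex_linear_def section_maps_def image_subset_iff)

lemma homog_closed:
  assumes V: "V \<in> opens_in M X"
  shows "f \<in> homog (sections M V) j \<Longrightarrow> f \<in> carrier (sections M V)"
    "\<zero>\<^bsub>sections M V\<^esub> \<in> homog (sections M V) j"
    "\<lbrakk>f \<in> homog (sections M V) j; g \<in> homog (sections M V) j\<rbrakk> \<Longrightarrow> f \<oplus>\<^bsub>sections M V\<^esub> g \<in> homog (sections M V) j"
    "f \<in> homog (sections M V) j \<Longrightarrow> a \<odot>\<^bsub>sections M V\<^esub> f \<in> homog (sections M V) j"
proof -
  note S = sections_superalgebra[OF opens_inD(1)[OF V]]
  note m = sections_module_closed(1)[OF V]
  note E = Module.module.submoduleE[OF m complex_superalgebra.homog_submodule[OF S]]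
  show "f \<in> homog (sections M V) j \<Longrightarrow> f \<in> carrier (sections M V)" using E(1) by blast
  show "\<lbrakk>f \<in> homog (sections M V) j; g \<in> homog (sections M V) j\<rbrakk> \<Longrightarrow> f \<oplus>\<^bsub>sections M V\<^esub> g \<in> homog (sections M V) j" by (rule E(5))
  show sm: "f \<in> homog (sections M V) j \<Longrightarrow> a \<odot>\<^bsub>sections M V\<^esub> f \<in> homog (sections M V) j" for a f
    by (rule E(4)) (auto simp: complex_field_def)
  obtain f where f: "f \<in> homog (sections M V) j" using E(2) by blast
  then have "0 \<odot>\<^bsub>sections M V\<^esub> f = \<zero>\<^bsub>sections M V\<^esub>"
    using sections_smult_zero[OF opens_inD(1)[OF V]] E(1) by blast
  then show "\<zero>\<^bsub>sections M V\<^esub> \<in> homog (sections M V) j" using sm[OF f, of 0] by simp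
qed

lemma restr_linear:
  assumes V: "V \<in> opens_in M X" and W: "W \<in> opens_in M V"
  shows "\<lbrakk>f \<in> carrier (sections M V); g \<in> carrier (sections M V)\<rbrakk> \<Longrightarrow>
      restr M V W (f \<oplus>\<^bsub>sections M V\<^esub> g) = restr M V W f \<oplus>\<^bsub>sections M W\<^esub> restr M V W g"
    "f \<in> carrier (sections M V) \<Longrightarrow> restr M V W (a \<odot>\<^bsub>sections M V\<^esub> f) = a \<odot>\<^bsub>sections M W\<^esub> restr M V W f"
  using restr_hom[OF opens_inD(1)[OF V] opens_inD[OF W]] by (simp_all add: superalgebra_hom_def complex_linear_def)

lemma homogeneous_superderivations_zero: "der_zero M X \<in> homogeneous_superderivations M X i"
proof (rule homogeneous_superderivationsI[OF section_maps_ops(1)])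
  fix V assume V: "V \<in> opens_in M X"
  note S = sections_superalgebra[OF opens_inD(1)[OF V]] and c = sections_module_closed[OF V]
  interpret m: Module.module complex_field "sections M V" by (rule c(1))
  have cf: "a \<in> carrier complex_field" for a by (simp add: complex_field_def)
  show "der_zero M X V (f \<oplus>\<^bsub>sections M V\<^esub> g) = der_zero M X V f \<oplus>\<^bsub>sections M V\<^esub> der_zero M X V g"
    if "f \<in> carrier (sections M V)" "g \<in> carrier (sections M V)" for f g
    using that V c by (simp add: der_apply)
  show "der_zero M X V (a \<odot>\<^bsub>sections M V\<^esub> f) = a \<odot>\<^bsub>sections M V\<^esub> der_zero M X V f"
    if "f \<in> carrier (sections M V)" for a f
    using that V c m.smult_r_null[OF cf] by (simp add: der_apply)
  show "der_zero M X V f \<in> homog (sections M V) (i + j)" if "f \<in> homog (sections M V) j" for j f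
    using that V homog_closed[OF V] by (simp add: der_apply)
  show "der_zero M X V (f \<otimes>\<^bsub>sections M V\<^esub> g) = (der_zero M X V f \<otimes>\<^bsub>sections M V\<^esub> g) \<oplus>\<^bsub>sections M V\<^esub>
               koszul_sign i j \<odot>\<^bsub>sections M V\<^esub> (f \<otimes>\<^bsub>sections M V\<^esub> der_zero M X V g)"
    if "f \<in> homog (sections M V) j" "g \<in> carrier (sections M V)" for j f g
  proof -
    note f = homog_closed(1)[OF V that(1)]
    have "f \<otimes>\<^bsub>sections M V\<^esub> g \<in> carrier (sections M V)"
      using S f that(2) by (simp add: complex_superalgebra_def ring.ring_simprules)
    then show ?thesis using leibniz_rules(3)[OF S f that(2) f that(2)] V f that(2) by (simp add: der_apply)
  qed
  show "restr M V W (der_zero M X V f) = der_zero M X W (restr M V W f)"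
    if "W \<in> opens_in M V" "f \<in> carrier (sections M V)" for W f
    using that V restr_zero[OF opens_inD(1)[OF V]] restr_closed[OF that(1) opens_inD(1)[OF V] that(2)] opens_in_trans[OF that(1) V]
    by (simp add: der_apply)
qed

lemma homogeneous_superderivations_add:
  assumes D: "D \<in> homogeneous_superderivations M X i" and E: "E \<in> homogeneous_superderivations M X i"
  shows "der_add M X D E \<in> homogeneous_superderivations M X i"
proof (rule homogeneous_superderivationsI)
  note d = homogeneous_superderivationsD[OF D] and e = homogeneous_superderivationsD[OF E]
  show "der_add M X D E \<in> section_maps" by (rule section_maps_ops(2)[OF d(1) e(1)])
  fix V assume V: "V \<in> opens_in M X"
  note S = sections_superalgebra[OF opens_inD(1)[OF V]] and c = sections_module_closed[OF V]
  note dc = section_maps_closed[OF d(1) V] and ec = section_maps_closed[OF e(1) V]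
  interpret m: Module.module complex_field "sections M V" by (rule c(1))
  have cf: "a \<in> carrier complex_field" for a by (simp add: complex_field_def)
  show "der_add M X D E V (f \<oplus>\<^bsub>sections M V\<^esub> g) = der_add M X D E V f \<oplus>\<^bsub>sections M V\<^esub> der_add M X D E V g"
    if "f \<in> carrier (sections M V)" "g \<in> carrier (sections M V)" for f g
    using that V c(3) dc ec by (simp add: der_apply d(2) e(2) m.M.a_ac)
  show "der_add M X D E V (a \<odot>\<^bsub>sections M V\<^esub> f) = a \<odot>\<^bsub>sections M V\<^esub> der_add M X D E V f"
    if "f \<in> carrier (sections M V)" for a f
    using that V c(4) dc ec by (simp add: der_apply d(3) e(3) m.smult_r_distr[OF cf])
  show "der_add M X D E V f \<in> homog (sections M V) (i + j)" if "f \<in> homog (sections M V) j" for j f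
    using that V homog_closed(3)[OF V] homog_closed(1)[OF V that] d(4)[OF V that] e(4)[OF V that] by (simp add: der_apply)
  show "der_add M X D E V (f \<otimes>\<^bsub>sections M V\<^esub> g) = (der_add M X D E V f \<otimes>\<^bsub>sections M V\<^esub> g) \<oplus>\<^bsub>sections M V\<^esub>
               koszul_sign i j \<odot>\<^bsub>sections M V\<^esub> (f \<otimes>\<^bsub>sections M V\<^esub> der_add M X D E V g)"
    if "f \<in> homog (sections M V) j" "g \<in> carrier (sections M V)" for j f g
  proof -
    note f = homog_closed(1)[OF V that(1)] and g = that(2)
    have fg: "f \<otimes>\<^bsub>sections M V\<^esub> g \<in> carrier (sections M V)"
      using S f that(2) by (simp add: complex_superalgebra_def ring.ring_simprules)
    show ?thesis
      unfolding der_apply[OF V fg] der_apply[OF V f] der_apply[OF V g] d(5)[OF V that] e(5)[OF V that]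
      by (rule leibniz_rules(1)[OF S f g dc[OF f] dc[OF g] ec[OF f] ec[OF g]])
  qed
  show "restr M V W (der_add M X D E V f) = der_add M X D E W (restr M V W f)"
    if "W \<in> opens_in M V" "f \<in> carrier (sections M V)" for W f
    using that V dc ec restr_linear(1)[OF V that(1)] restr_closed[OF that(1) opens_inD(1)[OF V] that(2)] opens_in_trans[OF that(1) V]
    by (simp add: der_apply d(6) e(6))
qed

lemma homogeneous_superderivations_smult:
  assumes D: "D \<in> homogeneous_superderivations M X i"
  shows "der_smult M X b D \<in> homogeneous_superderivations M X i"
proof (rule homogeneous_superderivationsI)
  note d = homogeneous_superderivationsD[OF D]
  show "der_smult M X b D \<in> section_maps" by (rule section_maps_ops(3)[OF d(1)])
  fix V assume V: "V \<in> opens_in M X"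
  note S = sections_superalgebra[OF opens_inD(1)[OF V]] and c = sections_module_closed[OF V]
  note dc = section_maps_closed[OF d(1) V]
  interpret m: Module.module complex_field "sections M V" by (rule c(1))
  have cf: "a \<in> carrier complex_field" for a by (simp add: complex_field_def)
  show "der_smult M X b D V (f \<oplus>\<^bsub>sections M V\<^esub> g) = der_smult M X b D V f \<oplus>\<^bsub>sections M V\<^esub> der_smult M X b D V g"
    if "f \<in> carrier (sections M V)" "g \<in> carrier (sections M V)" for f g
    using that V c(3) dc by (simp add: der_apply d(2) m.smult_r_distr[OF cf])
  show "der_smult M X b D V (a \<odot>\<^bsub>sections M V\<^esub> f) = a \<odot>\<^bsub>sections M V\<^esub> der_smult M X b D V f"
    if f: "f \<in> carrier (sections M V)" for a f
    using V c(4)[OF f] m.smult_assoc1[OF cf cf dc[OF f], of a b] m.smult_assoc1[OF cf cf dc[OF f], of b a]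
    by (simp add: der_apply d(3) f complex_field_def mult.commute)
  show "der_smult M X b D V f \<in> homog (sections M V) (i + j)" if "f \<in> homog (sections M V) j" for j f
    using that V homog_closed(4)[OF V] homog_closed(1)[OF V that] d(4)[OF V that] by (simp add: der_apply)
  show "der_smult M X b D V (f \<otimes>\<^bsub>sections M V\<^esub> g) = (der_smult M X b D V f \<otimes>\<^bsub>sections M V\<^esub> g) \<oplus>\<^bsub>sections M V\<^esub>
               koszul_sign i j \<odot>\<^bsub>sections M V\<^esub> (f \<otimes>\<^bsub>sections M V\<^esub> der_smult M X b D V g)"
    if "f \<in> homog (sections M V) j" "g \<in> carrier (sections M V)" for j f g
  proof -
    note f = homog_closed(1)[OF V that(1)] and g = that(2)
    have fg: "f \<otimes>\<^bsub>sections M V\<^esub> g \<in> carrier (sections M V)"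
      using S f that(2) by (simp add: complex_superalgebra_def ring.ring_simprules)
    show ?thesis
      unfolding der_apply[OF V fg] der_apply[OF V f] der_apply[OF V g] d(5)[OF V that]
      by (rule leibniz_rules(2)[OF S f g dc[OF f] dc[OF g]])
  qed
  show "restr M V W (der_smult M X b D V f) = der_smult M X b D W (restr M V W f)"
    if "W \<in> opens_in M V" "f \<in> carrier (sections M V)" for W f
    using that V dc restr_linear(2)[OF V that(1)] restr_closed[OF that(1) opens_inD(1)[OF V] that(2)] opens_in_trans[OF that(1) V]
    by (simp add: der_apply d(6))
qed

lemma superderivations_closed:
  "superderivations M X \<subseteq> section_maps"
  "der_zero M X \<in> superderivations M X"
  "\<lbrakk>D \<in> superderivations M X; E \<in> superderivations M X\<rbrakk> \<Longrightarrow> der_add M X D E \<in> superderivations M X"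
  "D \<in> superderivations M X \<Longrightarrow> der_smult M X a D \<in> superderivations M X"
proof -
  note hom = homogeneous_superderivationsD(1)
  show sub: "superderivations M X \<subseteq> section_maps"
    unfolding superderivations_def using section_maps_ops(2) hom by blast
  have I: "der_add M X D0 D1 \<in> superderivations M X"
    if "D0 \<in> homogeneous_superderivations M X 0" "D1 \<in> homogeneous_superderivations M X 1" for D0 D1
    using that unfolding superderivations_def by blast
  have cf: "a \<in> carrier complex_field" for a by (simp add: complex_field_def)
  note z = homogeneous_superderivations_zero
  have "der_add M X (der_zero M X) (der_zero M X) = der_zero M X"
  proof (rule section_maps_eqI[OF section_maps_ops(2)[OF section_maps_ops(1) section_maps_ops(1)] section_maps_ops(1)])
    fix V f assume V: "V \<in> opens_in M X" and f: "f \<in> carrier (sections M V)"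
    interpret m: Module.module complex_field "sections M V" by (rule sections_module_closed(1)[OF V])
    show "der_add M X (der_zero M X) (der_zero M X) V f = der_zero M X V f"
      using sections_module_closed(2)[OF V] by (simp add: der_apply[OF V f])
  qed
  then show "der_zero M X \<in> superderivations M X" using I[OF z z] by simp
  show "der_add M X D E \<in> superderivations M X" if DE: "D \<in> superderivations M X" "E \<in> superderivations M X" for D E
  proof -
    obtain D0 D1 E0 E1 where d: "D0 \<in> homogeneous_superderivations M X 0" "D1 \<in> homogeneous_superderivations M X 1"
      "D = der_add M X D0 D1" "E0 \<in> homogeneous_superderivations M X 0" "E1 \<in> homogeneous_superderivations M X 1" "E = der_add M X E0 E1"
      using DE unfolding superderivations_def by blast
    have "der_add M X D E = der_add M X (der_add M X D0 E0) (der_add M X D1 E1)"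
      unfolding d(3,6)
    proof (rule section_maps_eqI)
      fix V f assume V: "V \<in> opens_in M X" and f: "f \<in> carrier (sections M V)"
      interpret m: Module.module complex_field "sections M V" by (rule sections_module_closed(1)[OF V])
      note c = section_maps_closed[OF hom[OF d(1)] V f] section_maps_closed[OF hom[OF d(2)] V f]
        section_maps_closed[OF hom[OF d(4)] V f] section_maps_closed[OF hom[OF d(5)] V f]
      show "der_add M X (der_add M X D0 D1) (der_add M X E0 E1) V f = der_add M X (der_add M X D0 E0) (der_add M X D1 E1) V f"
        using c sections_module_closed(3)[OF V] by (simp add: der_apply[OF V f] m.M.a_ac)
    qed (intro section_maps_ops hom[OF d(1)] hom[OF d(2)] hom[OF d(4)] hom[OF d(5)])+
    then show ?thesis using I[OF homogeneous_superderivations_add[OF d(1,4)] homogeneous_superderivations_add[OF d(2,5)]] by simp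
  qed
  show "der_smult M X a D \<in> superderivations M X" if D: "D \<in> superderivations M X"
  proof -
    obtain D0 D1 where d: "D0 \<in> homogeneous_superderivations M X 0" "D1 \<in> homogeneous_superderivations M X 1"
      "D = der_add M X D0 D1"
      using D unfolding superderivations_def by blast
    have "der_smult M X a D = der_add M X (der_smult M X a D0) (der_smult M X a D1)"
      unfolding d(3)
    proof (rule section_maps_eqI)
      fix V f assume V: "V \<in> opens_in M X" and f: "f \<in> carrier (sections M V)"
      interpret m: Module.module complex_field "sections M V" by (rule sections_module_closed(1)[OF V])
      show "der_smult M X a (der_add M X D0 D1) V f = der_add M X (der_smult M X a D0) (der_smult M X a D1) V f"
        using m.smult_r_distr[OF cf section_maps_closed[OF hom[OF d(1)] V f] section_maps_closed[OF hom[OF d(2)] V f]]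
        by (simp add: der_apply[OF V f])
    qed (intro section_maps_ops hom[OF d(1)] hom[OF d(2)])+
    then show ?thesis using I[OF homogeneous_superderivations_smult[OF d(1)] homogeneous_superderivations_smult[OF d(2)]] by simp
  qed
qed

lemma Vec_simps:
  "carrier (Vec M) = superderivations M X" "D \<oplus>\<^bsub>Vec M\<^esub> E = der_add M X D E"
  "\<zero>\<^bsub>Vec M\<^esub> = der_zero M X" "a \<odot>\<^bsub>Vec M\<^esub> D = der_smult M X a D"
  by (simp_all add: Vec_def tangent_sheaf_def)

lemma Vec_module: "Module.module complex_field (Vec M)"
proof -
  note sd = superderivations_closed
  have sm: "D \<in> section_maps" if "D \<in> superderivations M X" for D using that sd(1) by blast
  have cf: "a \<in> carrier complex_field" for a by (simp add: complex_field_def)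
  note ops = section_maps_ops sm sd(2-4)
  note cl = section_maps_closed[OF sm]
  have ag: "abelian_group (Vec M)"
  proof (rule abelian_groupI; unfold Vec_simps)
    show "der_add M X (der_add M X D E) F = der_add M X D (der_add M X E F)"
      if "D \<in> superderivations M X" "E \<in> superderivations M X" "F \<in> superderivations M X" for D E F
    proof (rule section_maps_eqI)
      fix V f assume V: "V \<in> opens_in M X" and f: "f \<in> carrier (sections M V)"
      interpret m: Module.module complex_field "sections M V" by (rule sections_module_closed(1)[OF V])
      show "der_add M X (der_add M X D E) F V f = der_add M X D (der_add M X E F) V f"
        using that cl V f by (simp add: der_apply[OF V f] m.M.a_assoc)
    qed (use ops that in simp_all)
    show "der_add M X D E = der_add M X E D" if "D \<in> superderivations M X" "E \<in> superderivations M X" for D E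
    proof (rule section_maps_eqI)
      fix V f assume V: "V \<in> opens_in M X" and f: "f \<in> carrier (sections M V)"
      interpret m: Module.module complex_field "sections M V" by (rule sections_module_closed(1)[OF V])
      show "der_add M X D E V f = der_add M X E D V f"
        using that cl V f by (simp add: der_apply[OF V f] m.M.a_comm)
    qed (use ops that in simp_all)
    show "der_add M X (der_zero M X) D = D" if "D \<in> superderivations M X" for D
    proof (rule section_maps_eqI)
      fix V f assume V: "V \<in> opens_in M X" and f: "f \<in> carrier (sections M V)"
      interpret m: Module.module complex_field "sections M V" by (rule sections_module_closed(1)[OF V])
      show "der_add M X (der_zero M X) D V f = D V f"
        using that cl V f by (simp add: der_apply[OF V f])
    qed (use ops that in simp_all)
    show "\<exists>E\<in>superderivations M X. der_add M X E D = der_zero M X" if D: "D \<in> superderivations M X" for D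
    proof (rule bexI[of _ "der_smult M X (-1) D"])
      show "der_add M X (der_smult M X (-1) D) D = der_zero M X"
      proof (rule section_maps_eqI)
        fix V f assume V: "V \<in> opens_in M X" and f: "f \<in> carrier (sections M V)"
        interpret m: Module.module complex_field "sections M V" by (rule sections_module_closed(1)[OF V])
        note c = cl[OF D V f]
        have "(-1) \<odot>\<^bsub>sections M V\<^esub> D V f \<oplus>\<^bsub>sections M V\<^esub> D V f = 0 \<odot>\<^bsub>sections M V\<^esub> D V f"
          using m.smult_l_distr[OF cf cf c, of "-1" 1] m.smult_one[OF c] by (simp add: complex_field_def)
        then show "der_add M X (der_smult M X (-1) D) D V f = der_zero M X V f"
          using sections_smult_zero[OF opens_inD(1)[OF V] c] by (simp add: der_apply[OF V f])
      qed (use ops that in simp_all)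
    qed (use ops that in simp_all)
  qed (use sd(2,3) in simp_all)
  show ?thesis
  proof (rule Module.moduleI[OF cring_complex_field ag]; unfold Vec_simps)
    fix a b D E assume D: "D \<in> superderivations M X"
    show "der_smult M X a D \<in> superderivations M X" by (rule sd(4)[OF D])
    show "der_smult M X (a \<oplus>\<^bsub>complex_field\<^esub> b) D = der_add M X (der_smult M X a D) (der_smult M X b D)"
    proof (rule section_maps_eqI)
      fix V f assume V: "V \<in> opens_in M X" and f: "f \<in> carrier (sections M V)"
      interpret m: Module.module complex_field "sections M V" by (rule sections_module_closed(1)[OF V])
      show "der_smult M X (a \<oplus>\<^bsub>complex_field\<^esub> b) D V f = der_add M X (der_smult M X a D) (der_smult M X b D) V f"
        using m.smult_l_distr[OF cf cf cl[OF D V f]] by (simp add: der_apply[OF V f])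
    qed (use ops D in simp_all)
    show "der_smult M X (a \<otimes>\<^bsub>complex_field\<^esub> b) D = der_smult M X a (der_smult M X b D)"
    proof (rule section_maps_eqI)
      fix V f assume V: "V \<in> opens_in M X" and f: "f \<in> carrier (sections M V)"
      interpret m: Module.module complex_field "sections M V" by (rule sections_module_closed(1)[OF V])
      show "der_smult M X (a \<otimes>\<^bsub>complex_field\<^esub> b) D V f = der_smult M X a (der_smult M X b D) V f"
        using m.smult_assoc1[OF cf cf cl[OF D V f]] by (simp add: der_apply[OF V f])
    qed (use ops D in simp_all)
    show "der_smult M X \<one>\<^bsub>complex_field\<^esub> D = D"
    proof (rule section_maps_eqI)
      fix V f assume V: "V \<in> opens_in M X" and f: "f \<in> carrier (sections M V)"
      interpret m: Module.module complex_field "sections M V" by (rule sections_module_closed(1)[OF V])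
      show "der_smult M X \<one>\<^bsub>complex_field\<^esub> D V f = D V f"
        using m.smult_one[OF cl[OF D V f]] by (simp add: der_apply[OF V f])
    qed (use ops D in simp_all)
    assume E: "E \<in> superderivations M X"
    show "der_smult M X a (der_add M X D E) = der_add M X (der_smult M X a D) (der_smult M X a E)"
    proof (rule section_maps_eqI)
      fix V f assume V: "V \<in> opens_in M X" and f: "f \<in> carrier (sections M V)"
      interpret m: Module.module complex_field "sections M V" by (rule sections_module_closed(1)[OF V])
      show "der_smult M X a (der_add M X D E) V f = der_add M X (der_smult M X a D) (der_smult M X a E) V f"
        using m.smult_r_distr[OF cf cl[OF D V f] cl[OF E V f]] by (simp add: der_apply[OF V f])
    qed (use ops D E in simp_all)
  qed
qed

end

theorem proposition6p2:
  fixes m n :: nat and M :: "('p, 's) supermfd"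
  assumes "complex_supermanifold m n M"
    and "compact_space (base M)"
  shows "complex_finite_dimensional (Vec M)"
proof -
  interpret complex_supermanifold m n M by (rule assms(1))
  obtain J :: "'p set" and U0 U \<phi> \<theta> c r where dc: "disc_cover m n M J U0 U \<phi> \<theta> c r"
    using disc_cover_exists[OF assms(2)] by blast
  interpret C: disc_cover m n M J U0 U \<phi> \<theta> c r by (rule dc)
  from C.zero_if_zero_on_net obtain N where *: "(\<forall>j\<in>J. finite (N j) \<and> N j \<subseteq> U j) \<and>
    (\<forall>D i. D \<in> homogeneous_superderivations M X i \<longrightarrow>
      (\<forall>j\<in>J. \<forall>g\<in>C.gens j. \<forall>q\<in>N j. \<forall>S. S \<subseteq> {..<n} \<longrightarrow> C.chart_D D j (U j) g q S = 0) \<longrightarrow>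
      (\<forall>V f. openin (base M) V \<longrightarrow> f \<in> carrier (sections M V) \<longrightarrow> D V f = \<zero>\<^bsub>sections M V\<^esub>))" ..
  have N: "finite (N j)" "N j \<subseteq> U j" if "j \<in> J" for j using conjunct1[OF *] that by blast+
  have zero: "D V f = \<zero>\<^bsub>sections M V\<^esub>" if "D \<in> homogeneous_superderivations M X i"
      "\<And>j g q S. \<lbrakk>j \<in> J; g \<in> C.gens j; q \<in> N j; S \<subseteq> {..<n}\<rbrakk> \<Longrightarrow> C.chart_D D j (U j) g q S = 0"
      "openin (base M) V" "f \<in> carrier (sections M V)" for D i V f
    using conjunct2[OF *] that by blast
  define I where "I = (SIGMA j:J. C.gens j \<times> N j \<times> Pow {..<n})"
  define coeff where "coeff t D = (case t of (j, g, q, S) \<Rightarrow> C.chart_D D j (U j) g q S)" for t D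
  have IJ: "j \<in> J" "g \<in> C.gens j" "q \<in> U j" if "(j, g, q, S) \<in> I" for j g q S
    using that N(2) by (auto simp: I_def)
  have lin: "C.chart_D (der_add M X D E) j (U j) g q S = C.chart_D D j (U j) g q S + C.chart_D E j (U j) g q S"
      "C.chart_D (der_smult M X a D) j (U j) g q S = a * C.chart_D D j (U j) g q S"
    if "j \<in> J" "g \<in> C.gens j" "q \<in> U j" and D: "D \<in> section_maps" "E \<in> section_maps" for j g q S D E a
  proof -
    interpret L: coordinate_disc m n M "U0 j" "U j" "\<phi> j" "\<theta> j" "c j" "r j" by (rule C.discs[OF that(1)])
    note U = C.U_open[OF that(1)]
    have UX: "U j \<in> opens_in M X" using L.openin_U openin_subset by (auto simp: opens_in_def)
    note l = L.lift_closed[OF U C.gens_closed[OF that(1,2)]]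
    note Dl = section_maps_closed[OF D(1) UX l] and El = section_maps_closed[OF D(2) UX l]
    show "C.chart_D (der_add M X D E) j (U j) g q S = C.chart_D D j (U j) g q S + C.chart_D E j (U j) g q S"
      unfolding C.chart_D_def der_apply[OF UX l] L.theta_add[OF U Dl El] using that(3) by (simp add: model_add_def)
    show "C.chart_D (der_smult M X a D) j (U j) g q S = a * C.chart_D D j (U j) g q S"
      unfolding C.chart_D_def der_apply[OF UX l] L.theta_smult[OF U Dl] using that(3) by (simp add: model_smult_def)
  qed
  show ?thesis
  proof (rule complex_finite_dimensionalI[where I = I and l = coeff, OF Vec_module])
    show "finite I" unfolding I_def
      by (intro finite_SigmaI C.finite_J finite_cartesian_product finite_coordinate_functions N(1)) simp_all
    show "coeff t (D \<oplus>\<^bsub>Vec M\<^esub> E) = coeff t D + coeff t E"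
      if t: "t \<in> I" and D: "D \<in> carrier (Vec M)" "E \<in> carrier (Vec M)" for t D E
    proof -
      obtain j g q S where e: "t = (j, g, q, S)" by (cases t)
      have sm: "D \<in> section_maps" "E \<in> section_maps" using D superderivations_closed(1) by (auto simp: Vec_simps)
      show ?thesis unfolding e coeff_def prod.case Vec_simps by (rule lin(1)[OF IJ[OF t[unfolded e]] sm])
    qed
    show "coeff t (a \<odot>\<^bsub>Vec M\<^esub> D) = a * coeff t D"
      if t: "t \<in> I" and D: "D \<in> carrier (Vec M)" for t a D
    proof -
      obtain j g q S where e: "t = (j, g, q, S)" by (cases t)
      have sm: "D \<in> section_maps" using D superderivations_closed(1) by (auto simp: Vec_simps)
      show ?thesis unfolding e coeff_def prod.case Vec_simps by (rule lin(2)[OF IJ[OF t[unfolded e]] sm sm])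
    qed
    show "D = \<zero>\<^bsub>Vec M\<^esub>" if D: "D \<in> carrier (Vec M)" and z: "\<And>t. t \<in> I \<Longrightarrow> coeff t D = 0" for D
    proof -
      obtain D0 D1 where d: "D0 \<in> homogeneous_superderivations M X 0" "D1 \<in> homogeneous_superderivations M X 1"
        "D = der_add M X D0 D1"
        using D unfolding Vec_simps superderivations_def by blast
      note sm = homogeneous_superderivationsD(1)[OF d(1)] homogeneous_superderivationsD(1)[OF d(2)]
      have coeff_zero: "C.chart_D D0 j (U j) g q S = 0 \<and> C.chart_D D1 j (U j) g q S = 0"
        if j: "j \<in> J" and g: "g \<in> C.gens j" and q: "q \<in> N j" and S: "S \<subseteq> {..<n}" for j g q S
      proof -
        have qU: "q \<in> U j" using N(2)[OF j] q by blast
        note U = C.U_open[OF j] and gc = C.gens_closed[OF j g]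
        obtain \<pi> where \<pi>: "has_parity (U j) \<pi> g" using coordinate_functions_parity[OF g] by blast
        interpret L0: derivation_in_chart m n M "U0 j" "U j" "\<phi> j" "\<theta> j" D0 0 by (rule C.derivation_chart[OF j d(1)])
        interpret L1: derivation_in_chart m n M "U0 j" "U j" "\<phi> j" "\<theta> j" D1 1 by (rule C.derivation_chart[OF j d(2)])
        have p0: "has_parity (U j) (0 + \<pi>) (C.chart_D D0 j (U j) g)"
          unfolding C.chart_D_eq_local_D[OF j d(1)] by (rule L0.local_D_parity[OF U gc \<pi>])
        have p1: "has_parity (U j) (1 + \<pi>) (C.chart_D D1 j (U j) g)"
          unfolding C.chart_D_eq_local_D[OF j d(2)] by (rule L1.local_D_parity[OF U gc \<pi>])
        have "(j, g, q, S) \<in> I" using j g q S by (simp add: I_def)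
        from z[OF this] have sum: "C.chart_D D0 j (U j) g q S + C.chart_D D1 j (U j) g q S = 0"
          unfolding coeff_def prod.case d(3) lin(1)[OF j g qU sm] .
        \<comment> \<open>The two parts of \<open>D g\<close> have opposite parities, so at most one of the summands is nonzero.\<close>
        have ne: "(0::bit) + \<pi> \<noteq> 1 + \<pi>" by simp
        show ?thesis
        proof (cases "of_nat (card S) = 0 + \<pi>")
          case True
          then have "C.chart_D D1 j (U j) g q S = 0" using p1 qU ne unfolding has_parity_def by metis
          then show ?thesis using sum by simp
        next
          case False
          then have "C.chart_D D0 j (U j) g q S = 0" using p0 qU unfolding has_parity_def by metis
          then show ?thesis using sum by simp
        qed
      qed
      show ?thesis unfolding Vec_simps
      proof (rule section_maps_eqI[OF _ section_maps_ops(1)])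
        show "D \<in> section_maps" unfolding d(3) by (rule section_maps_ops(2)[OF sm])
        fix V f assume V: "V \<in> opens_in M X" and f: "f \<in> carrier (sections M V)"
        interpret m: Module.module complex_field "sections M V" by (rule sections_module_closed(1)[OF V])
        have "D0 V f = \<zero>\<^bsub>sections M V\<^esub>" by (rule zero[OF d(1) _ opens_inD(1)[OF V] f]) (use coeff_zero in blast)
        moreover have "D1 V f = \<zero>\<^bsub>sections M V\<^esub>" by (rule zero[OF d(2) _ opens_inD(1)[OF V] f]) (use coeff_zero in blast)
        ultimately show "D V f = der_zero M X V f"
          unfolding d(3) der_apply[OF V f] using sections_module_closed(2)[OF V] by simp
      qed
    qed
  qed
qed

end
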